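(* Let $n\ge1$. Every continuous, epi-translation invariant valuation $Z:\mathrm{Conv}_{\mathrm{sc}}(\mathbb{R}^n)\to\mathbb{R}$ that is epi-homogeneous of degree $1$ can be approximated, uniformly on compact subsets of $\mathrm{Conv}_{\mathrm{sc}}(\mathbb{R}^n)$, by a sequence $(Z_j)_j$ of valuations on $\mathrm{Conv}_{\mathrm{sc}}(\mathbb{R}^n)$ given by $$Z_j(u)=\int_{\mathbb{R}^n}\phi_j(x)\,u^*(x)\,dx,$$ where $\phi_j:\mathbb{R}^n\to\mathbb{R}$ are Lebesgue integrable functions such that the following holds: 1. There exists $R>0$ such that $\phi_j$ is supported on $B_R(0)$ for all $j\in\mathbb{N}$. 2. $\int_{\mathbb{R}^n}\phi_j(x)\,l(x)\,dx=0$ for all affine maps $l:\mathbb{R}^n\to\mathbb{R}$ and all $j\in\mathbb{N}$.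
   Context: $\mathrm{Conv}(\mathbb{R}^n)$ is the set of all convex, lower semi-continuous, proper (not identically $+\infty$) functions $u:\mathbb{R}^n\to(-\infty,+\infty]$. $\mathrm{Conv}_{\mathrm{sc}}(\mathbb{R}^n)=\{u\in\mathrm{Conv}(\mathbb{R}^n):\lim_{|x|\to\infty}u(x)/|x|=+\infty\}$. The Fenchel-Legendre transform of $u$ is $u^*(y)=\sup_{x\in\mathbb{R}^n}(x\cdot y-u(x))$, $y\in\mathbb{R}^n$; it is a finite convex function on $\mathbb{R}^n$ for $u\in\mathrm{Conv}_{\mathrm{sc}}(\mathbb{R}^n)$. $B_R(0)$ denotes the ball of radius $R$ centered at the origin of $\mathbb{R}^n$. $\mathrm{Conv}_{\mathrm{sc}}(\mathbb{R}^n)$ carries the (metrizable) topology of epi-convergence: $u_j$ epi-converges to $u$ if for every $x\in\mathbb{R}^n$ (i) $u(x)\le\liminf_j u_j(x_j)$ for every sequence $x_j\to x$, and (ii) there is a sequence $x_j\to x$ with $u(x)=\lim_j u_j(x_j)$. A functional $Z:\mathrm{Conv}_{\mathrm{sc}}(\mathbb{R}^n)\to\mathbb{R}$ is a valuation if $Z(u\wedge v)+Z(u\vee v)=Z(u)+Z(v)$ whenever $u,v$, their pointwise minimum $u\wedge v$ and their pointwise maximum $u\vee v$ all belong to $\mathrm{Conv}_{\mathrm{sc}}(\mathbb{R}^n)$. It is epi-translation invariant if $Z(u(\cdot-x)+c)=Z(u)$ for all $u$, all $x\in\mathbb{R}^n$ and $c\in\mathbb{R}$. It is epi-homogeneous of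 degree $i$ if $Z(t\cdot u(\cdot/t))=t^iZ(u)$ for all $u$ and all $t>0$, where $t\cdot u(\cdot/t)$ denotes the function $x\mapsto t\,u(x/t)$. *)

theory Defs
  imports "HOL-Analysis.Analysis"
begin

text \<open>Functions with values in $(-\infty,+\infty]$ are represented as \<open>ereal\<close>-valued functions that
  never take the value \<open>-\<infinity>\<close>; all the \<open>ereal\<close> sums and products below are then unambiguous.\<close>

definition convex_ereal :: "('a::real_vector \<Rightarrow> ereal) \<Rightarrow> bool" where
  "convex_ereal u \<longleftrightarrow>
    (\<forall>x y. \<forall>t::real. 0 < t \<and> t < 1 \<longrightarrow>
      u ((1 - t) *\<^sub>R x + t *\<^sub>R y) \<le> ereal (1 - t) * u x + ereal t * u y)"

definition lower_semicontinuous :: "('a::topological_space \<Rightarrow> ereal) \<Rightarrow> bool" where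
  "lower_semicontinuous u \<longleftrightarrow> (\<forall>x. u x \<le> Liminf (at x) u)"

definition Conv :: "('a::euclidean_space \<Rightarrow> ereal) set" where
  "Conv = {u. (\<forall>x. u x \<noteq> -\<infinity>) \<and> (\<exists>x. u x \<noteq> \<infinity>) \<and> convex_ereal u \<and> lower_semicontinuous u}"

definition Conv_sc :: "('a::euclidean_space \<Rightarrow> ereal) set" where
  "Conv_sc = {u \<in> Conv. ((\<lambda>x. u x / ereal (norm x)) \<longlongrightarrow> \<infinity>) at_infinity}"

definition fenchel :: "('a::euclidean_space \<Rightarrow> ereal) \<Rightarrow> 'a \<Rightarrow> ereal" where
  "fenchel u y = (SUP x. ereal (x \<bullet> y) - u x)"

definition epi_converges ::
    "(nat \<Rightarrow> 'a::euclidean_space \<Rightarrow> ereal) \<Rightarrow> ('a \<Rightarrow> ereal) \<Rightarrow> bool" where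
  "epi_converges us u \<longleftrightarrow>
    (\<forall>x. (\<forall>xs. xs \<longlonglongrightarrow> x \<longrightarrow> u x \<le> liminf (\<lambda>j. us j (xs j))) \<and>
         (\<exists>xs. xs \<longlonglongrightarrow> x \<and> (\<lambda>j. us j (xs j)) \<longlonglongrightarrow> u x))"

text \<open>The topology of epi-convergence on \<open>Conv_sc\<close>: epi-convergence on \<open>Conv_sc\<close> is induced by a
  metric, and the open sets of a metrizable topology are exactly the sets that are sequentially
  open, so the topology is recovered from its convergent sequences.\<close>

definition epi_open :: "('a::euclidean_space \<Rightarrow> ereal) set \<Rightarrow> bool" where
  "epi_open U \<longleftrightarrow> U \<subseteq> Conv_sc \<and>
    (\<forall>u\<in>U. \<forall>us. range us \<subseteq> Conv_sc \<and> epi_converges us u \<longrightarrow> (\<forall>\<^sub>F j in sequentially. us j \<in> U))"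

definition epi_topology :: "('a::euclidean_space \<Rightarrow> ereal) topology" where
  "epi_topology = topology epi_open"

lemma istopology_epi_open: "istopology epi_open"
  unfolding istopology_def
proof (intro conjI allI impI)
  fix S T :: "('a \<Rightarrow> ereal) set"
  assume "epi_open S" "epi_open T"
  then show "epi_open (S \<inter> T)"
    unfolding epi_open_def by (auto intro: eventually_conj)
next
  fix \<K> :: "('a \<Rightarrow> ereal) set set"
  assume K: "\<forall>K\<in>\<K>. epi_open K"
  show "epi_open (\<Union>\<K>)"
    unfolding epi_open_def
  proof (intro conjI ballI allI impI)
    show "\<Union>\<K> \<subseteq> Conv_sc" using K unfolding epi_open_def by blast
  next
    fix u and us :: "nat \<Rightarrow> 'a \<Rightarrow> ereal"
    assume "u \<in> \<Union>\<K>" and us: "range us \<subseteq> Conv_sc \<and> epi_converges us u"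
    then obtain U where U: "U \<in> \<K>" "u \<in> U" by blast
    then have "\<forall>\<^sub>F j in sequentially. us j \<in> U"
      using K us unfolding epi_open_def by blast
    then show "\<forall>\<^sub>F j in sequentially. us j \<in> \<Union>\<K>"
      by (rule eventually_mono) (use U in blast)
  qed
qed

lemma openin_epi_topology: "openin epi_topology U \<longleftrightarrow> epi_open U"
  by (simp add: epi_topology_def istopology_epi_open topology_inverse')

lemma topspace_epi_topology: "topspace epi_topology = Conv_sc"
proof -
  have "epi_open Conv_sc"
    unfolding epi_open_def by (auto intro!: always_eventually)
  then show ?thesis
    unfolding topspace_def openin_epi_topology by (auto simp: epi_open_def)
qed

text \<open>A functional on \<open>Conv_sc\<close> is a function on the whole type of which only the values on
  \<open>Conv_sc\<close> are relevant.\<close>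

definition valuation :: "(('a::euclidean_space \<Rightarrow> ereal) \<Rightarrow> real) \<Rightarrow> bool" where
  "valuation Z \<longleftrightarrow>
    (\<forall>u v. u \<in> Conv_sc \<and> v \<in> Conv_sc \<and>
        (\<lambda>x. min (u x) (v x)) \<in> Conv_sc \<and> (\<lambda>x. max (u x) (v x)) \<in> Conv_sc \<longrightarrow>
      Z (\<lambda>x. min (u x) (v x)) + Z (\<lambda>x. max (u x) (v x)) = Z u + Z v)"

definition epi_translation_invariant :: "(('a::euclidean_space \<Rightarrow> ereal) \<Rightarrow> real) \<Rightarrow> bool" where
  "epi_translation_invariant Z \<longleftrightarrow>
    (\<forall>u\<in>Conv_sc. \<forall>x. \<forall>c::real. Z (\<lambda>y. u (y - x) + ereal c) = Z u)"

definition epi_homogeneous :: "nat \<Rightarrow> (('a::euclidean_space \<Rightarrow> ereal) \<Rightarrow> real) \<Rightarrow> bool" where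
  "epi_homogeneous i Z \<longleftrightarrow>
    (\<forall>u\<in>Conv_sc. \<forall>t::real. 0 < t \<longrightarrow> Z (\<lambda>x. ereal t * u ((1 / t) *\<^sub>R x)) = t ^ i * Z u)"

end

(* Conjugation turns Z into a valuation mu on finite convex functions that is continuous for
   pointwise convergence, 1-homogeneous and invariant under adding affine functions. The valuation
   property for hinges max 0 l, l affine, together with homogeneity gives
   mu (f + max 0 l) = mu f + mu (max 0 l) for every convex f. The functions g with
   mu (f + g) = mu f + mu g for all f form a cone closed under limits, integrals and those
   differences that are convex; it contains the convex ridge functions, hence, via products of
   cosines, the sum of a Gaussian and a multiple of the squared norm, hence, by mollification,
   every convex function. So mu is additive. Additivity and continuity force mu to depend only on
   the values on some ball, and applying mu to the translates of the hat function
   max 0 (1 - j |x|) = max 1 (j |x|) - j |x| gives the densities phi_j: they represent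
   f |-> mu (f * hat_j), which converges to mu uniformly on compact sets by an Arzela-Ascoli
   argument. *)

theory Submission
  imports
    Defs
    "HOL-Probability.Probability"
    "HOL-Complex_Analysis.Great_Picard"
    "HOL-Real_Asymp.Real_Asymp"
begin

section \<open>Finite convex functions\<close>

text \<open>Convexity is the obstacle throughout: the functional is controlled on convex functions
  only, and the valuation identity speaks only of pairs whose minimum is convex. In dimension one,
  affine functions plus mixtures of hinges already approximate every convex function, so additivity
  for hinges would suffice. In higher dimensions sums of ridge functions form only a small part of
  the convex functions, and subtraction becomes unavoidable; hence the insistence on convex
  differences. A cosine is not convex, which explains the quadratic corrections that accompany every
  cosine and every Gaussian. They are harmless because quadratic functions are additive themselves
  and can be subtracted at the end, provided that a squared norm remains to keep the difference
  convex. General convex functions are therefore reached through functions that equal the squared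
  norm up to a constant outside a ball; what they have beyond the squared norm is a nonnegative
  function of compact support, which can be mollified.\<close>

lemma convex_on_max_UNIV:
  fixes f g :: "'a::real_vector \<Rightarrow> real"
  assumes "convex_on UNIV f" "convex_on UNIV g"
  shows "convex_on UNIV (\<lambda>x. max (f x) (g x))"
proof (rule convex_onI)
  fix t :: real and x y :: 'a
  assume t: "0 < t" "t < 1"
  let ?z = "(1 - t) *\<^sub>R x + t *\<^sub>R y"
  have "f ?z \<le> (1 - t) * f x + t * f y" "g ?z \<le> (1 - t) * g x + t * g y"
    using t assms by (auto intro!: convex_onD)
  moreover have "(1 - t) * f x + t * f y \<le> (1 - t) * max (f x) (g x) + t * max (f y) (g y)"
    "(1 - t) * g x + t * g y \<le> (1 - t) * max (f x) (g x) + t * max (f y) (g y)"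
    using t by (auto intro!: add_mono mult_left_mono)
  ultimately show "max (f ?z) (g ?z) \<le> (1 - t) * max (f x) (g x) + t * max (f y) (g y)"
    by linarith
qed simp

lemma convex_on_affine:
  fixes w :: "'a::real_inner"
  shows "convex_on UNIV (\<lambda>x. w \<bullet> x + c)"
proof (rule convex_onI)
  fix t :: real and x y :: 'a
  show "w \<bullet> ((1 - t) *\<^sub>R x + t *\<^sub>R y) + c \<le> (1 - t) * (w \<bullet> x + c) + t * (w \<bullet> y + c)"
    by (simp add: inner_add_right inner_diff_right algebra_simps)
qed simp

lemma convex_on_limit:
  fixes F :: "nat \<Rightarrow> 'a::real_vector \<Rightarrow> real"
  assumes "\<And>j. convex_on UNIV (F j)" "\<And>x. (\<lambda>j. F j x) \<longlonglongrightarrow> f x"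
  shows "convex_on UNIV f"
proof (rule convex_onI)
  fix t :: real and x y :: 'a
  assume t: "0 < t" "t < 1"
  show "f ((1 - t) *\<^sub>R x + t *\<^sub>R y) \<le> (1 - t) * f x + t * f y"
  proof (rule LIMSEQ_le)
    show "(\<lambda>j. F j ((1 - t) *\<^sub>R x + t *\<^sub>R y)) \<longlonglongrightarrow> f ((1 - t) *\<^sub>R x + t *\<^sub>R y)"
      by (rule assms)
    show "(\<lambda>j. (1 - t) * F j x + t * F j y) \<longlonglongrightarrow> (1 - t) * f x + t * f y"
      by (intro tendsto_intros assms)
    show "\<exists>N. \<forall>n\<ge>N. F n ((1 - t) *\<^sub>R x + t *\<^sub>R y) \<le> (1 - t) * F n x + t * F n y"
      using t assms(1) by (intro exI[of _ 0] allI impI convex_onD) auto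
  qed
qed simp

lemma convex_on_compose_affine:
  fixes f :: "'b::real_vector \<Rightarrow> real" and A :: "'a::real_vector \<Rightarrow> 'b"
  assumes "convex_on UNIV f" "\<And>x y t. A ((1 - t) *\<^sub>R x + t *\<^sub>R y) = (1 - t) *\<^sub>R A x + t *\<^sub>R A y"
  shows "convex_on UNIV (\<lambda>x. f (A x))"
  by (rule convex_onI) (use assms in \<open>auto intro!: convex_onD\<close>)

lemma convex_on_norm_sq: "convex_on UNIV (\<lambda>x::'a::real_inner. (norm x)\<^sup>2)"
proof (rule convex_onI)
  fix t :: real and x y :: 'a
  assume t: "0 < t" "t < 1"
  have "(1 - t) * (norm x)\<^sup>2 + t * (norm y)\<^sup>2 - (norm ((1 - t) *\<^sub>R x + t *\<^sub>R y))\<^sup>2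
      = t * (1 - t) * (norm (x - y))\<^sup>2"
    unfolding power2_norm_eq_inner by (simp add: inner_simps inner_commute algebra_simps)
  moreover have "0 \<le> t * (1 - t) * (norm (x - y))\<^sup>2" using t by simp
  ultimately show "(norm ((1 - t) *\<^sub>R x + t *\<^sub>R y))\<^sup>2 \<le> (1 - t) * (norm x)\<^sup>2 + t * (norm y)\<^sup>2"
    by linarith
qed simp

lemma convex_continuous: "convex_on UNIV (f::'a::euclidean_space \<Rightarrow> real) \<Longrightarrow> continuous_on S f"
  using convex_on_continuous[of UNIV f] continuous_on_subset by blast

lemma convex_on_integral:
  fixes g :: "'b \<Rightarrow> 'a::real_vector \<Rightarrow> real"
  assumes "\<And>y. convex_on UNIV (g y)" "\<And>x. integrable M (\<lambda>y. g y x)"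
  shows "convex_on UNIV (\<lambda>x. \<integral>y. g y x \<partial>M)"
proof (rule convex_onI)
  fix t :: real and x z :: 'a
  assume t: "0 < t" "t < 1"
  have "(\<integral>y. g y ((1 - t) *\<^sub>R x + t *\<^sub>R z) \<partial>M) \<le> (\<integral>y. (1 - t) * g y x + t * g y z \<partial>M)"
    by (rule integral_mono) (use t assms in \<open>auto intro!: convex_onD\<close>)
  also have "\<dots> = (1 - t) * (\<integral>y. g y x \<partial>M) + t * (\<integral>y. g y z \<partial>M)"
    using assms by simp
  finally show "(\<integral>y. g y ((1 - t) *\<^sub>R x + t *\<^sub>R z) \<partial>M) \<le> \<dots>" .
qed simp

text \<open>Prolong the segment from \<open>x\<close> through \<open>y\<close> by length 1. The new
  point stays in the ball of radius \<open>r + 1\<close>, where the oscillation of \<open>f\<close>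
  is at most \<open>2 * B\<close>, and \<open>y\<close> divides the longer segment at a fraction of
  at most \<open>norm (x - y)\<close>.\<close>

lemma convex_lipschitz:
  fixes f :: "'a::euclidean_space \<Rightarrow> real"
  assumes f: "convex_on UNIV f" and B: "\<And>x. norm x \<le> r + 1 \<Longrightarrow> \<bar>f x\<bar> \<le> B"
    and x: "norm x \<le> r" and y: "norm y \<le> r"
  shows "\<bar>f x - f y\<bar> \<le> 2 * B * norm (x - y)"
proof -
  have *: "f y - f x \<le> 2 * B * norm (x - y)" if x: "norm x \<le> r" and y: "norm y \<le> r" for x y
  proof (cases "x = y")
    case False
    define d where "d = norm (y - x)"
    have d: "d > 0" using False by (simp add: d_def)
    define z where "z = y + (1 / d) *\<^sub>R (y - x)"
    define t where "t = d / (1 + d)"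
    have t: "0 \<le> t" "t \<le> 1" "t \<le> d" "1 - t = 1 / (1 + d)" using d by (auto simp: t_def field_simps)
    have nz: "norm z \<le> r + 1"
      using norm_triangle_ineq[of y "(1 / d) *\<^sub>R (y - x)"] y d by (simp add: z_def d_def)
    have "(1 + d) *\<^sub>R ((1 - t) *\<^sub>R x + t *\<^sub>R z) = x + d *\<^sub>R z"
    proof -
      have "(1 + d) * (1 - t) = 1" "(1 + d) * t = d" using d by (auto simp: t_def field_simps)
      then show ?thesis by (simp add: scaleR_add_right)
    qed
    also have "\<dots> = (1 + d) *\<^sub>R y" using d by (simp add: z_def algebra_simps)
    finally have "y = (1 - t) *\<^sub>R x + t *\<^sub>R z" using d by simp
    then have "f y \<le> (1 - t) * f x + t * f z"
      using convex_onD[OF f t(1,2), of x z] by simp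
    then have "f y - f x \<le> t * (f z - f x)" by (simp add: algebra_simps)
    also have "\<dots> \<le> t * (2 * B)" using B[OF nz] B[of x] x t(1) by (intro mult_left_mono) auto
    also have "\<dots> \<le> d * (2 * B)" using B[of x] x t(3) by (intro mult_right_mono) auto
    finally show ?thesis by (simp add: d_def norm_minus_commute mult.commute)
  qed auto
  show ?thesis using *[OF x y] *[OF y x] by (simp add: norm_minus_commute abs_le_iff)
qed

text \<open>Convexity turns bounds at single points into bounds on balls. From above, the finitely
  many vertices of a cube containing the ball suffice. From below, the upper bound at the reflected
  point and the value at 0 suffice, which is the source of the summand
  \<open>2 * \<bar>b 0\<bar>\<close>.\<close>

lemma convex_family_bounded:
  fixes F :: "('a::euclidean_space \<Rightarrow> real) set"
  assumes conv: "\<And>f. f \<in> F \<Longrightarrow> convex_on UNIV f" and bd: "\<And>x. \<exists>B. \<forall>f\<in>F. \<bar>f x\<bar> \<le> B"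
  shows "\<exists>B>0. \<forall>f\<in>F. \<forall>x. norm x \<le> r \<longrightarrow> \<bar>f x\<bar> \<le> B"
proof -
  obtain b where b: "\<And>x f. f \<in> F \<Longrightarrow> \<bar>f x\<bar> \<le> b x" using bd by metis
  define d where "d = \<bar>r\<bar> + 1"
  obtain S :: "'a set" where S: "finite S" "cbox (0 - (\<Sum>i\<in>Basis. d *\<^sub>R i)) (0 + (\<Sum>i\<in>Basis. d *\<^sub>R i)) = convex hull S"
    by (rule cube_convex_hull[of d 0]) (auto simp: d_def)
  define B0 where "B0 = (\<Sum>x\<in>S. \<bar>b x\<bar>)"
  define B where "B = B0 + 2 * \<bar>b 0\<bar> + 1"
  have "B0 \<ge> 0" by (simp add: B0_def sum_nonneg)
  have "\<bar>f x\<bar> \<le> B" if f: "f \<in> F" and x: "norm x \<le> r" for f x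
  proof -
    have S_le: "f v \<le> B0" if "v \<in> S" for v
    proof -
      have "f v \<le> \<bar>b v\<bar>" using b[OF f, of v] by linarith
      also have "\<dots> \<le> B0" unfolding B0_def using S(1) that by (intro member_le_sum) auto
      finally show ?thesis .
    qed
    have hull: "\<forall>x\<in>convex hull S. f x \<le> B0"
      by (rule convex_on_convex_hull_bound)
        (use S_le convex_on_subset[OF conv[OF f]] in \<open>auto simp: convex_convex_hull\<close>)
    have "f y \<le> B0" if "y \<in> cball 0 d" for y
    proof -
      have "y \<in> cbox (0 - (\<Sum>i\<in>Basis. d *\<^sub>R i)) (0 + (\<Sum>i\<in>Basis. d *\<^sub>R i))"
      proof -
        have "\<bar>y \<bullet> i\<bar> \<le> d" if "i \<in> Basis" for i
          using Basis_le_norm[OF that, of y] \<open>y \<in> cball 0 d\<close> by simp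
        then show ?thesis by (auto simp: mem_box inner_sum_left_Basis inner_diff_left abs_le_iff minus_le_iff)
      qed
      then show ?thesis using hull S(2) by blast
    qed
    then have "\<bar>f x\<bar> \<le> B0 + 2 * \<bar>f 0\<bar>"
      using x by (intro convex_bounds_lemma[where e=d])
        (auto simp: d_def intro: convex_on_subset[OF conv[OF f]])
    also have "\<dots> \<le> B" using b[OF f, of 0] by (simp add: B_def)
    finally show ?thesis .
  qed
  moreover have "B > 0" using \<open>B0 \<ge> 0\<close> by (simp add: B_def)
  ultimately show ?thesis by blast
qed

lemma convex_bounded_on_cball:
  fixes f :: "'a::euclidean_space \<Rightarrow> real"
  assumes "convex_on UNIV f"
  obtains B where "B > 0" "\<And>x. norm x \<le> r \<Longrightarrow> \<bar>f x\<bar> \<le> B"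
  using convex_family_bounded[of "{f}" r] assms by (metis order_refl singletonD singletonI)

lemma convex_sequence_bounded:
  fixes F :: "nat \<Rightarrow> 'a::euclidean_space \<Rightarrow> real"
  assumes "\<And>j. convex_on UNIV (F j)" "\<And>x. (\<lambda>j. F j x) \<longlonglongrightarrow> f x"
  obtains B where "B > 0" "\<And>j x. norm x \<le> r \<Longrightarrow> \<bar>F j x\<bar> \<le> B"
proof -
  have "\<exists>B. \<forall>g\<in>range F. \<bar>g x\<bar> \<le> B" for x
  proof -
    have "Bseq (\<lambda>j. F j x)" using assms(2) convergentI convergent_imp_Bseq by blast
    then show ?thesis unfolding Bseq_def by auto
  qed
  then have "\<exists>B>0. \<forall>g\<in>range F. \<forall>x. norm x \<le> r \<longrightarrow> \<bar>g x\<bar> \<le> B"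
    by (intro convex_family_bounded) (use assms(1) in auto)
  then show ?thesis using that by auto
qed

text \<open>By the local bound and \<open>convex_lipschitz\<close> the sequence is equi-Lipschitz
  near \<open>y\<close>, so letting the argument move with the index costs nothing in the
  limit.\<close>

lemma convex_continuous_convergence:
  fixes F :: "nat \<Rightarrow> 'a::euclidean_space \<Rightarrow> real"
  assumes F: "\<And>j. convex_on UNIV (F j)" "\<And>x. (\<lambda>j. F j x) \<longlonglongrightarrow> f x" and y: "ys \<longlonglongrightarrow> y"
  shows "(\<lambda>j. F j (ys j)) \<longlonglongrightarrow> f y"
proof -
  obtain r where r: "r > 0" "\<And>j. norm (ys j) \<le> r"
    using convergent_imp_Bseq[OF convergentI[OF y]] unfolding Bseq_def by auto
  have yr: "norm y \<le> r" using Lim_bounded[OF tendsto_norm[OF y]] r by blast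
  obtain B where B: "B > 0" "\<And>j x. norm x \<le> r + 1 \<Longrightarrow> \<bar>F j x\<bar> \<le> B"
    using convex_sequence_bounded[OF F] by blast
  have "(\<lambda>j. F j (ys j) - F j y) \<longlonglongrightarrow> 0"
  proof (rule Lim_null_comparison)
    show "\<forall>\<^sub>F j in sequentially. norm (F j (ys j) - F j y) \<le> 2 * B * norm (ys j - y)"
      using convex_lipschitz[OF F(1) B(2) r(2) yr] by (auto intro!: always_eventually)
    have "(\<lambda>j. 2 * B * norm (ys j - y)) \<longlonglongrightarrow> 2 * B * norm (y - y)"
      by (intro tendsto_intros y)
    then show "(\<lambda>j. 2 * B * norm (ys j - y)) \<longlonglongrightarrow> 0" by simp
  qed
  from tendsto_add[OF this F(2)[of y]] show ?thesis by simp
qed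

text \<open>An Arzela-Ascoli theorem for convex functions: extract a subsequence that converges on a
  countable dense set, then carry convergence to every point by the common local Lipschitz
  constant.\<close>

lemma convex_subsequence:
  fixes F :: "nat \<Rightarrow> 'a::euclidean_space \<Rightarrow> real"
  assumes F: "\<And>j. convex_on UNIV (F j)" and bd: "\<And>x. \<exists>B. \<forall>j. \<bar>F j x\<bar> \<le> B"
  obtains s f where "strict_mono (s :: nat \<Rightarrow> nat)" "\<And>x. (\<lambda>j. F (s j) x) \<longlonglongrightarrow> f x"
proof -
  obtain b where b: "\<And>j x. \<bar>F j x\<bar> \<le> b x" using bd by metis
  have b0: "b x \<ge> 0" for x using b[of 0 x] by linarith
  obtain D :: "'a set" where D: "countable D" "\<And>X. open X \<Longrightarrow> X \<noteq> {} \<Longrightarrow> \<exists>d\<in>D. d \<in> X"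
    by (rule countable_dense_setE) blast
  \<comment> \<open>The extraction lemma asks for one bound valid at all points, hence the division
    by \<open>1 + b x\<close>; it is undone in \<open>convD\<close>.\<close>
  have "norm (F j x / (1 + b x)) \<le> 1" for j x
    using b[of j x] b0[of x] by (simp add: divide_le_eq_1)
  then obtain s where s: "strict_mono (s::nat\<Rightarrow>nat)"
      "\<And>x. x \<in> D \<Longrightarrow> \<exists>l. (\<lambda>j. F (s j) x / (1 + b x)) \<longlonglongrightarrow> l"
    by (rule function_convergent_subsequence[OF D(1), of "\<lambda>j x. F j x / (1 + b x)" 1]) blast+
  have convD: "convergent (\<lambda>j. F (s j) d)" if d: "d \<in> D" for d
  proof -
    obtain l where "(\<lambda>j. F (s j) d / (1 + b d)) \<longlonglongrightarrow> l" using s(2)[OF d] by blast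
    then have "(\<lambda>j. (1 + b d) * (F (s j) d / (1 + b d))) \<longlonglongrightarrow> (1 + b d) * l" by (intro tendsto_intros)
    moreover have "(1 + b d) * (F (s j) d / (1 + b d)) = F (s j) d" for j using b0[of d] by simp
    ultimately show ?thesis by (auto simp: convergent_def)
  qed
  have "Cauchy (\<lambda>j. F (s j) x)" for x
  proof (rule metric_CauchyI)
    fix e :: real assume e: "e > 0"
    obtain B where B: "B > 0" "\<And>j y. norm y \<le> (norm x + 1) + 1 \<Longrightarrow> \<bar>F j y\<bar> \<le> B"
    proof -
      have "\<exists>B>0. \<forall>g\<in>range F. \<forall>y. norm y \<le> (norm x + 1) + 1 \<longrightarrow> \<bar>g y\<bar> \<le> B"
        by (rule convex_family_bounded) (use F b in auto)
      then show thesis using that by auto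
    qed
    define \<delta> where "\<delta> = min 1 (e / (8 * B))"
    have \<delta>: "\<delta> > 0" using e B by (simp add: \<delta>_def)
    obtain d where d: "d \<in> D" "d \<in> ball x \<delta>" using D(2)[of "ball x \<delta>"] \<delta> by auto
    have nd: "norm (x - d) < \<delta>" using d(2) by (simp add: dist_norm)
    have close: "\<bar>F j x - F j d\<bar> < e / 3" for j
    proof -
      have "norm d \<le> norm x + norm (d - x)" using norm_triangle_ineq[of x "d - x"] by simp
      then have "norm d \<le> norm x + 1" using nd by (simp add: \<delta>_def norm_minus_commute)
      then have "\<bar>F j x - F j d\<bar> \<le> 2 * B * norm (x - d)"
        by (intro convex_lipschitz[OF F B(2)]) auto
      also have "\<dots> \<le> 2 * B * (e / (8 * B))"
        using nd B(1) by (intro mult_left_mono) (auto simp: \<delta>_def)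
      also have "\<dots> < e / 3" using B(1) e by simp
      finally show ?thesis .
    qed
    have "Cauchy (\<lambda>j. F (s j) d)" using convD[OF d(1)] by (rule convergent_Cauchy)
    then obtain N where N: "\<And>m n. m \<ge> N \<Longrightarrow> n \<ge> N \<Longrightarrow> dist (F (s m) d) (F (s n) d) < e / 3"
      using e unfolding Cauchy_def by (metis divide_pos_pos zero_less_numeral)
    show "\<exists>M. \<forall>m\<ge>M. \<forall>n\<ge>M. dist (F (s m) x) (F (s n) x) < e"
    proof (intro exI[of _ N] allI impI)
      fix m n assume "N \<le> m" "N \<le> n"
      then show "dist (F (s m) x) (F (s n) x) < e"
        using N[of m n] close[of "s m"] close[of "s n"] unfolding dist_real_def by linarith
    qed
  qed
  then have "\<exists>l. (\<lambda>j. F (s j) x) \<longlonglongrightarrow> l" for x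
    using Cauchy_convergent unfolding convergent_def by blast
  then show thesis using that s(1) by metis
qed

section \<open>The Legendre transform and epi-convergence\<close>

text \<open>Separates the epigraph of \<open>u\<close> from the open cone below the minorant.\<close>

lemma conic_minorant_imp_affine_minorant:
  fixes u :: "'a::euclidean_space \<Rightarrow> ereal"
  assumes u: "convex_ereal u" "u x0 \<noteq> \<infinity>"
    and le: "\<And>x. ereal (c - \<epsilon> * norm (x - a)) \<le> u x" and \<epsilon>: "\<epsilon> \<ge> 0"
  obtains p where "norm p \<le> \<epsilon>" "\<And>x. ereal (c + p \<bullet> (x - a)) \<le> u x"
proof -
  define S where "S = {z::'a \<times> real. snd z < c - \<epsilon> * norm (fst z - a)}"
  define T where "T = {z::'a \<times> real. u (fst z) \<le> ereal (snd z)}"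
  have "convex S"
  proof (rule convexI)
    fix z w :: "'a \<times> real" and s t :: real
    assume *: "z \<in> S" "w \<in> S" "0 \<le> s" "0 \<le> t" "s + t = 1"
    have "norm (s *\<^sub>R fst z + t *\<^sub>R fst w - a) = norm (s *\<^sub>R (fst z - a) + t *\<^sub>R (fst w - a))"
    proof -
      have "s *\<^sub>R (fst z - a) + t *\<^sub>R (fst w - a) = s *\<^sub>R fst z + t *\<^sub>R fst w - (s + t) *\<^sub>R a"
        by (simp add: algebra_simps)
      then show ?thesis using * by simp
    qed
    also have "\<dots> \<le> s * norm (fst z - a) + t * norm (fst w - a)"
      using norm_triangle_ineq[of "s *\<^sub>R (fst z - a)" "t *\<^sub>R (fst w - a)"] * by simp
    finally have n: "\<epsilon> * norm (s *\<^sub>R fst z + t *\<^sub>R fst w - a) \<le> \<epsilon> * (s * norm (fst z - a) + t * norm (fst w - a))"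
      using \<epsilon> by (rule mult_left_mono)
    have "s * snd z + t * snd w < s * (c - \<epsilon> * norm (fst z - a)) + t * (c - \<epsilon> * norm (fst w - a))"
      using * unfolding S_def
      by (cases "s = 0") (auto intro!: add_less_le_mono mult_strict_left_mono mult_left_mono)
    also have "\<dots> = (s + t) * c - \<epsilon> * (s * norm (fst z - a) + t * norm (fst w - a))"
      by (simp add: algebra_simps)
    finally show "s *\<^sub>R z + t *\<^sub>R w \<in> S" unfolding S_def using n * by simp
  qed
  moreover have "convex T"
  proof (rule convexI)
    fix z w :: "'a \<times> real" and s t :: real
    assume *: "z \<in> T" "w \<in> T" "0 \<le> s" "0 \<le> t" "s + t = 1"
    show "s *\<^sub>R z + t *\<^sub>R w \<in> T"
    proof (cases "t = 0 \<or> t = 1")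
      case True
      then show ?thesis using * by auto
    next
      case False
      then have t: "0 < t" "t < 1" and s: "s = 1 - t" using * by auto
      have "u ((1 - t) *\<^sub>R fst z + t *\<^sub>R fst w) \<le> ereal (1 - t) * u (fst z) + ereal t * u (fst w)"
        using u(1) t unfolding convex_ereal_def by blast
      also have "\<dots> \<le> ereal (1 - t) * ereal (snd z) + ereal t * ereal (snd w)"
        using * t by (intro add_mono ereal_mult_left_mono) (auto simp: T_def)
      finally show ?thesis unfolding T_def s by simp
    qed
  qed
  moreover have "(a, c - 1) \<in> S" by (simp add: S_def)
  moreover have "u x0 \<noteq> -\<infinity>" using le[of x0] by auto
  then have "(x0, real_of_ereal (u x0)) \<in> T" using u(2) by (cases "u x0") (auto simp: T_def)
  moreover have "S \<inter> T = {}"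
  proof -
    have False if "z \<in> S" "z \<in> T" for z
    proof -
      have "ereal (c - \<epsilon> * norm (fst z - a)) \<le> ereal (snd z)"
        using order_trans[OF le[of "fst z"], of "ereal (snd z)"] that(2) by (simp add: T_def)
      then show False using that(1) by (simp add: S_def)
    qed
    then show ?thesis by blast
  qed
  ultimately obtain qb b where sep: "qb \<noteq> 0" "\<And>z. z \<in> S \<Longrightarrow> qb \<bullet> z \<le> b" "\<And>z. z \<in> T \<Longrightarrow> qb \<bullet> z \<ge> b"
    using separating_hyperplane_sets[of S T] by blast
  obtain q \<beta> where qb: "qb = (q, \<beta>)" by (cases qb)
  have S': "q \<bullet> x + \<beta> * s \<le> b" if "s < c - \<epsilon> * norm (x - a)" for x s
    using sep(2)[of "(x, s)"] that by (simp add: S_def qb)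
  have T': "b \<le> q \<bullet> x + \<beta> * s" if "u x \<le> ereal s" for x s
    using sep(3)[of "(x, s)"] that by (simp add: T_def qb)
  have "\<beta> \<ge> 0"
  proof (rule ccontr)
    assume "\<not> \<beta> \<ge> 0"
    then have \<beta>: "\<beta> < 0" by simp
    define s where "s = min (c - 1) ((b - q \<bullet> a + 1) / \<beta>)"
    have "q \<bullet> a + \<beta> * s \<le> b" by (rule S') (simp add: s_def)
    moreover have "\<beta> * s \<ge> \<beta> * ((b - q \<bullet> a + 1) / \<beta>)"
      using \<beta> by (intro mult_left_mono_neg) (auto simp: s_def)
    moreover have "\<beta> * ((b - q \<bullet> a + 1) / \<beta>) = b - q \<bullet> a + 1" using \<beta> by simp
    ultimately show False by linarith
  qed
  moreover have "\<beta> \<noteq> 0"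
  proof
    \<comment> \<open>A vertical hyperplane is excluded because \<open>S\<close> projects onto the
      whole space: a multiple of \<open>q\<close> violates the bound.\<close>
    assume \<beta>: "\<beta> = 0"
    then have q: "q \<noteq> 0" using sep(1) qb by (auto simp: zero_prod_def)
    have "q \<bullet> (((b + 1) / (q \<bullet> q)) *\<^sub>R q) \<le> b"
      using S'[of "c - \<epsilon> * norm (((b + 1) / (q \<bullet> q)) *\<^sub>R q - a) - 1" "((b + 1) / (q \<bullet> q)) *\<^sub>R q"] \<beta> by simp
    then show False using q by simp
  qed
  ultimately have \<beta>: "\<beta> > 0" by simp
  define p where "p = - (1 / \<beta>) *\<^sub>R q"
  have qp: "q = - \<beta> *\<^sub>R p" using \<beta> by (simp add: p_def)
  have upper: "c - \<epsilon> * norm (x - a) \<le> b / \<beta> + p \<bullet> x" for x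
  proof (rule dense_le)
    fix s assume "s < c - \<epsilon> * norm (x - a)"
    from S'[OF this] show "s \<le> b / \<beta> + p \<bullet> x"
      using \<beta> by (simp add: qp field_simps)
  qed
  have lower: "ereal (b / \<beta> + p \<bullet> x) \<le> u x" for x
  proof (cases "u x")
    case (real r)
    then have "b \<le> q \<bullet> x + \<beta> * r" using T' by simp
    then show ?thesis using \<beta> real by (simp add: qp field_simps)
  qed (use le[of x] in auto)
  have ca: "c \<le> b / \<beta> + p \<bullet> a" using upper[of a] by simp
  show thesis
  proof
    fix x
    have "ereal (c + p \<bullet> (x - a)) \<le> ereal (b / \<beta> + p \<bullet> x)"
      using ca by (simp add: inner_diff_right)
    then show "ereal (c + p \<bullet> (x - a)) \<le> u x" using lower[of x] by (rule order_trans)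
  next
    show "norm p \<le> \<epsilon>"
    proof (rule ccontr)
      assume "\<not> norm p \<le> \<epsilon>"
      then have p: "norm p > \<epsilon>" "norm p > 0" using \<epsilon> by auto
      \<comment> \<open>\<open>k\<close> is the gap at \<open>a\<close> between the affine function
        and the value \<open>c\<close>. In the direction \<open>- p\<close> the affine function
        falls faster than the cone, and \<open>t\<close> is so large that the gap would be overdrawn
        by 1.\<close>
      define k where "k = b / \<beta> + p \<bullet> a - c"
      define t where "t = (k + 1) / (norm p * (norm p - \<epsilon>))"
      have k: "k \<ge> 0" using ca by (simp add: k_def)
      have t: "t > 0" unfolding t_def using p k by (intro divide_pos_pos mult_pos_pos) auto
      have "c - \<epsilon> * norm (a - t *\<^sub>R p - a) \<le> b / \<beta> + p \<bullet> (a - t *\<^sub>R p)" by (rule upper)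
      then have "t * (norm p * (norm p - \<epsilon>)) \<le> k"
        using t by (simp add: k_def inner_diff_right dot_square_norm power2_eq_square algebra_simps)
      moreover have "t * (norm p * (norm p - \<epsilon>)) = k + 1" using p by (simp add: t_def)
      ultimately show False by simp
    qed
  qed
qed

section \<open>Conjugates: semicontinuity, convexity, growth and biconjugation\<close>

lemma convex_ereal_iff: "convex_ereal (\<lambda>x. ereal (f x)) \<longleftrightarrow> convex_on UNIV f"
  unfolding convex_ereal_def
proof
  assume *: "\<forall>x y. \<forall>t::real. 0 < t \<and> t < 1 \<longrightarrow>
      ereal (f ((1 - t) *\<^sub>R x + t *\<^sub>R y)) \<le> ereal (1 - t) * ereal (f x) + ereal t * ereal (f y)"
  show "convex_on UNIV f" by (rule convex_onI) (use * in auto)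
qed (auto intro!: convex_onD)

text \<open>Real thresholds on the conjugate are affine minorants of \<open>u\<close>. Through this
  equivalence and its negation the supremum is handled without arithmetic on infinite
  values.\<close>

lemma fenchel_le_iff: "fenchel u y \<le> ereal c \<longleftrightarrow> (\<forall>x. ereal (x \<bullet> y - c) \<le> u x)"
proof -
  have "ereal (x \<bullet> y) - u x \<le> ereal c \<longleftrightarrow> ereal (x \<bullet> y - c) \<le> u x" for x
    by (cases "u x") auto
  then show ?thesis unfolding fenchel_def by (simp add: SUP_le_iff)
qed

lemma less_fenchel_iff: "ereal c < fenchel u y \<longleftrightarrow> (\<exists>x. u x < ereal (x \<bullet> y - c))"
  using fenchel_le_iff[of u y c] by (metis not_le)

lemma fenchel_antimono: "(\<And>x. u x \<le> v x) \<Longrightarrow> fenchel v y \<le> fenchel u y"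
  unfolding fenchel_def by (intro SUP_mono') (simp add: ereal_minus_mono)

lemma fenchel_young: "ereal (x \<bullet> y) - u x \<le> fenchel u y"
  unfolding fenchel_def by (rule SUP_upper) simp

lemma fenchel_min: "fenchel (\<lambda>x. min (u x) (v x)) y = max (fenchel u y) (fenchel v y)"
proof (rule antisym)
  have "ereal (x \<bullet> y) - min (u x) (v x) \<le> max (fenchel u y) (fenchel v y)" for x
    using fenchel_young[of x y u] fenchel_young[of x y v]
    by (cases "u x \<le> v x") (auto simp: min_def le_max_iff_disj)
  then show "fenchel (\<lambda>x. min (u x) (v x)) y \<le> max (fenchel u y) (fenchel v y)"
    unfolding fenchel_def[of "\<lambda>x. min (u x) (v x)"] by (rule SUP_least)
qed (auto intro!: fenchel_antimono)

lemma lsc_nhds: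
  assumes "lower_semicontinuous u" "a < u x"
  shows "\<forall>\<^sub>F z in nhds x. a < u z"
proof -
  have "u x \<le> Liminf (at x) u" using assms by (simp add: lower_semicontinuous_def)
  then have "\<forall>\<^sub>F z in at x. a < u z" using assms(2) by (simp add: le_Liminf_iff)
  then show ?thesis using assms(2)
    by (simp add: eventually_at_filter) (erule eventually_mono, metis)
qed

lemma lsc_tendsto:
  assumes "lower_semicontinuous u" "(g \<longlongrightarrow> x) F" "a < u x"
  shows "\<forall>\<^sub>F j in F. a < u (g j)"
  using assms(2) lsc_nhds[OF assms(1,3)] unfolding filterlim_iff by (elim allE[of _ "\<lambda>z. a < u z"] impE)

lemma lower_semicontinuousI:
  assumes "\<And>x a. ereal a < u x \<Longrightarrow> \<forall>\<^sub>F z in nhds x. ereal a < u z"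
  shows "lower_semicontinuous u"
  unfolding lower_semicontinuous_def le_Liminf_iff
proof (intro allI impI)
  fix x y assume "y < u x"
  then obtain a where a: "y < ereal a" "ereal a < u x" using ereal_dense2 by blast
  have "\<forall>\<^sub>F z in nhds x. y < u z"
    using assms[OF a(2)] by (rule eventually_mono) (use a(1) in \<open>auto intro: less_trans\<close>)
  then show "\<forall>\<^sub>F z in at x. y < u z" by (auto simp: eventually_at_filter elim: eventually_mono)
qed

lemma fenchel_lsc: "lower_semicontinuous (fenchel u)"
proof (rule lower_semicontinuousI)
  fix x a assume "ereal a < fenchel u x"
  then obtain z where z: "u z < ereal (z \<bullet> x - a)" by (auto simp: less_fenchel_iff)
  have "((\<lambda>x. ereal (z \<bullet> x - a)) \<longlongrightarrow> ereal (z \<bullet> x - a)) (nhds x)"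
    by (intro tendsto_intros filterlim_ident)
  then have "\<forall>\<^sub>F x' in nhds x. u z < ereal (z \<bullet> x' - a)" using z by (rule order_tendstoD)
  then show "\<forall>\<^sub>F z in nhds x. ereal a < fenchel u z"
    by (rule eventually_mono) (auto simp: less_fenchel_iff)
qed

lemma fenchel_convex:
  assumes "\<And>x. u x \<noteq> -\<infinity>"
  shows "convex_ereal (fenchel u)"
  unfolding convex_ereal_def
proof (intro allI impI)
  fix x y and t :: real assume t: "0 < t \<and> t < 1"
  show "fenchel u ((1 - t) *\<^sub>R x + t *\<^sub>R y) \<le> ereal (1 - t) * fenchel u x + ereal t * fenchel u y"
    unfolding fenchel_def[of u "(1 - t) *\<^sub>R x + t *\<^sub>R y"]
  proof (rule SUP_least)
    fix z
    show "ereal (z \<bullet> ((1 - t) *\<^sub>R x + t *\<^sub>R y)) - u z \<le> ereal (1 - t) * fenchel u x + ereal t * fenchel u y"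
    proof (cases "u z")
      case (real r)
      have "ereal (z \<bullet> ((1 - t) *\<^sub>R x + t *\<^sub>R y)) - u z
          = ereal (1 - t) * (ereal (z \<bullet> x) - u z) + ereal t * (ereal (z \<bullet> y) - u z)"
        using real by (simp add: inner_add_right algebra_simps)
      also have "\<dots> \<le> ereal (1 - t) * fenchel u x + ereal t * fenchel u y"
        using t by (intro add_mono ereal_mult_left_mono fenchel_young) auto
      finally show ?thesis .
    qed (use assms in auto)
  qed
qed

text \<open>Near 0 the Lipschitz bound gives a conic minorant with vertex value \<open>f 0\<close>,
  and convexity along rays extends it to the whole space. Separation then replaces the cone by an
  affine function with the same value at 0; other base points follow by translation.\<close>

lemma convex_subgradient:
  fixes f :: "'a::euclidean_space \<Rightarrow> real"
  assumes f: "convex_on UNIV f"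
  obtains p where "\<And>x. f z + p \<bullet> (x - z) \<le> f x"
proof -
  have at_0: "\<exists>p. \<forall>x. f 0 + p \<bullet> x \<le> f x" if f: "convex_on UNIV f" for f :: "'a \<Rightarrow> real"
  proof -
    obtain B where B: "B > 0" "\<And>x. norm x \<le> 1 + 1 \<Longrightarrow> \<bar>f x\<bar> \<le> B"
      using convex_bounded_on_cball[OF f] by blast
    have lip: "\<bar>f x - f 0\<bar> \<le> 2 * B * norm (x - 0)" if "norm x \<le> 1" for x
      by (rule convex_lipschitz[OF f B(2)]) (use that in auto)
    have le: "f 0 - 2 * B * norm x \<le> f x" for x
    proof (cases "norm x \<le> 1")
      case True
      then show ?thesis using lip[of x] by simp
    next
      case False
      define t where "t = 1 / norm x"
      have t: "0 \<le> t" "t \<le> 1" "norm x = 1 / t" "t > 0" using False by (auto simp: t_def divide_le_eq_1)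
      have "f (t *\<^sub>R x) \<le> (1 - t) * f 0 + t * f x"
        using convex_onD[OF f t(1,2), of 0 x] by simp
      moreover have "f 0 - 2 * B \<le> f (t *\<^sub>R x)"
      proof -
        have "norm (t *\<^sub>R x) = 1" using t(4) by (simp add: t(3))
        then show ?thesis using lip[of "t *\<^sub>R x"] by simp
      qed
      ultimately have "t * f 0 - 2 * B \<le> t * f x" by (simp add: algebra_simps)
      moreover have "t * (2 * B * norm x) = 2 * B" using t(3,4) by simp
      ultimately have "t * (f 0 - 2 * B * norm x) \<le> t * f x" by (simp only: right_diff_distrib)
      then show ?thesis using t(4) by simp
    qed
    obtain p where "\<And>x. ereal (f 0 + p \<bullet> (x - 0)) \<le> ereal (f x)"
    proof (rule conic_minorant_imp_affine_minorant)
      show "convex_ereal (\<lambda>x. ereal (f x))" using f by (simp add: convex_ereal_iff)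
      show "ereal (f 0 - (2 * B) * norm (x - 0)) \<le> ereal (f x)" for x using le by simp
    qed (use B in auto)
    then show ?thesis by auto
  qed
  have "convex_on UNIV (\<lambda>x. f (x + z))"
    by (rule convex_on_compose_affine[OF f]) (simp add: algebra_simps)
  from at_0[OF this] obtain p where p: "f z + p \<bullet> x \<le> f (x + z)" for x by auto
  show thesis using that[of p] p[of "x - z" for x] by simp
qed

text \<open>Superlinear growth of the conjugate is dual to finiteness of \<open>f\<close>: testing
  the supremum at the multiple of \<open>x\<close> of norm \<open>M\<close> gives at least
  \<open>M * norm x - B\<close>, where \<open>B\<close> bounds \<open>f\<close> on the ball of
  radius \<open>M\<close>. A subgradient at 0 is a point where the conjugate is finite.\<close>

lemma fenchel_convex_in_Conv_sc:
  fixes f :: "'a::euclidean_space \<Rightarrow> real"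
  assumes f: "convex_on UNIV f"
  shows "fenchel (\<lambda>x. ereal (f x)) \<in> Conv_sc"
proof -
  let ?u = "fenchel (\<lambda>x. ereal (f x))"
  have "?u x \<noteq> -\<infinity>" for x using fenchel_young[of 0 x "\<lambda>x. ereal (f x)"] by auto
  moreover have "\<exists>x. ?u x \<noteq> \<infinity>"
  proof -
    obtain p where p: "\<And>x. f 0 + p \<bullet> (x - 0) \<le> f x"
      using convex_subgradient[OF f] by blast
    have "?u p \<le> ereal (- f 0)"
      unfolding fenchel_le_iff using p by (simp add: inner_commute add.commute)
    then have "?u p \<noteq> \<infinity>" by auto
    then show ?thesis by blast
  qed
  moreover have "((\<lambda>x. ?u x / ereal (norm x)) \<longlongrightarrow> \<infinity>) at_infinity"
    unfolding tendsto_PInfty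
  proof
    fix r :: real
    \<comment> \<open>\<open>M\<close> exceeds \<open>r\<close> by at least 1, so the surplus
      \<open>norm x\<close> absorbs \<open>B\<close> as soon as \<open>norm x\<close> is larger than
      \<open>B\<close>.\<close>
    define M where "M = \<bar>r\<bar> + 1"
    obtain B where B: "B > 0" "\<And>x. norm x \<le> M \<Longrightarrow> \<bar>f x\<bar> \<le> B"
      using convex_bounded_on_cball[OF f] by blast
    show "\<forall>\<^sub>F x in at_infinity. ereal r < ?u x / ereal (norm x)"
      unfolding eventually_at_infinity
    proof (intro exI[of _ "B + 1"] allI impI)
      fix x :: 'a assume x: "B + 1 \<le> norm x"
      then have x0: "norm x > 0" using B by linarith
      have "ereal (r * norm x) < ereal (M * norm x - B)"
      proof -
        have "M * norm x - r * norm x \<ge> norm x"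
          using mult_right_mono[of "r + 1" M "norm x"] by (auto simp: M_def algebra_simps)
        then show ?thesis using x by simp
      qed
      also have "\<dots> \<le> ?u x"
      proof -
        define y where "y = (M / norm x) *\<^sub>R x"
        have "norm y \<le> M" using x0 by (simp add: y_def M_def)
        then have "f y \<le> B" using B(2)[of y] by simp
        moreover have "y \<bullet> x = M * norm x"
          using x0 by (simp add: y_def dot_square_norm power2_eq_square)
        ultimately have "ereal (M * norm x - B) \<le> ereal (y \<bullet> x) - ereal (f y)" by simp
        also have "\<dots> \<le> ?u x" by (rule fenchel_young)
        finally show ?thesis .
      qed
      finally have "ereal (r * norm x) < ?u x" .
      then show "ereal r < ?u x / ereal (norm x)"
        using x0 by (cases "?u x") (auto simp: field_simps)
    qed
  qed
  ultimately show ?thesis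
    unfolding Conv_sc_def Conv_def using fenchel_lsc fenchel_convex[of "\<lambda>x. ereal (f x)"] by auto
qed

lemma Conv_scD:
  assumes "u \<in> Conv_sc"
  shows "u x \<noteq> -\<infinity>" "\<exists>x. u x \<noteq> \<infinity>" "convex_ereal u" "lower_semicontinuous u"
    "((\<lambda>x. u x / ereal (norm x)) \<longlongrightarrow> \<infinity>) at_infinity"
  using assms by (auto simp: Conv_sc_def Conv_def)

text \<open>Outside a large ball this is the growth condition. Inside, a lower semicontinuous
  function that avoids minus infinity is bounded below by compactness; the constant \<open>B\<close>
  pays for both regions.\<close>

lemma Conv_sc_growth:
  fixes u :: "'a::euclidean_space \<Rightarrow> ereal"
  assumes u: "u \<in> Conv_sc" and M: "M \<ge> 0"
  obtains B where "\<And>x. ereal (M * norm x - B) \<le> u x"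
proof -
  have "\<forall>\<^sub>F x in at_infinity. ereal M < u x / ereal (norm x)"
    using Conv_scD(5)[OF u] by (simp add: tendsto_PInfty)
  then obtain b0 where b0: "\<And>x. b0 \<le> norm x \<Longrightarrow> ereal M < u x / ereal (norm x)"
    by (auto simp: eventually_at_infinity)
  define b where "b = max b0 1"
  have far: "ereal (M * norm x) \<le> u x" if "b \<le> norm x" for x
  proof -
    have "ereal M < u x / ereal (norm x)" "norm x > 0" using that b0[of x] by (auto simp: b_def)
    then show ?thesis by (cases "u x") (auto simp: field_simps)
  qed
  have "\<exists>k::nat. \<forall>x\<in>cball 0 b. ereal (- real k) \<le> u x"
  proof (rule ccontr)
    assume "\<not> ?thesis"
    then have "\<forall>k::nat. \<exists>x\<in>cball 0 b. u x < ereal (- real k)" by (metis not_le)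
    then obtain xs where xs: "\<And>k. xs k \<in> cball 0 b" "\<And>k. u (xs k) < ereal (- real k)"
      by metis
    obtain l r where l: "strict_mono (r::nat\<Rightarrow>nat)" "(xs \<circ> r) \<longlonglongrightarrow> l"
      using compact_cball[of "0::'a" b] xs(1) unfolding compact_def by blast
    obtain a where a: "ereal a < u l"
      using Conv_scD(1)[OF u, of l] ereal_dense2[of "-\<infinity>" "u l"] by auto
    have "\<forall>\<^sub>F j in sequentially. ereal a < u ((xs \<circ> r) j)"
      by (rule lsc_tendsto[OF Conv_scD(4)[OF u] l(2) a])
    moreover obtain N :: nat where N: "- a \<le> real N" using real_arch_simple by blast
    have "\<forall>\<^sub>F j in sequentially. j \<ge> N" by (rule eventually_ge_at_top)
    ultimately have "\<forall>\<^sub>F j in sequentially. False"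
    proof eventually_elim
      case (elim j)
      have "u (xs (r j)) < ereal (- real (r j))" by (rule xs)
      also have "\<dots> \<le> ereal a"
      proof -
        have "real N \<le> real (r j)" using seq_suble[OF l(1), of j] elim(2) by simp
        then show ?thesis using N by simp
      qed
      finally show False using elim(1) by simp
    qed
    then show False by simp
  qed
  then obtain k :: nat where k: "\<And>x. x \<in> cball 0 b \<Longrightarrow> ereal (- real k) \<le> u x" by blast
  show thesis
  proof
    fix x :: 'a
    show "ereal (M * norm x - (M * b + real k)) \<le> u x"
    proof (cases "norm x \<le> b")
      case True
      then have "ereal (M * norm x - (M * b + real k)) \<le> ereal (- real k)"
        using mult_left_mono[OF True M] by simp
      also have "\<dots> \<le> u x" using k[of x] True by simp
      finally show ?thesis .
    next
      case False
      have "M * b \<ge> 0" using M by (simp add: b_def)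
      then have "ereal (M * norm x - (M * b + real k)) \<le> ereal (M * norm x)" by simp
      also have "\<dots> \<le> u x" using far[of x] False by simp
      finally show ?thesis .
    qed
  qed
qed

lemma fenchel_Conv_sc_finite:
  fixes u :: "'a::euclidean_space \<Rightarrow> ereal"
  assumes u: "u \<in> Conv_sc"
  shows "ereal (real_of_ereal (fenchel u y)) = fenchel u y"
proof -
  obtain B where B: "\<And>x. ereal (norm y * norm x - B) \<le> u x"
    using Conv_sc_growth[OF u, of "norm y"] by auto
  have "ereal (x \<bullet> y - B) \<le> u x" for x
  proof -
    have "x \<bullet> y \<le> norm y * norm x" using norm_cauchy_schwarz[of x y] by (simp add: mult.commute)
    then have "ereal (x \<bullet> y - B) \<le> ereal (norm y * norm x - B)" by simp
    then show ?thesis using B by (rule order_trans)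
  qed
  then have "fenchel u y \<le> ereal B" by (simp add: fenchel_le_iff)
  moreover obtain x where "u x \<noteq> \<infinity>" using Conv_scD(2)[OF u] by blast
  then have "fenchel u y \<noteq> -\<infinity>"
    using fenchel_young[of x y u] Conv_scD(1)[OF u, of x] by (cases "u x") auto
  ultimately show ?thesis by (cases "fenchel u y") auto
qed

lemma fenchel_Conv_sc_convex:
  fixes u :: "'a::euclidean_space \<Rightarrow> ereal"
  assumes u: "u \<in> Conv_sc"
  shows "convex_on UNIV (\<lambda>y. real_of_ereal (fenchel u y))"
  unfolding convex_ereal_iff[symmetric] fenchel_Conv_sc_finite[OF u]
  using fenchel_convex[of u] Conv_scD(1)[OF u] by auto

text \<open>Given \<open>\<alpha> < u x\<close>, lower semicontinuity near \<open>x\<close> and a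
  global lower bound away from \<open>x\<close> fit a cone under \<open>u\<close> with its vertex at
  height \<open>\<alpha>\<close> over \<open>x\<close>. Separation replaces the cone by an affine
  minorant, whose slope is the test point for the second conjugate.\<close>

lemma fenchel_fenchel:
  fixes u :: "'a::euclidean_space \<Rightarrow> ereal"
  assumes u: "u \<in> Conv_sc"
  shows "fenchel (fenchel u) = u"
proof (intro ext antisym)
  fix x
  show "fenchel (fenchel u) x \<le> u x"
    unfolding fenchel_def[of "fenchel u"]
  proof (rule SUP_least)
    fix y
    show "ereal (y \<bullet> x) - fenchel u y \<le> u x"
      using fenchel_young[of x y u] fenchel_Conv_sc_finite[OF u, of y] Conv_scD(1)[OF u, of x]
      by (cases "u x"; cases "fenchel u y") (auto simp: inner_commute)
  qed
  show "u x \<le> fenchel (fenchel u) x"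
  proof (rule dense_le)
    fix \<alpha>' assume "\<alpha>' < u x"
    then obtain \<alpha> where \<alpha>: "\<alpha>' < ereal \<alpha>" "ereal \<alpha> < u x" using ereal_dense2 by blast
    obtain \<delta> where \<delta>: "\<delta> > 0" "\<And>z. dist z x < \<delta> \<Longrightarrow> ereal \<alpha> < u z"
      using lsc_nhds[OF Conv_scD(4)[OF u] \<alpha>(2)] by (auto simp: eventually_nhds_metric)
    obtain B where B: "\<And>x. ereal (0 * norm x - B) \<le> u x" using Conv_sc_growth[OF u, of 0] by auto
    obtain x0 where x0: "u x0 \<noteq> \<infinity>" using Conv_scD(2)[OF u] by blast
    \<comment> \<open>With this slope the cone has dropped by
      \<open>\<bar>\<alpha>\<bar> + \<bar>B\<bar>\<close> at distance \<open>\<delta>\<close>, so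
      from there on it lies below the global bound \<open>- B\<close>.\<close>
    define \<epsilon> where "\<epsilon> = (\<bar>\<alpha>\<bar> + \<bar>B\<bar>) / \<delta>"
    have \<epsilon>: "\<epsilon> \<ge> 0" using \<delta> by (simp add: \<epsilon>_def)
    have "ereal (\<alpha> - \<epsilon> * norm (z - x)) \<le> u z" for z
    proof (cases "dist z x < \<delta>")
      case True
      have "ereal (\<alpha> - \<epsilon> * norm (z - x)) \<le> ereal \<alpha>" using \<epsilon> by simp
      also have "\<dots> \<le> u z" using \<delta>(2)[OF True] by simp
      finally show ?thesis .
    next
      case False
      have "\<epsilon> * \<delta> \<le> \<epsilon> * norm (z - x)" using False \<epsilon> by (intro mult_left_mono) (auto simp: dist_norm)
      moreover have "\<epsilon> * \<delta> = \<bar>\<alpha>\<bar> + \<bar>B\<bar>" using \<delta> by (simp add: \<epsilon>_def)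
      ultimately have "ereal (\<alpha> - \<epsilon> * norm (z - x)) \<le> ereal (0 * norm z - B)" by simp
      then show ?thesis using B by (rule order_trans)
    qed
    then obtain p where p: "\<And>z. ereal (\<alpha> + p \<bullet> (z - x)) \<le> u z"
      using conic_minorant_imp_affine_minorant[OF Conv_scD(3)[OF u] x0 _ \<epsilon>] by metis
    have "fenchel u p \<le> ereal (x \<bullet> p - \<alpha>)"
      unfolding fenchel_le_iff using p by (simp add: inner_diff_right inner_commute algebra_simps)
    then have "ereal \<alpha> \<le> ereal (p \<bullet> x) - fenchel u p"
      by (cases "fenchel u p") (auto simp: inner_commute)
    also have "\<dots> \<le> fenchel (fenchel u) x" by (rule fenchel_young)
    finally show "\<alpha>' \<le> fenchel (fenchel u) x" using \<alpha>(1) by auto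
  qed
qed

text \<open>On a segment joining a good point for \<open>u\<close> to a good point for \<open>v\<close>, the closed sets where
  \<open>u\<close>, respectively \<open>v\<close>, lies below the chord cover the segment, so they meet.\<close>

lemma fenchel_max:
  fixes u v :: "'a::euclidean_space \<Rightarrow> ereal"
  assumes u: "\<And>x. u x \<noteq> -\<infinity>" "lower_semicontinuous u" and v: "\<And>x. v x \<noteq> -\<infinity>" "lower_semicontinuous v"
    and conv: "convex_ereal (\<lambda>x. min (u x) (v x))"
  shows "fenchel (\<lambda>x. max (u x) (v x)) y = min (fenchel u y) (fenchel v y)"
proof (rule antisym)
  show "fenchel (\<lambda>x. max (u x) (v x)) y \<le> min (fenchel u y) (fenchel v y)"
    by (auto intro!: fenchel_antimono)
  show "min (fenchel u y) (fenchel v y) \<le> fenchel (\<lambda>x. max (u x) (v x)) y"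
  proof (rule dense_le)
    fix \<alpha>' assume "\<alpha>' < min (fenchel u y) (fenchel v y)"
    then obtain \<alpha> where \<alpha>: "\<alpha>' < ereal \<alpha>" "ereal \<alpha> < min (fenchel u y) (fenchel v y)"
      using ereal_dense2 by blast
    then obtain x1 x2 where x: "u x1 < ereal (x1 \<bullet> y - \<alpha>)" "v x2 < ereal (x2 \<bullet> y - \<alpha>)"
      by (auto simp: less_fenchel_iff)
    then obtain a b where ab: "u x1 = ereal a" "v x2 = ereal b"
      using u(1)[of x1] v(1)[of x2] by (cases "u x1"; cases "v x2") auto
    define z where "z t = (1 - t) *\<^sub>R x1 + t *\<^sub>R x2" for t
    define l where "l t = (1 - t) * a + t * b" for t
    have lz: "l t < z t \<bullet> y - \<alpha>" if "t \<in> {0..1}" for t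
    proof -
      have "(1 - t) * a + t * b < (1 - t) * (x1 \<bullet> y - \<alpha>) + t * (x2 \<bullet> y - \<alpha>)"
        using that x ab
        by (cases "t = 0") (auto intro!: add_le_less_mono mult_strict_left_mono mult_left_mono)
      then show ?thesis by (simp add: l_def z_def inner_add_left algebra_simps)
    qed
    have closed: "closed {t \<in> {0..1}. w (z t) \<le> ereal (l t)}"
      if w: "lower_semicontinuous w" for w :: "'a \<Rightarrow> ereal"
      unfolding closed_sequential_limits
    proof (intro allI impI)
      fix ts t assume ts: "(\<forall>n. ts n \<in> {t \<in> {0..1}. w (z t) \<le> ereal (l t)}) \<and> ts \<longlonglongrightarrow> t"
      then have t: "t \<in> {0..1}" using closed_sequentially[of "{0..1::real}" ts t] by auto
      have "w (z t) \<le> ereal (l t)"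
      proof (rule ccontr)
        assume "\<not> w (z t) \<le> ereal (l t)"
        then obtain \<gamma> where \<gamma>: "ereal (l t) < ereal \<gamma>" "ereal \<gamma> < w (z t)"
          using ereal_dense2[of "ereal (l t)" "w (z t)"] by (auto simp: not_le)
        have lim: "(\<lambda>n. z (ts n)) \<longlonglongrightarrow> z t" "(\<lambda>n. l (ts n)) \<longlonglongrightarrow> l t"
          unfolding z_def l_def using ts by (auto intro!: tendsto_intros)
        have "\<forall>\<^sub>F n in sequentially. ereal \<gamma> < w (z (ts n))"
          by (rule lsc_tendsto[OF w lim(1) \<gamma>(2)])
        moreover have "\<forall>\<^sub>F n in sequentially. l (ts n) < \<gamma>"
          using lim(2) \<gamma>(1) by (simp add: order_tendstoD)
        ultimately have "\<forall>\<^sub>F n in sequentially. False"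
        proof eventually_elim
          case (elim n)
          have "w (z (ts n)) \<le> ereal (l (ts n))" using ts by auto
          also have "\<dots> < ereal \<gamma>" using elim(2) by simp
          finally show False using elim(1) by simp
        qed
        then show False by simp
      qed
      then show "t \<in> {t \<in> {0..1}. w (z t) \<le> ereal (l t)}" using t by simp
    qed
    let ?A = "{t \<in> {0..1}. u (z t) \<le> ereal (l t)}" and ?B = "{t \<in> {0..1}. v (z t) \<le> ereal (l t)}"
    have mem: "0 \<in> ?A" "1 \<in> ?B" using ab by (auto simp: z_def l_def)
    have cover: "{0..1} \<subseteq> ?A \<union> ?B"
    proof
      fix t :: real assume t: "t \<in> {0..1}"
      show "t \<in> ?A \<union> ?B"
      proof (cases "t = 0 \<or> t = 1")
        case True
        then show ?thesis using mem by auto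
      next
        case False
        then have t': "0 < t" "t < 1" using t by auto
        have "min (u (z t)) (v (z t)) \<le> ereal (1 - t) * min (u x1) (v x1) + ereal t * min (u x2) (v x2)"
          using conv t' unfolding convex_ereal_def z_def by blast
        also have "\<dots> \<le> ereal (1 - t) * ereal a + ereal t * ereal b"
          using t' ab by (intro add_mono ereal_mult_left_mono) (auto simp: min_le_iff_disj)
        finally show ?thesis using t by (auto simp: l_def min_le_iff_disj)
      qed
    qed
    have "?A \<inter> ?B \<inter> {0..1} \<noteq> {}"
      using connected_Icc[of 0 "1::real"] closed[OF u(2)] closed[OF v(2)] cover mem
      unfolding connected_closed by (metis (no_types, lifting) IntI atLeastAtMost_iff emptyE zero_le_one order_refl)
    then obtain t where t: "t \<in> {0..1}" "u (z t) \<le> ereal (l t)" "v (z t) \<le> ereal (l t)" by auto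
    then have "max (u (z t)) (v (z t)) \<le> ereal (l t)" by simp
    also have "\<dots> < ereal (z t \<bullet> y - \<alpha>)" using lz[OF t(1)] by simp
    finally have "ereal \<alpha> < fenchel (\<lambda>x. max (u x) (v x)) y" unfolding less_fenchel_iff by blast
    then show "\<alpha>' \<le> fenchel (\<lambda>x. max (u x) (v x)) y" using \<alpha>(1) by auto
  qed
qed

section \<open>Pointwise convergence implies epi-convergence of the conjugates\<close>

lemma convex_uniform_convergence:
  fixes F :: "nat \<Rightarrow> 'a::euclidean_space \<Rightarrow> real"
  assumes F: "\<And>j. convex_on UNIV (F j)" "\<And>x. (\<lambda>j. F j x) \<longlonglongrightarrow> f x" and \<delta>: "\<delta> > 0"
  shows "\<forall>\<^sub>F j in sequentially. \<forall>y. norm y \<le> r \<longrightarrow> \<bar>F j y - f y\<bar> < \<delta>"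
proof (rule ccontr)
  assume "\<not> ?thesis"
  then obtain s where s: "strict_mono (s :: nat \<Rightarrow> nat)" "\<forall>k. \<not> (\<forall>y. norm y \<le> r \<longrightarrow> \<bar>F (s k) y - f y\<bar> < \<delta>)"
    by (auto dest!: not_eventually_sequentiallyD)
  then obtain ys where ys: "\<And>k. norm (ys k) \<le> r" "\<And>k. \<bar>F (s k) (ys k) - f (ys k)\<bar> \<ge> \<delta>"
    by (metis not_less)
  \<comment> \<open>A limit point \<open>q\<close> of the bad points contradicts continuous
    convergence at \<open>q\<close>.\<close>
  have "\<forall>k. ys k \<in> cball 0 r" using ys(1) by simp
  then obtain l q where l: "strict_mono (l :: nat \<Rightarrow> nat)" "(ys \<circ> l) \<longlonglongrightarrow> q"
    using compact_cball[of "0::'a" r] unfolding compact_def by blast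
  have "continuous_on UNIV f" using convex_on_limit[OF F] by (rule convex_continuous)
  then have "(\<lambda>k. f ((ys \<circ> l) k)) \<longlonglongrightarrow> f q"
    using continuous_on_tendsto_compose[of UNIV f "ys \<circ> l" q] l(2) by simp
  moreover have "(\<lambda>k. F (s (l k)) ((ys \<circ> l) k)) \<longlonglongrightarrow> f q"
  proof (rule convex_continuous_convergence[OF F(1) _ l(2)])
    show "(\<lambda>k. F (s (l k)) x) \<longlonglongrightarrow> f x" for x
      using LIMSEQ_subseq_LIMSEQ[OF F(2)[of x] strict_mono_o[OF s(1) l(1)]] by (simp add: o_def)
  qed
  ultimately have "(\<lambda>k. F (s (l k)) ((ys \<circ> l) k) - f ((ys \<circ> l) k)) \<longlonglongrightarrow> f q - f q"
    by (rule tendsto_diff[rotated])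
  then have "\<forall>\<^sub>F k in sequentially. dist (F (s (l k)) ((ys \<circ> l) k) - f ((ys \<circ> l) k)) 0 < \<delta>"
    using \<delta> by (simp add: tendsto_iff)
  then obtain k where "\<bar>F (s (l k)) (ys (l k)) - f (ys (l k))\<bar> < \<delta>"
    unfolding eventually_sequentially by (auto simp: dist_real_def)
  then show False using ys(2)[of "l k"] by simp
qed

text \<open>Merges the statements for all positive \<open>\<epsilon>\<close> into one along a null
  sequence, as needed to assemble a recovery sequence from approximate ones.\<close>

lemma diagonal_eventually:
  fixes P :: "real \<Rightarrow> nat \<Rightarrow> bool"
  assumes mono: "\<And>\<epsilon> \<epsilon>' j. P \<epsilon> j \<Longrightarrow> \<epsilon> \<le> \<epsilon>' \<Longrightarrow> P \<epsilon>' j"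
    and ev: "\<And>\<epsilon>. \<epsilon> > 0 \<Longrightarrow> \<forall>\<^sub>F j in sequentially. P \<epsilon> j"
  obtains e where "e \<longlonglongrightarrow> 0" "\<forall>\<^sub>F j in sequentially. P (e j) j"
proof
  let ?S = "\<lambda>j. {\<epsilon>. \<epsilon> > 0 \<and> P \<epsilon> j}"
  \<comment> \<open>The infimum of the admissible \<open>\<epsilon>\<close> need not be admissible
    itself; the added term leaves room above it. Only finitely many \<open>j\<close> have no
    admissible value at all, and there the infimum is arbitrary.\<close>
  define e where "e j = Inf (?S j) + inverse (real (Suc j))" for j
  have bdd: "bdd_below (?S j)" for j by (rule bdd_belowI[of _ 0]) auto
  show "\<forall>\<^sub>F j in sequentially. P (e j) j"
    using ev[OF zero_less_one]
  proof eventually_elim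
    case (elim j)
    then have ne: "?S j \<noteq> {}" by (auto intro!: exI[of _ 1])
    have "Inf (?S j) < e j" by (simp add: e_def)
    then obtain \<epsilon> where "\<epsilon> \<in> ?S j" "\<epsilon> < e j" using cInf_lessD[OF ne] by blast
    then show ?case using mono[of \<epsilon> j "e j"] by simp
  qed
  have "(\<lambda>j. Inf (?S j)) \<longlonglongrightarrow> 0"
  proof (rule tendstoI)
    fix \<epsilon> :: real assume "\<epsilon> > 0"
    then have "\<epsilon> / 2 > 0" by simp
    from ev[OF this] show "\<forall>\<^sub>F j in sequentially. dist (Inf (?S j)) 0 < \<epsilon>"
    proof eventually_elim
      case (elim j)
      then have "Inf (?S j) \<le> \<epsilon> / 2" using \<open>\<epsilon> > 0\<close> by (intro cInf_lower bdd) auto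
      moreover have "Inf (?S j) \<ge> 0" using elim \<open>\<epsilon> > 0\<close> by (intro cInf_greatest) (auto intro!: exI[of _ "\<epsilon> / 2"])
      ultimately show ?case using \<open>\<epsilon> > 0\<close> by simp
    qed
  qed
  from tendsto_add[OF this LIMSEQ_inverse_real_of_nat] show "e \<longlonglongrightarrow> 0" unfolding e_def[abs_def] by simp
qed

text \<open>The value \<open>c\<close> says that \<open>f\<close> minus the linear function of
  \<open>x\<close> is at least \<open>- c\<close>. Uniform convergence transfers this to
  \<open>F j\<close> on a ball up to \<open>\<epsilon>\<close>, and convexity along rays from 0
  extends it everywhere at the price of a cone of slope \<open>\<epsilon>\<close>. Separation yields
  a slope \<open>p\<close> with \<open>norm p \<le> \<epsilon>\<close>, and the conjugate is
  controlled at the perturbed point \<open>x + p\<close>.\<close>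

lemma fenchel_recovery:
  fixes F :: "nat \<Rightarrow> 'a::euclidean_space \<Rightarrow> real"
  assumes F: "\<And>j. convex_on UNIV (F j)" "\<And>x. (\<lambda>j. F j x) \<longlonglongrightarrow> f x"
    and c: "fenchel (\<lambda>x. ereal (f x)) x = ereal c" and \<epsilon>: "\<epsilon> > 0"
  shows "\<forall>\<^sub>F j in sequentially. \<exists>p. norm (p - x) \<le> \<epsilon> \<and> fenchel (\<lambda>x. ereal (F j x)) p \<le> ereal (c + \<epsilon>)"
proof -
  have fx: "y \<bullet> x - c \<le> f y" for y
    using c fenchel_le_iff[of "\<lambda>x. ereal (f x)" x c] by simp
  then have c0: "- c \<le> f 0" by (metis diff_0 inner_zero_left)
  \<comment> \<open>From 0 to the sphere of radius \<open>r\<close> the function \<open>h\<close>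
    below drops by at most \<open>2 + c + f 0\<close>; the radius is chosen so that the cone of
    slope \<open>\<epsilon>\<close> drops by more than this.\<close>
  define r where "r = (3 + c + f 0) / \<epsilon>"
  have \<epsilon>r: "\<epsilon> * r = 3 + c + f 0" using \<epsilon> by (simp add: r_def)
  have r: "r > 0" unfolding r_def using \<epsilon> c0 by (intro divide_pos_pos) auto
  have "\<forall>\<^sub>F j in sequentially. \<forall>y. norm y \<le> r \<longrightarrow> \<bar>F j y - f y\<bar> < min \<epsilon> 1"
    by (rule convex_uniform_convergence[OF F]) (use \<epsilon> in auto)
  then show ?thesis
  proof eventually_elim
    case (elim j)
    define h where "h y = F j y - y \<bullet> x" for y
    have h: "convex_on UNIV h"
      using convex_on_add[OF F(1)[of j] convex_on_affine[of "- x" 0]]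
      by (simp add: h_def[abs_def] inner_commute)
    have near: "- c - \<epsilon> \<le> h y" "- c - 1 \<le> h y" if "norm y \<le> r" for y
      using elim that fx[of y] by (auto simp: h_def dest!: spec[of _ y])
    have h0: "h 0 \<le> f 0 + 1" using elim r by (auto simp: h_def dest!: spec[of _ 0])
    have le: "- c - \<epsilon> - \<epsilon> * norm (y - 0) \<le> h y" for y
    proof (cases "norm y \<le> r")
      case True
      have "0 \<le> \<epsilon> * norm (y - 0)" using \<epsilon> by simp
      then show ?thesis using near(1)[OF True] by linarith
    next
      case False
      define t where "t = r / norm y"
      have y: "norm y > 0" using False r by linarith
      have t: "0 \<le> t" "t \<le> 1" "t > 0" "t * norm y = r" using False r y by (auto simp: t_def divide_le_eq_1)
      have "h (t *\<^sub>R y) \<le> (1 - t) * h 0 + t * h y"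
        using convex_onD[OF h t(1,2), of 0 y] by simp
      moreover have "- c - 1 \<le> h (t *\<^sub>R y)" using t by (intro near) simp
      moreover have "(1 - t) * h 0 \<le> f 0 + 1 + t * (c + \<epsilon>)"
      proof -
        have "(1 - t) * h 0 \<le> (1 - t) * (f 0 + 1)" using h0 t by (intro mult_left_mono) auto
        moreover have "t * (- f 0 - 1) \<le> t * (c + \<epsilon>)" using c0 \<epsilon> t by (intro mult_left_mono) auto
        ultimately show ?thesis by (simp add: algebra_simps)
      qed
      ultimately have "- c - 1 - f 0 - 1 \<le> t * (h y + c + \<epsilon>)" by (simp add: algebra_simps)
      moreover have "- c - 1 - f 0 - 1 \<ge> t * (- \<epsilon> * norm y)"
      proof -
        have "t * (- \<epsilon> * norm y) = - (\<epsilon> * r)" using t(4) by (simp add: algebra_simps)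
        then show ?thesis using \<epsilon>r by simp
      qed
      ultimately have "t * (- \<epsilon> * norm y) \<le> t * (h y + c + \<epsilon>)" by linarith
      then have "- \<epsilon> * norm y \<le> h y + c + \<epsilon>" using t(3) mult_le_cancel_left_pos by blast
      then show ?thesis by simp
    qed
    obtain p where p: "norm p \<le> \<epsilon>" "\<And>y. ereal (- c - \<epsilon> + p \<bullet> (y - 0)) \<le> ereal (h y)"
    proof (rule conic_minorant_imp_affine_minorant)
      show "convex_ereal (\<lambda>y. ereal (h y))" using h by (simp add: convex_ereal_iff)
      show "ereal (- c - \<epsilon> - \<epsilon> * norm (y - 0)) \<le> ereal (h y)" for y using le by simp
    qed (use \<epsilon> in auto)
    have "fenchel (\<lambda>x. ereal (F j x)) (x + p) \<le> ereal (c + \<epsilon>)"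
      unfolding fenchel_le_iff
    proof
      fix y show "ereal (y \<bullet> (x + p) - (c + \<epsilon>)) \<le> ereal (F j y)"
        using p(2)[of y] by (simp add: h_def inner_add_right inner_commute algebra_simps)
    qed
    then show ?case using p(1) by (intro exI[of _ "x + p"]) simp
  qed
qed

text \<open>For the lower bound, one test point \<open>z\<close> with
  \<open>f z < z \<bullet> x - a\<close> works for all large \<open>j\<close>. A recovery sequence
  is constant where the limit is infinite; where it is finite it comes from
  \<open>fenchel_recovery\<close> by diagonalization.\<close>

lemma fenchel_epi_converges:
  fixes F :: "nat \<Rightarrow> 'a::euclidean_space \<Rightarrow> real"
  assumes F: "\<And>j. convex_on UNIV (F j)" "\<And>x. (\<lambda>j. F j x) \<longlonglongrightarrow> f x"
  shows "epi_converges (\<lambda>j. fenchel (\<lambda>x. ereal (F j x))) (fenchel (\<lambda>x. ereal (f x)))"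
  unfolding epi_converges_def
proof (intro allI conjI impI)
  let ?U = "\<lambda>j. fenchel (\<lambda>x. ereal (F j x))" and ?u = "fenchel (\<lambda>x. ereal (f x))"
  fix x
  have low: "\<forall>\<^sub>F j in sequentially. ereal a < ?U j (xs j)"
    if xs: "xs \<longlonglongrightarrow> x" and a: "ereal a < ?u x" for xs a
  proof -
    from a obtain z where z: "f z < z \<bullet> x - a" by (auto simp: less_fenchel_iff)
    have "(\<lambda>j. z \<bullet> xs j - a - F j z) \<longlonglongrightarrow> z \<bullet> x - a - f z" by (intro tendsto_intros xs F)
    then have "\<forall>\<^sub>F j in sequentially. 0 < z \<bullet> xs j - a - F j z" using z by (intro order_tendstoD) auto
    then show ?thesis by (rule eventually_mono) (auto simp: less_fenchel_iff intro!: exI[of _ z])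
  qed
  show liminf: "?u x \<le> liminf (\<lambda>j. ?U j (xs j))" if xs: "xs \<longlonglongrightarrow> x" for xs
    unfolding le_Liminf_iff
  proof (intro allI impI)
    fix b assume "b < ?u x"
    then obtain a where a: "b < ereal a" "ereal a < ?u x" using ereal_dense2 by blast
    show "\<forall>\<^sub>F j in sequentially. b < ?U j (xs j)"
      using low[OF xs a(2)] by (rule eventually_mono) (use a(1) in \<open>auto intro: less_trans\<close>)
  qed
  show "\<exists>xs. xs \<longlonglongrightarrow> x \<and> (\<lambda>j. ?U j (xs j)) \<longlonglongrightarrow> ?u x"
  proof (cases "?u x")
    case PInf
    have "(\<lambda>j. ?U j x) \<longlonglongrightarrow> ?u x"
      unfolding PInf tendsto_PInfty using low[of "\<lambda>_. x"] PInf by simp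
    then show ?thesis by (intro exI[of _ "\<lambda>_. x"]) simp
  next
    case MInf
    then show ?thesis using fenchel_young[of 0 x "\<lambda>x. ereal (f x)"] by simp
  next
    case (real c)
    let ?P = "\<lambda>\<epsilon> j. \<exists>p. norm (p - x) \<le> \<epsilon> \<and> ?U j p \<le> ereal (c + \<epsilon>)"
    have mono: "?P \<epsilon>' j" if "?P \<epsilon> j" "\<epsilon> \<le> \<epsilon>'" for \<epsilon> \<epsilon>' j
    proof -
      from that obtain p where "norm (p - x) \<le> \<epsilon>" "?U j p \<le> ereal (c + \<epsilon>)" by blast
      moreover have "ereal (c + \<epsilon>) \<le> ereal (c + \<epsilon>')" using that by simp
      ultimately show ?thesis using that(2) by (meson order_trans)
    qed
    obtain e where e: "e \<longlonglongrightarrow> 0" "\<forall>\<^sub>F j in sequentially. ?P (e j) j"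
      by (rule diagonal_eventually[of ?P]) (erule (1) mono, erule fenchel_recovery[OF F real])
    \<comment> \<open>The value \<open>x\<close> is a default for the finitely many indices at which
      \<open>?P (e j) j\<close> fails.\<close>
    define xs where "xs j = (if ?P (e j) j then SOME p. norm (p - x) \<le> e j \<and> ?U j p \<le> ereal (c + e j) else x)" for j
    have xs: "\<forall>\<^sub>F j in sequentially. norm (xs j - x) \<le> e j \<and> ?U j (xs j) \<le> ereal (c + e j)"
      using e(2)
    proof eventually_elim
      case (elim j)
      from someI_ex[OF elim] show ?case using elim by (simp add: xs_def)
    qed
    have lim: "xs \<longlonglongrightarrow> x"
    proof (rule LIM_zero_cancel, rule Lim_null_comparison[OF _ e(1)])
      show "\<forall>\<^sub>F j in sequentially. norm (xs j - x) \<le> e j" using xs by (rule eventually_mono) simp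
    qed
    have "(\<lambda>j. ?U j (xs j)) \<longlonglongrightarrow> ?u x"
    proof (rule order_tendstoI)
      fix a assume "a < ?u x"
      then show "\<forall>\<^sub>F j in sequentially. a < ?U j (xs j)"
        using liminf[OF lim] by (simp add: le_Liminf_iff)
    next
      fix a assume "?u x < a"
      then obtain b where b: "c < b" "ereal b < a" using real ereal_dense2[of "?u x" a] by auto
      have "(\<lambda>j. c + e j) \<longlonglongrightarrow> c + 0" by (intro tendsto_intros e)
      then have "\<forall>\<^sub>F j in sequentially. c + e j < b" using b(1) by (intro order_tendstoD) auto
      with xs show "\<forall>\<^sub>F j in sequentially. ?U j (xs j) < a"
      proof eventually_elim
        case (elim j)
        then have "?U j (xs j) \<le> ereal (c + e j)" "ereal (c + e j) < ereal b" by auto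
        then show ?case using b(2) by order
      qed
    qed
    then show ?thesis using lim by blast
  qed
qed

section \<open>Epi-convergence implies pointwise convergence of the conjugates\<close>

lemma epi_converges_subseq:
  assumes "epi_converges us u" "strict_mono r"
  shows "epi_converges (\<lambda>k. us (r k)) u"
  unfolding epi_converges_def
proof (intro allI conjI impI)
  fix x
  show "\<exists>xs. xs \<longlonglongrightarrow> x \<and> (\<lambda>k. us (r k) (xs k)) \<longlonglongrightarrow> u x"
  proof -
    obtain xs where xs: "xs \<longlonglongrightarrow> x" "(\<lambda>j. us j (xs j)) \<longlonglongrightarrow> u x"
      using assms(1) unfolding epi_converges_def by blast
    show ?thesis
      using LIMSEQ_subseq_LIMSEQ[OF xs(1) assms(2)] LIMSEQ_subseq_LIMSEQ[OF xs(2) assms(2)]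
      by (intro exI[of _ "xs \<circ> r"]) (simp add: o_def)
  qed
  fix xs assume xs: "xs \<longlonglongrightarrow> x"
  \<comment> \<open>The lower bound is assumed for sequences indexed by all \<open>j\<close>, so
    \<open>xs\<close> is spread over the range of \<open>r\<close> and the gaps are filled with the
    limit \<open>x\<close>.\<close>
  define ys where "ys j = (if j \<in> range r then xs (inv r j) else x)" for j
  have inj: "inj r" using assms(2) by (rule strict_mono_imp_inj_on)
  have ysr: "ys (r k) = xs k" for k using inj by (simp add: ys_def)
  have "ys \<longlonglongrightarrow> x"
  proof (rule tendstoI)
    fix e :: real assume "e > 0"
    then obtain N where N: "\<And>k. k \<ge> N \<Longrightarrow> dist (xs k) x < e"
      using xs unfolding tendsto_iff eventually_sequentially by blast
    show "\<forall>\<^sub>F j in sequentially. dist (ys j) x < e"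
      unfolding eventually_sequentially
    proof (intro exI[of _ "r N"] allI impI)
      fix j assume j: "r N \<le> j"
      show "dist (ys j) x < e"
      proof (cases "j \<in> range r")
        case True
        then obtain k where k: "j = r k" by blast
        then have "N \<le> k" using j assms(2) by (simp add: strict_mono_less_eq)
        then show ?thesis using N k ysr by simp
      qed (use \<open>e > 0\<close> in \<open>simp add: ys_def\<close>)
    qed
  qed
  then have "u x \<le> liminf (\<lambda>j. us j (ys j))" using assms(1) unfolding epi_converges_def by blast
  also have "\<dots> \<le> liminf ((\<lambda>j. us j (ys j)) \<circ> r)" by (rule liminf_subseq_mono[OF assms(2)])
  finally show "u x \<le> liminf (\<lambda>k. us (r k) (xs k))" by (simp add: o_def ysr)
qed

text \<open>A point witnessing the strict bound for \<open>u\<close> is moved along its recovery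
  sequence and eventually witnesses the same bound for \<open>us j\<close>.\<close>

lemma epi_converges_fenchel_gt:
  assumes "epi_converges us u" "ereal m < fenchel u y"
  shows "\<forall>\<^sub>F j in sequentially. ereal m < fenchel (us j) y"
proof -
  obtain x where x: "u x < ereal (x \<bullet> y - m)" using assms(2) by (auto simp: less_fenchel_iff)
  then obtain a where a: "u x < ereal a" "a < x \<bullet> y - m" using ereal_dense2[of "u x" "ereal (x \<bullet> y - m)"] by auto
  obtain xs where xs: "xs \<longlonglongrightarrow> x" "(\<lambda>j. us j (xs j)) \<longlonglongrightarrow> u x"
    using assms(1) unfolding epi_converges_def by blast
  have "\<forall>\<^sub>F j in sequentially. us j (xs j) < ereal a" using xs(2) a(1) by (rule order_tendstoD)
  moreover have "(\<lambda>j. xs j \<bullet> y - m) \<longlonglongrightarrow> x \<bullet> y - m" by (intro tendsto_intros xs)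
  then have "\<forall>\<^sub>F j in sequentially. a < xs j \<bullet> y - m" using a(2) by (rule order_tendstoD)
  ultimately show ?thesis
  proof eventually_elim
    case (elim j)
    then have "us j (xs j) < ereal (xs j \<bullet> y - m)" by (auto intro: less_trans)
    then show ?case unfolding less_fenchel_iff by blast
  qed
qed

text \<open>If \<open>us (r k)\<close> admits points \<open>xs k\<close> violating the bound, then on the segment from a recovery
  sequence to \<open>xs k\<close> the convexity of \<open>us (r k)\<close> gives points at distance at most \<open>\<rho>\<close> whose
  limit contradicts either the bound for \<open>u\<close> or its superlinear growth; so no point can escape
  to infinity.\<close>

lemma epi_converges_fenchel_lt:
  fixes us :: "nat \<Rightarrow> 'a::euclidean_space \<Rightarrow> ereal"
  assumes epi: "epi_converges us u" and us: "range us \<subseteq> Conv_sc" and u: "u \<in> Conv_sc"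
    and m: "fenchel u y < ereal m"
  shows "\<forall>\<^sub>F j in sequentially. fenchel (us j) y < ereal m"
proof (rule ccontr)
  assume "\<not> ?thesis"
  then obtain r where r: "strict_mono (r::nat\<Rightarrow>nat)" "\<And>k. ereal m \<le> fenchel (us (r k)) y"
    by (auto dest!: not_eventually_sequentiallyD simp: not_less)
  define v where "v k = us (r k)" for k
  have vC: "v k \<in> Conv_sc" for k using us by (auto simp: v_def)
  have v_epi: "epi_converges v u" using epi_converges_subseq[OF epi r(1)] by (simp add: v_def[abs_def])
  obtain m' where m': "fenchel u y < ereal m'" "m' < m" using m ereal_dense2[of "fenchel u y" "ereal m"] by auto
  have "\<exists>x. v k x < ereal (x \<bullet> y - m')" for k
  proof -
    have "ereal m' < fenchel (v k) y" using r(2)[of k] m'(2) unfolding v_def by (metis ereal_less_ereal_Ex less_ereal.simps(1) less_le_trans)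
    then show ?thesis by (simp add: less_fenchel_iff)
  qed
  then obtain xs where xs: "\<And>k. v k (xs k) < ereal (xs k \<bullet> y - m')" by metis
  obtain x0 where x0: "u x0 \<noteq> \<infinity>" using Conv_scD(2)[OF u] by blast
  then obtain a where a: "u x0 = ereal a" using Conv_scD(1)[OF u, of x0] by (cases "u x0") auto
  obtain zs where zs: "zs \<longlonglongrightarrow> x0" "(\<lambda>k. v k (zs k)) \<longlonglongrightarrow> u x0"
    using v_epi unfolding epi_converges_def by blast
  have vz: "\<forall>\<^sub>F k in sequentially. v k (zs k) < ereal (a + 1)"
    using zs(2) by (rule order_tendstoD) (simp add: a)
  \<comment> \<open>Slope \<open>norm y + 1\<close> beats the linear function of \<open>y\<close> by
    a full \<open>norm x\<close>; this confines the limit point \<open>q\<close> in the second case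
    of the final distinction.\<close>
  obtain B where B: "\<And>x. ereal ((norm y + 1) * norm x - B) \<le> u x"
    using Conv_sc_growth[OF u, of "norm y + 1"] by auto
  \<comment> \<open>In the second case the estimates give
    \<open>norm q \<le> B + (a + 1 - x0 \<bullet> y)\<close>, while \<open>q\<close> has distance at
    least \<open>\<rho>\<close> from \<open>x0\<close>; this value makes the two
    incompatible.\<close>
  define \<rho> where "\<rho> = \<bar>B\<bar> + norm x0 + \<bar>a + 1 - x0 \<bullet> y\<bar> + 1"
  have \<rho>: "\<rho> > 0" by (simp add: \<rho>_def add_nonneg_pos)
  \<comment> \<open>\<open>p k\<close> is either \<open>xs k\<close> itself or the point at distance
    \<open>\<rho>\<close> from \<open>zs k\<close> on the segment towards it; either way it stays in
    a compact set.\<close>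
  define t where "t k = (if norm (xs k - zs k) \<le> \<rho> then 1 else \<rho> / norm (xs k - zs k))" for k
  define p where "p k = (1 - t k) *\<^sub>R zs k + t k *\<^sub>R xs k" for k
  have t: "0 < t k" "t k \<le> 1" for k 
  proof -
    have "norm (xs k - zs k) > 0" if "\<not> norm (xs k - zs k) \<le> \<rho>" using that \<rho> by linarith
    then show "0 < t k" "t k \<le> 1" using \<rho> by (auto simp: t_def divide_le_eq_1)
  qed
  have pz: "p k - zs k = t k *\<^sub>R (xs k - zs k)" for k by (simp add: p_def algebra_simps)
  have np: "norm (p k - zs k) \<le> \<rho>" for k unfolding pz using t[of k] \<rho> by (auto simp: t_def)
  have t1: "t k = 1" if "norm (p k - zs k) < \<rho>" for k
    using that \<rho> unfolding pz by (auto simp: t_def split: if_splits)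
  have vp: "v k (p k) \<le> ereal (p k \<bullet> y - m' + (1 - t k) * (a + 1 - zs k \<bullet> y + m'))"
    if "v k (zs k) < ereal (a + 1)" for k
  proof (cases "t k = 1")
    case True
    then show ?thesis using xs[of k] by (simp add: p_def less_imp_le)
  next
    case False
    then have tk: "0 < t k" "t k < 1" using t[of k] by auto
    have "v k (p k) \<le> ereal (1 - t k) * v k (zs k) + ereal (t k) * v k (xs k)"
      using Conv_scD(3)[OF vC, of k] tk unfolding convex_ereal_def p_def by blast
    also have "\<dots> \<le> ereal (1 - t k) * ereal (a + 1) + ereal (t k) * ereal (xs k \<bullet> y - m')"
      using tk that xs[of k] by (intro add_mono ereal_mult_left_mono) (auto simp: less_imp_le)
    also have "\<dots> = ereal (p k \<bullet> y - m' + (1 - t k) * (a + 1 - zs k \<bullet> y + m'))"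
      by (simp add: p_def inner_add_left algebra_simps)
    finally show ?thesis .
  qed
  obtain b where b: "\<And>k. norm (zs k) \<le> b"
    using convergent_imp_Bseq[OF convergentI[OF zs(1)]] unfolding Bseq_def by auto
  have "\<forall>k. p k \<in> cball 0 (\<rho> + b)"
  proof
    fix k
    have "norm (p k) \<le> norm (p k - zs k) + norm (zs k)" by (metis diff_add_cancel norm_triangle_ineq)
    then show "p k \<in> cball 0 (\<rho> + b)" using np[of k] b[of k] by simp
  qed
  then obtain l q where l: "strict_mono (l::nat\<Rightarrow>nat)" "(p \<circ> l) \<longlonglongrightarrow> q"
    using compact_cball[of "0::'a" "\<rho> + b"] unfolding compact_def by blast
  have zl: "(\<lambda>k. zs (l k)) \<longlonglongrightarrow> x0" using LIMSEQ_subseq_LIMSEQ[OF zs(1) l(1)] by (simp add: o_def)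
  have pl: "(\<lambda>k. p (l k)) \<longlonglongrightarrow> q" using l(2) by (simp add: o_def)
  have vzl: "\<forall>\<^sub>F k in sequentially. v (l k) (zs (l k)) < ereal (a + 1)"
    using eventually_subseq[OF l(1) vz] .
  have liminf: "u q \<le> liminf (\<lambda>k. v (l k) (p (l k)))"
    using epi_converges_subseq[OF v_epi l(1)] pl unfolding epi_converges_def by blast
  have bound: "u q \<le> ereal w" if "w' \<longlonglongrightarrow> w" "\<forall>\<^sub>F k in sequentially. v (l k) (p (l k)) \<le> ereal (w' k)" for w w'
  proof -
    note liminf
    also have "liminf (\<lambda>k. v (l k) (p (l k))) \<le> liminf (\<lambda>k. ereal (w' k))" by (rule Liminf_mono[OF that(2)])
    also have "\<dots> = ereal w" using that(1) by (intro lim_imp_Liminf) auto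
    finally show ?thesis .
  qed
  have lim1: "(\<lambda>k. p (l k) \<bullet> y - m') \<longlonglongrightarrow> q \<bullet> y - m'" by (intro tendsto_intros pl)
  have lim2: "(\<lambda>k. p (l k) \<bullet> y - m' + max 0 (a + 1 - zs (l k) \<bullet> y + m'))
      \<longlonglongrightarrow> q \<bullet> y - m' + max 0 (a + 1 - x0 \<bullet> y + m')" by (intro tendsto_intros pl zl)
  have limn: "(\<lambda>k. norm (p (l k) - zs (l k))) \<longlonglongrightarrow> norm (q - x0)" by (intro tendsto_intros pl zl)
  have fu: "ereal (x \<bullet> y - m') < u x" for x
  proof -
    have "\<not> ereal m' < fenchel u y" using m'(1) by simp
    moreover have "ereal (x \<bullet> y) - u x \<le> fenchel u y" by (rule fenchel_young)
    ultimately show ?thesis using m'(1) by (cases "u x"; cases "fenchel u y") auto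
  qed
  show False
  proof (cases "norm (q - x0) < \<rho>")
    case True
    then have "\<forall>\<^sub>F k in sequentially. norm (p (l k) - zs (l k)) < \<rho>" using limn by (intro order_tendstoD)
    with vzl have "\<forall>\<^sub>F k in sequentially. v (l k) (p (l k)) \<le> ereal (p (l k) \<bullet> y - m')"
    proof eventually_elim
      case (elim k)
      then show ?case using vp[of "l k"] t1[of "l k"] by simp
    qed
    from bound[OF lim1 this] show False using fu[of q] by simp
  next
    case False
    have "\<forall>\<^sub>F k in sequentially. v (l k) (p (l k)) \<le> ereal (p (l k) \<bullet> y - m' + max 0 (a + 1 - zs (l k) \<bullet> y + m'))"
      using vzl
    proof eventually_elim
      case (elim k)
      define X where "X = a + 1 - zs (l k) \<bullet> y + m'"
      have "(1 - t (l k)) * X \<le> (1 - t (l k)) * max 0 X"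
        using t(2)[of "l k"] by (intro mult_left_mono) auto
      also have "\<dots> \<le> 1 * max 0 X" using t(1)[of "l k"] by (intro mult_right_mono) auto
      finally have "(1 - t (l k)) * (a + 1 - zs (l k) \<bullet> y + m') \<le> max 0 (a + 1 - zs (l k) \<bullet> y + m')"
        by (simp add: X_def)
      then have "ereal (p (l k) \<bullet> y - m' + (1 - t (l k)) * (a + 1 - zs (l k) \<bullet> y + m'))
        \<le> ereal (p (l k) \<bullet> y - m' + max 0 (a + 1 - zs (l k) \<bullet> y + m'))" by simp
      with vp[OF elim] show ?case by (rule order_trans)
    qed
    from bound[OF lim2 this] have "u q \<le> ereal (q \<bullet> y - m' + max 0 (a + 1 - x0 \<bullet> y + m'))" .
    moreover have "x0 \<bullet> y - m' < a" using fu[of x0] a by simp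
    ultimately have "u q \<le> ereal (q \<bullet> y + (a + 1 - x0 \<bullet> y))" by (simp add: max_absorb2 algebra_simps)
    with B[of q] have "ereal ((norm y + 1) * norm q - B) \<le> ereal (q \<bullet> y + (a + 1 - x0 \<bullet> y))" by (rule order_trans)
    then have "(norm y + 1) * norm q \<le> B + q \<bullet> y + (a + 1 - x0 \<bullet> y)" by simp
    moreover have "q \<bullet> y \<le> norm y * norm q" using norm_cauchy_schwarz[of q y] by (simp add: mult.commute)
    ultimately have "norm q \<le> B + (a + 1 - x0 \<bullet> y)" by (simp add: algebra_simps)
    moreover have "\<rho> - norm x0 \<le> norm q" using False norm_triangle_ineq4[of q x0] by linarith
    ultimately show False unfolding \<rho>_def by linarith
  qed
qed

text \<open>Strict bounds \<open>- m\<close> and \<open>m\<close> on the conjugate at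
  \<open>y\<close> define open sets by the two preceding lemmas, and these cover
  \<open>Conv_sc\<close>, so \<open>K\<close> lies in finitely many of them. This is the form in
  which compactness enters the Arzela-Ascoli argument.\<close>

lemma compactin_fenchel_bounded:
  fixes K :: "('a::euclidean_space \<Rightarrow> ereal) set"
  assumes K: "compactin epi_topology K"
  shows "\<exists>B. \<forall>u\<in>K. \<bar>real_of_ereal (fenchel u y)\<bar> \<le> B"
proof -
  have KC: "K \<subseteq> Conv_sc" using K by (simp add: compactin_def topspace_epi_topology)
  define U where "U m = {u \<in> Conv_sc. ereal (- real m) < fenchel u y \<and> fenchel u y < ereal (real m)}" for m :: nat
  have "openin epi_topology (U m)" for m
    unfolding openin_epi_topology epi_open_def
  proof (intro conjI ballI allI impI)
    show "U m \<subseteq> Conv_sc" by (auto simp: U_def)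
    fix u us assume u: "u \<in> U m" and us: "range us \<subseteq> Conv_sc \<and> epi_converges us u"
    have "\<forall>\<^sub>F j in sequentially. ereal (- real m) < fenchel (us j) y"
      by (rule epi_converges_fenchel_gt) (use u us in \<open>auto simp: U_def\<close>)
    moreover have "\<forall>\<^sub>F j in sequentially. fenchel (us j) y < ereal (real m)"
      by (rule epi_converges_fenchel_lt[of us u]) (use u us in \<open>auto simp: U_def\<close>)
    ultimately show "\<forall>\<^sub>F j in sequentially. us j \<in> U m"
      by eventually_elim (use us in \<open>auto simp: U_def\<close>)
  qed
  moreover have "K \<subseteq> \<Union>(range U)"
  proof
    fix u assume "u \<in> K"
    then have u: "u \<in> Conv_sc" using KC by blast
    obtain m :: nat where m: "\<bar>real_of_ereal (fenchel u y)\<bar> < real m" using reals_Archimedean2 by blast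
    have "u \<in> U m"
      using u m fenchel_Conv_sc_finite[OF u, of y] unfolding U_def by (cases "fenchel u y") auto
    then show "u \<in> \<Union>(range U)" by blast
  qed
  ultimately obtain \<F> where \<F>: "finite \<F>" "\<F> \<subseteq> range U" "K \<subseteq> \<Union>\<F>"
    using K unfolding compactin_def by (metis (no_types, lifting) imageE)
  then obtain N where N: "finite N" "\<F> = U ` N" by (metis finite_subset_image)
  have "\<bar>real_of_ereal (fenchel u y)\<bar> \<le> real (Max (insert 0 N))" if "u \<in> K" for u
  proof -
    obtain m where m: "m \<in> N" "u \<in> U m" using \<open>u \<in> K\<close> \<F>(3) unfolding N(2) by blast
    have u: "u \<in> Conv_sc" using that KC by blast
    have "\<bar>real_of_ereal (fenchel u y)\<bar> \<le> real m"
      using m(2) fenchel_Conv_sc_finite[OF u, of y] unfolding U_def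
      by (cases "fenchel u y") auto
    also have "\<dots> \<le> real (Max (insert 0 N))" using N(1) m(1) by simp
    finally show ?thesis .
  qed
  then show ?thesis by blast
qed

section \<open>Hat functions and Gaussians\<close>

lemma cos_power_tendsto:
  "(\<lambda>n. cos (s / sqrt (real n)) ^ n) \<longlonglongrightarrow> exp (- s\<^sup>2 / 2)"
proof (cases "s = 0")
  case False
  have lim: "(\<lambda>n. cos (t / sqrt (real n)) ^ n) \<longlonglongrightarrow> exp (- t\<^sup>2 / 2)" if "t > 0" for t :: real
  proof (rule Lim_transform_eventually)
    \<comment> \<open>Real exponents suit the asymptotic expansion; they agree with natural powers
      because the base is eventually positive. Evenness of the cosine later covers negative
      \<open>s\<close>.\<close>
    show "(\<lambda>n. cos (t / sqrt (real n)) powr real n) \<longlonglongrightarrow> exp (- t\<^sup>2 / 2)"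
      using that by (real_asymp simp: power2_eq_square)
    have "(\<lambda>n. cos (t / sqrt (real n))) \<longlonglongrightarrow> 1" using that by real_asymp
    then have "\<forall>\<^sub>F n in sequentially. 0 < cos (t / sqrt (real n))" by (rule order_tendstoD) simp
    then show "\<forall>\<^sub>F n in sequentially. cos (t / sqrt (real n)) powr real n = cos (t / sqrt (real n)) ^ n"
      by (rule eventually_mono) (simp add: powr_realpow)
  qed
  have "cos (\<bar>s\<bar> / sqrt (real n)) = cos (s / sqrt (real n))" for n
    using cos_abs_real[of "s / sqrt (real n)"] by (simp add: abs_divide)
  then show ?thesis using lim[of "\<bar>s\<bar>"] False by simp
qed simp

lemma integral_lborel_affine:
  fixes f :: "'a::euclidean_space \<Rightarrow> real"
  assumes [measurable]: "f \<in> borel_measurable borel" and e: "e > 0"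
  shows "(\<integral>z. f z \<partial>lborel) = e ^ DIM('a) * (\<integral>y. f (x + e *\<^sub>R y) \<partial>lborel)"
proof -
  have "(\<integral>z. f z \<partial>lborel) = (\<integral>z. f z \<partial>density (distr lborel borel (\<lambda>y. x + e *\<^sub>R y)) (\<lambda>_. ennreal (\<bar>e\<bar> ^ DIM('a))))"
    using lborel_affine[of e x] e by simp
  also have "\<dots> = e ^ DIM('a) * (\<integral>y. f (x + e *\<^sub>R y) \<partial>lborel)"
    using e by (subst integral_density) (auto simp: integral_distr)
  finally show ?thesis .
qed

text \<open>The integrand is a product over the coordinates, so its integral is a product of
  one-dimensional normal integrals.\<close>

lemma integrable_gaussian: "integrable lborel (\<lambda>y::'a::euclidean_space. exp (- (norm y)\<^sup>2 / 2))"
proof (rule integrableI_bounded)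
  have prod: "ennreal (norm (exp (- (norm y)\<^sup>2 / 2))) = (\<Prod>b\<in>Basis. ennreal (exp (- (y \<bullet> b)\<^sup>2 / 2)))" for y :: 'a
    unfolding power2_norm_eq_inner euclidean_inner[of y y]
    by (subst prod_ennreal) (auto simp: exp_sum[symmetric] sum_divide_distrib sum_negf power2_eq_square)
  have "(\<integral>\<^sup>+s. ennreal (exp (- s\<^sup>2 / 2)) \<partial>lborel) < \<infinity>"
  proof -
    have "integrable lborel (\<lambda>s. sqrt (2 * pi) * std_normal_density s)" by auto
    then have "integrable lborel (\<lambda>s::real. exp (- s\<^sup>2 / 2))"
      by (simp add: std_normal_density_def)
    then show ?thesis by (simp add: integrable_iff_bounded)
  qed
  then show "(\<integral>\<^sup>+y. ennreal (norm (exp (- (norm (y::'a))\<^sup>2 / 2))) \<partial>lborel) < \<infinity>"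
    unfolding prod by (subst nn_integral_lborel_prod) (auto simp: power_less_top_ennreal)
qed simp

lemma integral_gaussian_pos: "0 < (\<integral>y. exp (- (norm (y::'a::euclidean_space))\<^sup>2 / 2) \<partial>lborel)"
proof -
  have "(\<integral>y. exp (- (norm (y::'a))\<^sup>2 / 2) \<partial>lborel) \<noteq> 0"
    by (subst integral_nonneg_eq_0_iff_AE[OF integrable_gaussian]) (auto simp: AE_iff_null)
  moreover have "0 \<le> (\<integral>y. exp (- (norm (y::'a))\<^sup>2 / 2) \<partial>lborel)" by simp
  ultimately show ?thesis by linarith
qed

section \<open>Smoothing with hat kernels\<close>

lemma set_integrable_cball_continuous:
  fixes f :: "'a::euclidean_space \<Rightarrow> real"
  assumes "continuous_on UNIV f"
  shows "set_integrable lborel (cball a r) f"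
  unfolding set_integrable_def
  by (intro borel_integrable_compact continuous_on_subset[OF assms]) auto

definition hat :: "real \<Rightarrow> 'a::euclidean_space \<Rightarrow> real" where
  "hat n z = max 0 (1 - n * norm z)"

definition hat_mass :: "'a::euclidean_space itself \<Rightarrow> real \<Rightarrow> real" where
  "hat_mass _ n = (\<integral>z. hat n (z::'a) \<partial>lborel)"

text \<open>Because the hat is even, this is convolution with the hat normalized to integral
  one.\<close>

definition hat_smooth :: "real \<Rightarrow> ('a::euclidean_space \<Rightarrow> real) \<Rightarrow> 'a \<Rightarrow> real" where
  "hat_smooth n f x = (\<integral>z. f (x + z) * hat n z \<partial>lborel) / hat_mass TYPE('a) n"

lemma hat_nonneg: "hat n z \<ge> 0"
  by (simp add: hat_def)

lemma hat_eq_0: "n \<ge> 1 \<Longrightarrow> norm z > 1 \<Longrightarrow> hat n z = 0"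
  using mult_mono[of 1 n 1 "norm z"] by (simp add: hat_def)

lemma continuous_on_hat: "continuous_on S (hat n)"
  unfolding hat_def[abs_def] by (intro continuous_intros)

lemma integrable_hat:
  fixes f :: "'a::euclidean_space \<Rightarrow> real"
  assumes f: "continuous_on UNIV f" and n: "n \<ge> 1"
  shows "integrable lborel (\<lambda>z. f z * hat n z)"
proof -
  have "integrable lborel (\<lambda>z. indicator (cball 0 1) z *\<^sub>R (f z * hat n z))"
    by (intro borel_integrable_compact continuous_intros continuous_on_hat continuous_on_subset[OF f]) auto
  moreover have "indicator (cball 0 1) z *\<^sub>R (f z * hat n z) = f z * hat n z" for z
    using hat_eq_0[OF n, of z] by (auto simp: indicator_def)
  ultimately show ?thesis by (simp only:)
qed

lemma hat_mass_pos:
  assumes n: "n \<ge> 1"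
  shows "hat_mass TYPE('a::euclidean_space) n > 0"
proof -
  have int: "integrable lborel (\<lambda>z::'a. hat n z)"
    using integrable_hat[of "\<lambda>_::'a. 1" n] n by (simp add: continuous_on_const)
  have "(\<integral>z. (1 / 2 :: real) * indicator (ball 0 (1 / (2 * n))) (z::'a) \<partial>lborel) \<le> (\<integral>z. hat n (z::'a) \<partial>lborel)"
  proof (rule integral_mono)
    show "integrable lborel (\<lambda>z::'a. (1 / 2 :: real) * indicator (ball 0 (1 / (2 * n))) z)"
      using emeasure_lborel_ball_finite[of "0::'a" "1 / (2 * n)"]
      by (intro integrable_mult_right integrable_real_indicator) auto
    show "(1 / 2 :: real) * indicator (ball 0 (1 / (2 * n))) z \<le> hat n z" for z :: 'a
      using n by (auto simp: indicator_def hat_def field_simps)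
  qed (rule int)
  moreover have "measure lborel (ball (0::'a) (1 / (2 * n))) > 0"
    using n by (intro content_ball_pos) auto
  moreover have "(\<integral>z. (1 / 2 :: real) * indicator (ball 0 (1 / (2 * n))) (z::'a) \<partial>lborel)
      = measure lborel (ball (0::'a) (1 / (2 * n))) / 2" by simp
  ultimately show ?thesis unfolding hat_mass_def by linarith
qed

lemma hat_smooth_convex:
  fixes f :: "'a::euclidean_space \<Rightarrow> real"
  assumes f: "convex_on UNIV f" and n: "n \<ge> 1"
  shows "convex_on UNIV (hat_smooth n f)"
proof -
  have sh: "convex_on UNIV (\<lambda>x. f (x + z))" for z
    by (rule convex_on_compose_affine[OF f]) (simp add: algebra_simps)
  have "convex_on UNIV (\<lambda>x. \<integral>z. f (x + z) * hat n z \<partial>lborel)"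
  proof (rule convex_on_integral)
    show "convex_on UNIV (\<lambda>x. f (x + z) * hat n z)" for z
      using convex_on_cmul[OF hat_nonneg[of n z] sh[of z]] by (simp add: mult.commute)
    show "integrable lborel (\<lambda>z. f (x + z) * hat n z)" for x
    proof (rule integrable_hat[OF _ n])
      show "continuous_on UNIV (\<lambda>z. f (x + z))" using sh[of x] by (simp add: convex_continuous add.commute)
    qed
  qed
  then show ?thesis
    unfolding hat_smooth_def[abs_def] by (rule convex_on_cdiv[OF less_imp_le[OF hat_mass_pos[OF n]]])
qed

text \<open>The kernel charges only \<open>norm z \<le> 1 / n \<le> 1\<close>, and
  \<open>2 * B\<close> is a Lipschitz constant of \<open>f\<close> on the ball of radius
  \<open>r + 1\<close>; this explains the radius \<open>r + 2\<close>. The error depends on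
  \<open>f\<close> only through \<open>B\<close>, as uniformity over a family requires.\<close>

lemma hat_smooth_close:
  fixes f :: "'a::euclidean_space \<Rightarrow> real"
  assumes f: "convex_on UNIV f" and n: "n \<ge> 1" and B: "\<And>x. norm x \<le> r + 2 \<Longrightarrow> \<bar>f x\<bar> \<le> B"
    and x: "norm x \<le> r"
  shows "\<bar>hat_smooth n f x - f x\<bar> \<le> 2 * B / n"
proof -
  let ?a = "hat_mass TYPE('a) n"
  have a: "?a > 0" using n by (rule hat_mass_pos)
  have fc: "continuous_on UNIV (\<lambda>z. f (x + z))"
    by (intro convex_continuous convex_on_compose_affine[OF f]) (simp add: algebra_simps)
  have int: "integrable lborel (\<lambda>z. f (x + z) * hat n z)" "integrable lborel (\<lambda>z. c * hat n (z::'a))" for c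
    by (intro integrable_hat n fc continuous_intros)+
  have B0: "B \<ge> 0" using B[of x] x by linarith
  have "\<bar>(\<integral>z. f (x + z) * hat n z - f x * hat n z \<partial>lborel)\<bar> \<le> (\<integral>z. 2 * B / n * hat n (z::'a) \<partial>lborel)"
  proof (rule integral_abs_bound_integral)
    fix z :: 'a
    show "\<bar>f (x + z) * hat n z - f x * hat n z\<bar> \<le> 2 * B / n * hat n z"
    proof (cases "n * norm z \<le> 1")
      case True
      then have nz: "norm z \<le> 1 / n" using n by (simp add: field_simps)
      also have "\<dots> \<le> 1" using n by simp
      finally have "norm (x + z) \<le> r + 1" using norm_triangle_ineq[of x z] x by simp
      then have "\<bar>f (x + z) - f x\<bar> \<le> 2 * B * norm ((x + z) - x)"
        by (intro convex_lipschitz[OF f, of "r + 1"] B) (use x in auto)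
      also have "\<dots> \<le> 2 * B * (1 / n)" using nz B0 by (intro mult_left_mono) auto
      finally have "\<bar>f (x + z) - f x\<bar> * hat n z \<le> 2 * B * (1 / n) * hat n z"
        by (rule mult_right_mono) (rule hat_nonneg)
      then show ?thesis by (simp add: left_diff_distrib[symmetric] abs_mult hat_nonneg)
    qed (simp add: hat_def)
  qed (use int in auto)
  also have "\<dots> = 2 * B / n * ?a" by (simp add: hat_mass_def)
  also have "(\<integral>z. f (x + z) * hat n z - f x * hat n z \<partial>lborel) = (hat_smooth n f x - f x) * ?a"
    using int a by (simp add: hat_smooth_def left_diff_distrib) (simp add: hat_mass_def)
  finally have "\<bar>hat_smooth n f x - f x\<bar> * ?a \<le> 2 * B / n * ?a"
    by (simp only: abs_mult abs_of_pos[OF a])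
  then show ?thesis using a mult_le_cancel_right_pos by blast
qed

text \<open>Only the slope is recorded: the functionals of interest vanish on all affine functions,
  so the constant may be anything.\<close>

lemma hat_smooth_affine:
  assumes n: "n \<ge> 1"
  obtains c' where "\<And>x. hat_smooth n (\<lambda>x. w \<bullet> x + c) x = w \<bullet> x + c'"
proof
  fix x :: 'a
  let ?a = "hat_mass TYPE('a) n"
  have a: "?a > 0" using n by (rule hat_mass_pos)
  have int: "integrable lborel (\<lambda>z. (w \<bullet> x) * hat n z)" "integrable lborel (\<lambda>z. (w \<bullet> z + c) * hat n z)"
    by (intro integrable_hat n continuous_intros)+
  have "(\<integral>z. (w \<bullet> (x + z) + c) * hat n z \<partial>lborel) = (\<integral>z. (w \<bullet> x) * hat n z + (w \<bullet> z + c) * hat n z \<partial>lborel)"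
    by (simp add: inner_add_right algebra_simps)
  also have "\<dots> = (w \<bullet> x) * ?a + (\<integral>z. (w \<bullet> z + c) * hat n z \<partial>lborel)"
    by (subst Bochner_Integration.integral_add[OF int]) (simp add: hat_mass_def)
  finally show "hat_smooth n (\<lambda>x. w \<bullet> x + c) x = w \<bullet> x + (\<integral>z. (w \<bullet> z + c) * hat n z \<partial>lborel) / ?a"
    using a by (simp add: hat_smooth_def add_divide_distrib)
qed

section \<open>Additivity of dual valuations\<close>

text \<open>The properties of \<open>Z\<close> transported by conjugation. The values of
  \<open>\<mu>\<close> matter on convex functions only, hence the convexity hypotheses in each
  axiom. Continuity is stated for pointwise convergent sequences, the counterpart of
  epi-convergence.\<close>

locale dual_valuation =
  fixes \<mu> :: "('a::euclidean_space \<Rightarrow> real) \<Rightarrow> real"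
  assumes val: "\<lbrakk>convex_on UNIV f; convex_on UNIV g; convex_on UNIV (\<lambda>x. min (f x) (g x))\<rbrakk>
      \<Longrightarrow> \<mu> (\<lambda>x. max (f x) (g x)) + \<mu> (\<lambda>x. min (f x) (g x)) = \<mu> f + \<mu> g"
    and add_affine: "convex_on UNIV f \<Longrightarrow> \<mu> (\<lambda>x. f x + (w \<bullet> x + c)) = \<mu> f"
    and homog: "convex_on UNIV f \<Longrightarrow> t > 0 \<Longrightarrow> \<mu> (\<lambda>x. t * f x) = t * \<mu> f"
    and conts: "\<lbrakk>\<And>j. convex_on UNIV (F j); convex_on UNIV f; \<And>x. (\<lambda>j. F j x) \<longlonglongrightarrow> f x\<rbrakk>
      \<Longrightarrow> (\<lambda>j. \<mu> (F j)) \<longlonglongrightarrow> \<mu> f"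
begin

lemma zero: "\<mu> (\<lambda>x. 0) = 0"
  using homog[of "\<lambda>x. 0" 2] by (simp add: convex_on_const)

lemma affine: "\<mu> (\<lambda>x. w \<bullet> x + c) = 0"
  using add_affine[of "\<lambda>x. 0" w c] zero by (simp add: convex_on_const)

lemma add_const: "convex_on UNIV f \<Longrightarrow> \<mu> (\<lambda>x. f x + c) = \<mu> f"
  using add_affine[of f 0 c] by simp

lemma continuous_on_param:
  fixes g :: "'b::metric_space \<Rightarrow> 'a \<Rightarrow> real"
  assumes g: "\<And>y. convex_on UNIV (g y)" "\<And>x. continuous_on UNIV (\<lambda>y. g y x)"
  shows "continuous_on UNIV (\<lambda>y. \<mu> (g y))"
  unfolding continuous_on_sequentially
proof (intro ballI allI impI)
  fix ys y assume "(\<forall>n. ys n \<in> UNIV) \<and> ys \<longlonglongrightarrow> (y::'b)"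
  then have ys: "ys \<longlonglongrightarrow> y" by simp
  have "(\<lambda>n. \<mu> (g (ys n))) \<longlonglongrightarrow> \<mu> (g y)"
    by (rule conts) (use g continuous_on_tendsto_compose[OF g(2) ys] in auto)
  then show "((\<lambda>y. \<mu> (g y)) \<circ> ys) \<longlonglongrightarrow> \<mu> (g y)" by (simp add: o_def)
qed

text \<open>The valuation property is applied to \<open>f + m l\<^sub>+\<close> and \<open>f + m l + l\<^sub>+\<close>, whose maximum is
  \<open>f + (m + 1) l\<^sub>+\<close> and whose minimum is the affine perturbation \<open>f + m l\<close> of \<open>f\<close>.\<close>

lemma add_hinge:
  assumes f: "convex_on UNIV f"
  shows "\<mu> (\<lambda>x. f x + max 0 (w \<bullet> x + c)) = \<mu> f + \<mu> (\<lambda>x. max 0 (w \<bullet> x + c))"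
proof -
  define l where "l = (\<lambda>x. w \<bullet> x + c)"
  have l: "convex_on UNIV l" unfolding l_def by (rule convex_on_affine)
  have h: "convex_on UNIV (\<lambda>x. max 0 (l x))"
    by (rule convex_on_max_UNIV) (auto simp: convex_on_const l)
  have fh: "convex_on UNIV (\<lambda>x. f x + a * max 0 (l x))" if "a \<ge> 0" for a
    using that f h by (intro convex_on_add convex_on_cmul) auto
  \<comment> \<open>\<open>D\<close> is the increment caused by one hinge on top of
    \<open>f\<close>; the valuation identity shows that each further copy of the hinge adds the same
    amount.\<close>
  define D where "D = \<mu> (\<lambda>x. f x + max 0 (l x)) - \<mu> f"
  have step: "\<mu> (\<lambda>x. f x + real (Suc m) * max 0 (l x)) = \<mu> (\<lambda>x. f x + real m * max 0 (l x)) + D" for m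
  proof -
    have aff: "convex_on UNIV (\<lambda>x. g x + real m * l x)"
       "\<mu> (\<lambda>x. g x + real m * l x) = \<mu> g" if "convex_on UNIV g" for g
      using add_affine[of g "real m *\<^sub>R w" "real m * c"] that
        convex_on_add[OF that convex_on_affine[of "real m *\<^sub>R w" "real m * c"]]
      by (auto simp: l_def algebra_simps)
    let ?p = "\<lambda>x. f x + real m * max 0 (l x)" and ?q = "\<lambda>x. (f x + max 0 (l x)) + real m * l x"
    have mx: "max (?p x) (?q x) = f x + real (Suc m) * max 0 (l x)" for x
    proof (cases "l x \<ge> 0")
      case False
      then have "real m * l x \<le> 0" by (simp add: mult_nonneg_nonpos)
      then show ?thesis using False by (simp add: max_absorb1)
    qed (simp add: max_absorb2 algebra_simps)
    have mn: "min (?p x) (?q x) = f x + real m * l x" for x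
    proof (cases "l x \<ge> 0")
      case False
      then have "real m * l x \<le> 0" by (simp add: mult_nonneg_nonpos)
      then show ?thesis using False by (simp add: min_absorb2 max_absorb1)
    qed (simp add: min_absorb1)
    have "\<mu> (\<lambda>x. max (?p x) (?q x)) + \<mu> (\<lambda>x. min (?p x) (?q x)) = \<mu> ?p + \<mu> ?q"
    proof (rule val)
      show "convex_on UNIV ?p" by (rule fh) simp
      show "convex_on UNIV ?q" using aff(1)[of "\<lambda>x. f x + max 0 (l x)"] fh[of 1] by simp
      show "convex_on UNIV (\<lambda>x. min (?p x) (?q x))" unfolding mn by (rule aff f)+
    qed
    then show ?thesis
      unfolding mx mn using aff(2)[of f] aff(2)[of "\<lambda>x. f x + max 0 (l x)"] fh[of 1] f
      by (simp add: D_def)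
  qed
  have lin: "\<mu> (\<lambda>x. f x + real m * max 0 (l x)) = \<mu> f + real m * D" for m
    by (induction m) (simp, simp only: step, simp add: algebra_simps)
  \<comment> \<open>Dividing by \<open>m + 1\<close> uses homogeneity of degree one. It makes
    \<open>f\<close> fade out as \<open>m\<close> grows, which identifies \<open>D\<close> as the
    value at the hinge alone.\<close>
  have eq: "\<mu> (\<lambda>x. inverse (real (Suc m)) * f x + max 0 (l x)) = inverse (real (Suc m)) * \<mu> f + D" for m
  proof -
    have "\<mu> (\<lambda>x. inverse (real (Suc m)) * (f x + real (Suc m) * max 0 (l x)))
        = inverse (real (Suc m)) * \<mu> (\<lambda>x. f x + real (Suc m) * max 0 (l x))"
      by (rule homog) (auto intro: fh)
    also have "\<dots> = inverse (real (Suc m)) * \<mu> f + D"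
      unfolding lin by (simp add: field_simps)
    finally show ?thesis by (simp add: field_simps)
  qed
  have "(\<lambda>m. \<mu> (\<lambda>x. inverse (real (Suc m)) * f x + max 0 (l x))) \<longlonglongrightarrow> \<mu> (\<lambda>x. max 0 (l x))"
  proof (rule conts)
    show "convex_on UNIV (\<lambda>x. inverse (real (Suc m)) * f x + max 0 (l x))" for m
      using f h by (intro convex_on_add convex_on_cmul) auto
    show "(\<lambda>m. inverse (real (Suc m)) * f x + max 0 (l x)) \<longlonglongrightarrow> max 0 (l x)" for x
      using tendsto_add[OF tendsto_mult[OF LIMSEQ_inverse_real_of_nat tendsto_const[of "f x"]] tendsto_const[of "max 0 (l x)"]]
      by simp
  qed (rule h)
  moreover have "(\<lambda>m. inverse (real (Suc m)) * \<mu> f + D) \<longlonglongrightarrow> 0 * \<mu> f + D"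
    by (intro tendsto_intros LIMSEQ_inverse_real_of_nat)
  ultimately have "\<mu> (\<lambda>x. max 0 (l x)) = D"
    unfolding eq by (simp add: LIMSEQ_unique)
  then show ?thesis by (simp add: D_def l_def)
qed

section \<open>The cone of additive functions\<close>

definition additive :: "('a \<Rightarrow> real) \<Rightarrow> bool" where
  "additive g \<longleftrightarrow> convex_on UNIV g \<and> (\<forall>f. convex_on UNIV f \<longrightarrow> \<mu> (\<lambda>x. f x + g x) = \<mu> f + \<mu> g)"

lemma additive_convex: "additive g \<Longrightarrow> convex_on UNIV g"
  by (simp add: additive_def)

lemma additiveD: "additive g \<Longrightarrow> convex_on UNIV f \<Longrightarrow> \<mu> (\<lambda>x. f x + g x) = \<mu> f + \<mu> g"
  by (simp add: additive_def)

lemma additive_hinge: "additive (\<lambda>x. max 0 (w \<bullet> x + c))"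
  unfolding additive_def using add_hinge
  by (auto intro!: convex_on_max_UNIV convex_on_affine simp: convex_on_const)

lemma additive_affine: "additive (\<lambda>x. w \<bullet> x + c)"
  unfolding additive_def using add_affine affine by (auto intro!: convex_on_affine)

lemma additive_add:
  assumes "additive g" "additive h" shows "additive (\<lambda>x. g x + h x)"
  unfolding additive_def
proof (intro conjI allI impI)
  show "convex_on UNIV (\<lambda>x. g x + h x)" using assms by (auto simp: additive_def)
  fix f :: "'a \<Rightarrow> real" assume f: "convex_on UNIV f"
  have "\<mu> (\<lambda>x. f x + g x + h x) = \<mu> (\<lambda>x. f x + g x) + \<mu> h"
    by (rule additiveD) (use assms f in \<open>auto simp: additive_def\<close>)
  moreover have "\<mu> (\<lambda>x. g x + h x) = \<mu> g + \<mu> h"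
    by (rule additiveD) (use assms f in \<open>auto simp: additive_def\<close>)
  ultimately show "\<mu> (\<lambda>x. f x + (g x + h x)) = \<mu> f + \<mu> (\<lambda>x. g x + h x)"
    using additiveD[OF assms(1) f] by (simp add: add.assoc)
qed

lemma additive_cmul:
  assumes "additive g" "c \<ge> 0" shows "additive (\<lambda>x. c * g x)"
proof (cases "c = 0")
  case True
  then show ?thesis using additive_affine[of 0 0] by simp
next
  case False
  with assms have c: "c > 0" by simp
  show ?thesis
    unfolding additive_def
  proof (intro conjI allI impI)
    show "convex_on UNIV (\<lambda>x. c * g x)" using assms by (auto simp: additive_def)
    fix f :: "'a \<Rightarrow> real" assume f: "convex_on UNIV f"
    have f': "convex_on UNIV (\<lambda>x. f x / c)" using f c by (intro convex_on_cdiv) auto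
    have g: "convex_on UNIV g" using assms by (simp add: additive_def)
    have "\<mu> (\<lambda>x. c * (f x / c + g x)) = c * \<mu> (\<lambda>x. f x / c + g x)"
      by (rule homog) (use f' g c in auto)
    also have "\<dots> = c * \<mu> (\<lambda>x. f x / c) + c * \<mu> g"
      using additiveD[OF assms(1) f'] by (simp add: algebra_simps)
    also have "\<dots> = \<mu> f + \<mu> (\<lambda>x. c * g x)"
      using homog[OF f' c] homog[OF g c] c by simp
    finally show "\<mu> (\<lambda>x. f x + c * g x) = \<mu> f + \<mu> (\<lambda>x. c * g x)"
      using c by (simp add: algebra_simps)
  qed
qed

lemma additive_sum:
  assumes "finite S" "\<And>v. v \<in> S \<Longrightarrow> additive (g v)" "\<And>v. v \<in> S \<Longrightarrow> c v \<ge> 0"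
  shows "additive (\<lambda>x. \<Sum>v\<in>S. c v * g v x) \<and> \<mu> (\<lambda>x. \<Sum>v\<in>S. c v * g v x) = (\<Sum>v\<in>S. c v * \<mu> (g v))"
  using assms
proof (induction S rule: finite_induct)
  case empty
  then show ?case using additive_affine[of 0 0] zero by simp
next
  case (insert a S)
  have IH: "additive (\<lambda>x. \<Sum>v\<in>S. c v * g v x)"
     "\<mu> (\<lambda>x. \<Sum>v\<in>S. c v * g v x) = (\<Sum>v\<in>S. c v * \<mu> (g v))"
    using insert by auto
  have a: "additive (g a)" "c a \<ge> 0" using insert by auto
  have ca: "additive (\<lambda>x. c a * g a x)" using additive_cmul a by simp
  have m: "\<mu> (\<lambda>x. c a * g a x) = c a * \<mu> (g a)"
    using homog[of "g a" "c a"] a zero additive_convex by (cases "c a = 0") auto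
  show ?case
    using insert.hyps IH additive_add[OF ca IH(1)] additiveD[OF IH(1) additive_convex[OF ca]] m
    by simp
qed

text \<open>Write \<open>f + g\<close> as \<open>(f + (g - h)) + h\<close> and cancel the value at
  \<open>h\<close>. Convexity of the difference has to be supplied, as it does not follow from that
  of \<open>g\<close> and \<open>h\<close>.\<close>

lemma additive_diff:
  assumes "additive g" "additive h" "convex_on UNIV (\<lambda>x. g x - h x)"
  shows "additive (\<lambda>x. g x - h x)"
  unfolding additive_def
proof (intro conjI allI impI)
  show "convex_on UNIV (\<lambda>x. g x - h x)" by (rule assms)
  fix f :: "'a \<Rightarrow> real" assume f: "convex_on UNIV f"
  have "\<mu> (\<lambda>x. (f x + (g x - h x)) + h x) = \<mu> (\<lambda>x. f x + (g x - h x)) + \<mu> h"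
    by (rule additiveD) (use assms f in auto)
  moreover have "\<mu> (\<lambda>x. (g x - h x) + h x) = \<mu> (\<lambda>x. g x - h x) + \<mu> h"
    by (rule additiveD) (use assms f in auto)
  moreover have "\<mu> (\<lambda>x. f x + g x) = \<mu> f + \<mu> g"
    by (rule additiveD) (use assms f in auto)
  ultimately show "\<mu> (\<lambda>x. f x + (g x - h x)) = \<mu> f + \<mu> (\<lambda>x. g x - h x)"
    by simp
qed

lemma additive_limit:
  assumes G: "\<And>j. additive (G j)" and lim: "\<And>x. (\<lambda>j. G j x) \<longlonglongrightarrow> g x"
  shows "additive g"
  unfolding additive_def
proof (intro conjI allI impI)
  have Gc: "convex_on UNIV (G j)" for j using G by (rule additive_convex)
  show g: "convex_on UNIV g" using convex_on_limit Gc lim by blast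
  fix f :: "'a \<Rightarrow> real" assume f: "convex_on UNIV f"
  have "(\<lambda>j. \<mu> (\<lambda>x. f x + G j x)) \<longlonglongrightarrow> \<mu> (\<lambda>x. f x + g x)"
    by (rule conts) (auto intro!: tendsto_intros lim f g Gc)
  moreover have "(\<lambda>j. \<mu> f + \<mu> (G j)) \<longlonglongrightarrow> \<mu> f + \<mu> g"
    by (intro tendsto_intros conts lim g Gc)
  ultimately show "\<mu> (\<lambda>x. f x + g x) = \<mu> f + \<mu> g"
    using additiveD[OF G f] by (simp add: LIMSEQ_unique)
qed

text \<open>The parameter is replaced by simple functions \<open>s i\<close> converging to it; for these the
  integral is a finite conic combination.\<close>

lemma additive_integral:
  fixes g :: "'b::euclidean_space \<Rightarrow> 'a \<Rightarrow> real"
  assumes add: "\<And>y. additive (g y)" and cont: "\<And>x. continuous_on UNIV (\<lambda>y. g y x)"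
  shows "additive (\<lambda>x. \<integral>y\<in>cball 0 r. g y x \<partial>lborel)"
    and "\<mu> (\<lambda>x. \<integral>y\<in>cball 0 r. g y x \<partial>lborel) = (\<integral>y\<in>cball 0 r. \<mu> (g y) \<partial>lborel)"
proof -
  let ?Q = "cball (0::'b) r"
  define M where "M = restrict_space lborel ?Q"
  have space_M: "space M = ?Q" by (simp add: M_def space_restrict_space)
  interpret finite_measure M
    by (rule finite_measureI)
      (use emeasure_lborel_cball_finite[of "0::'b" r] in
        \<open>auto simp: M_def space_restrict_space emeasure_restrict_space\<close>)
  have set_int: "(\<integral>y\<in>?Q. h y \<partial>lborel) = (\<integral>y. h y \<partial>M)" for h :: "'b \<Rightarrow> real"
    unfolding M_def set_lebesgue_integral_def
    by (subst integral_restrict_space) auto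
  have "(\<lambda>y. y) \<in> borel_measurable M" by (simp add: M_def measurable_restrict_space1)
  from borel_measurable_implies_sequence_metric[OF this, of 0] obtain s
    where s: "\<And>i. simple_function M (s i)" "\<And>y. y \<in> ?Q \<Longrightarrow> (\<lambda>i. s i y) \<longlonglongrightarrow> y"
      "\<And>i y. y \<in> ?Q \<Longrightarrow> dist (s i y) 0 \<le> 2 * dist y 0"
    unfolding space_M by blast
  have gc: "convex_on UNIV (g y)" for y using add by (rule additive_convex)
  \<comment> \<open>The approximating simple functions may leave the ball, but they stay in the
    doubled one, where continuous integrands are bounded.\<close>
  have sQ: "s i y \<in> cball 0 (2 * r)" if "y \<in> ?Q" for i y
    using s(3)[OF that, of i] that by (simp add: dist_commute)
  have conv: "(\<lambda>i. \<integral>y. h (s i y) \<partial>M) \<longlonglongrightarrow> (\<integral>y. h y \<partial>M)" and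
    simp_int: "(\<integral>y. h (s i y) \<partial>M) = (\<Sum>v\<in>s i ` ?Q. measure M {y\<in>?Q. s i y = v} * h v)"
    if h: "continuous_on UNIV h" for h :: "'b \<Rightarrow> real" and i
  proof -
    have "bounded (h ` cball 0 (2 * r))"
      by (intro compact_imp_bounded compact_continuous_image continuous_on_subset[OF h]) auto
    then obtain B where "\<forall>z\<in>h ` cball 0 (2 * r). norm z \<le> B"
      unfolding bounded_iff by (rule exE)
    then have B: "norm (h y) \<le> B" if "y \<in> cball 0 (2 * r)" for y using that by blast
    have [measurable]: "s i \<in> borel_measurable M" for i by (rule borel_measurable_simple_function[OF s(1)])
    have [measurable]: "h \<in> borel_measurable borel" using h by (rule borel_measurable_continuous_onI)
    show "(\<lambda>i. \<integral>y. h (s i y) \<partial>M) \<longlonglongrightarrow> (\<integral>y. h y \<partial>M)"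
    proof (rule integral_dominated_convergence[where w="\<lambda>_. B"])
      show "h \<in> borel_measurable M" by (simp add: M_def measurable_restrict_space1)
      show "AE y in M. (\<lambda>i. h (s i y)) \<longlonglongrightarrow> h y"
      proof (rule AE_I2)
        fix y assume "y \<in> space M"
        then have "(\<lambda>i. s i y) \<longlonglongrightarrow> y" using s(2) space_M by simp
        then show "(\<lambda>i. h (s i y)) \<longlonglongrightarrow> h y"
          using continuous_on_tendsto_compose[OF h, of "\<lambda>i. s i y" y] by simp
      qed
      show "AE y in M. norm (h (s i y)) \<le> B" for i
        by (rule AE_I2) (use B sQ space_M in auto)
    qed auto
    have fin: "finite (s i ` ?Q)" using s(1)[of i] by (simp add: simple_function_def space_M)
    have meas: "{y\<in>?Q. s i y = v} \<in> sets M" for v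
    proof -
      have "s i -` {v} \<inter> space M \<in> sets M" by (rule simple_functionD(2)[OF s(1)])
      moreover have "s i -` {v} \<inter> space M = {y\<in>?Q. s i y = v}" unfolding space_M by blast
      ultimately show ?thesis by simp
    qed
    have "(\<integral>y. h (s i y) \<partial>M) = (\<integral>y. (\<Sum>v\<in>s i ` ?Q. indicator {y\<in>?Q. s i y = v} y * h v) \<partial>M)"
    proof (rule Bochner_Integration.integral_cong[OF refl])
      fix y assume "y \<in> space M"
      then have y: "y \<in> ?Q" using space_M by simp
      have "(\<Sum>v\<in>s i ` ?Q. indicator {y\<in>?Q. s i y = v} y * h v) = (\<Sum>v\<in>s i ` ?Q. if v = s i y then h v else 0)"
        using y by (intro sum.cong) (auto simp: indicator_def)
      also have "\<dots> = h (s i y)" using fin y by (subst sum.delta) auto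
      finally show "h (s i y) = (\<Sum>v\<in>s i ` ?Q. indicator {y\<in>?Q. s i y = v} y * h v)" by simp
    qed
    also have "\<dots> = (\<Sum>v\<in>s i ` ?Q. (\<integral>y. indicator {y\<in>?Q. s i y = v} y * h v \<partial>M))"
      by (rule Bochner_Integration.integral_sum)
        (use meas in \<open>auto intro!: integrable_mult_left integrable_real_indicator simp: emeasure_eq_measure\<close>)
    also have "\<dots> = (\<Sum>v\<in>s i ` ?Q. measure M {y\<in>?Q. s i y = v} * h v)"
      using meas by (intro sum.cong) (auto simp: Int_absorb2 sets.sets_into_space)
    finally show "(\<integral>y. h (s i y) \<partial>M) = (\<Sum>v\<in>s i ` ?Q. measure M {y\<in>?Q. s i y = v} * h v)" .
  qed
  have fin: "finite (s i ` ?Q)" for i using s(1)[of i] by (simp add: simple_function_def space_M)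
  have contm: "continuous_on UNIV (\<lambda>y. \<mu> (g y))" by (rule continuous_on_param[OF gc cont])
  define G where "G i x = (\<integral>y. g (s i y) x \<partial>M)" for i x
  have Geq: "G i = (\<lambda>x. \<Sum>v\<in>s i ` ?Q. measure M {y\<in>?Q. s i y = v} * g v x)" for i
    unfolding G_def using simp_int[OF cont] by auto
  have Ga: "additive (G i)" and Gm: "\<mu> (G i) = (\<integral>y. \<mu> (g (s i y)) \<partial>M)" for i
    unfolding Geq simp_int[OF contm, of i]
    using additive_sum[OF fin[of i], of g "\<lambda>v. measure M {y\<in>?Q. s i y = v}"] add by auto
  have Glim: "(\<lambda>i. G i x) \<longlonglongrightarrow> (\<integral>y. g y x \<partial>M)" for x
    unfolding G_def by (rule conv[OF cont])
  show "additive (\<lambda>x. \<integral>y\<in>?Q. g y x \<partial>lborel)"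
    unfolding set_int using additive_limit[OF Ga Glim] .
  then have "(\<lambda>i. \<mu> (G i)) \<longlonglongrightarrow> \<mu> (\<lambda>x. \<integral>y. g y x \<partial>M)"
    unfolding set_int by (intro conts additive_convex Ga Glim) auto
  moreover have "(\<lambda>i. \<mu> (G i)) \<longlonglongrightarrow> (\<integral>y. \<mu> (g y) \<partial>M)"
    unfolding Gm by (rule conv[OF contm])
  ultimately show "\<mu> (\<lambda>x. \<integral>y\<in>?Q. g y x \<partial>lborel) = (\<integral>y\<in>?Q. \<mu> (g y) \<partial>lborel)"
    unfolding set_int by (rule LIMSEQ_unique)
qed

text \<open>Taylor's formula with integral remainder at \<open>- M\<close>: for
  \<open>\<bar>s\<bar> \<le> M\<close> the function \<open>\<phi>\<close> is its tangent there plus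
  a mixture of the hinges \<open>max 0 (s - t)\<close> with density \<open>h t \<ge> 0\<close>. So
  the ridge function is a limit of affine functions plus integrals of hinges in
  \<open>x\<close>.\<close>

lemma additive_ridge:
  assumes d: "\<And>s. (\<phi> has_real_derivative \<phi>' s) (at s)" "\<And>s. (\<phi>' has_real_derivative h s) (at s)"
    and h: "\<And>s. h s \<ge> 0" "continuous_on UNIV h"
  shows "additive (\<lambda>x. \<phi> (w \<bullet> x))"
proof (rule additive_limit)
  define G where "G M x = (\<integral>t\<in>cball 0 (real M). h t * max 0 (w \<bullet> x + (- t)) \<partial>lborel)
    + (((\<phi>' (- real M)) *\<^sub>R w) \<bullet> x + (\<phi> (- real M) + \<phi>' (- real M) * real M))" for M :: nat and x
  have cont: "continuous_on UNIV (\<lambda>t. h t * max 0 (w \<bullet> x + (- t)))" for x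
    by (intro continuous_intros h)
  show "additive (G M)" for M
    unfolding G_def[abs_def]
    by (intro additive_add additive_affine additive_integral additive_cmul additive_hinge h cont)
  fix x
  define s where "s = w \<bullet> x"
  have "G M x = \<phi> s" if M: "\<bar>s\<bar> \<le> real M" for M
  proof -
    \<comment> \<open>The antiderivative in \<open>t\<close> is
      \<open>\<phi>' t * (s - t) + \<phi> t\<close>.\<close>
    have "((\<lambda>t. h t * (s - t)) has_integral ((\<phi>' s * (s - s) + \<phi> s) - (\<phi>' (- real M) * (s - (- real M)) + \<phi> (- real M)))) {- real M..s}"
      by (rule fundamental_theorem_of_calculus)
        (use M in \<open>auto intro!: derivative_eq_intros DERIV_subset[OF d(1)] DERIV_subset[OF d(2)]
          simp: has_real_derivative_iff_has_vector_derivative[symmetric] algebra_simps\<close>)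
    then have 1: "((\<lambda>t. h t * max 0 (s - t)) has_integral (\<phi> s - \<phi>' (- real M) * (s + real M) - \<phi> (- real M))) {- real M..s}"
      by (rule has_integral_eq[rotated, OF has_integral_eq_rhs]) auto
    have 2: "((\<lambda>t. h t * max 0 (s - t)) has_integral 0) {s..real M}"
      by (rule has_integral_eq[rotated, OF has_integral_0]) auto
    have "((\<lambda>t. h t * max 0 (s - t)) has_integral (\<phi> s - \<phi>' (- real M) * (s + real M) - \<phi> (- real M) + 0)) {- real M..real M}"
      by (rule has_integral_combine[OF _ _ 1 2]) (use M in auto)
    then have "integral {- real M..real M} (\<lambda>t. h t * max 0 (s + (- t))) = \<phi> s - \<phi>' (- real M) * (s + real M) - \<phi> (- real M)"
      by (simp add: integral_unique)
    moreover have "(\<integral>t\<in>cball 0 (real M). h t * max 0 (s + (- t)) \<partial>lborel) = integral {- real M..real M} (\<lambda>t. h t * max 0 (s + (- t)))"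
      unfolding cball_eq_atLeastAtMost diff_0 add_0
      by (intro set_borel_integral_eq_integral(2) borel_integrable_atLeastAtMost' continuous_intros continuous_on_subset[OF h(2)]) auto
    ultimately show ?thesis by (simp add: G_def s_def algebra_simps)
  qed
  moreover obtain N where "\<bar>s\<bar> \<le> real N" using real_arch_simple by blast
  then have "\<forall>\<^sub>F M in sequentially. \<bar>s\<bar> \<le> real M"
    unfolding eventually_sequentially by (intro exI[of _ N]) (auto intro: order_trans)
  ultimately have "\<forall>\<^sub>F M in sequentially. G M x = \<phi> s" by (auto elim: eventually_mono)
  then show "(\<lambda>M. G M x) \<longlonglongrightarrow> \<phi> (w \<bullet> x)" unfolding s_def by (rule tendsto_eventually)
qed

section \<open>Quadratic functions, products of cosines and Gaussians\<close>

lemma additive_square: "additive (\<lambda>x. (w \<bullet> (x - z))\<^sup>2)"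
proof -
  have "additive (\<lambda>x. (\<lambda>s. (s - w \<bullet> z)\<^sup>2) (w \<bullet> x))"
    by (rule additive_ridge[where \<phi>' = "\<lambda>s. 2 * (s - w \<bullet> z)" and h = "\<lambda>s. 2"])
      (auto intro!: derivative_eq_intros)
  then show ?thesis by (simp add: inner_diff_right)
qed

text \<open>The second derivative of \<open>cos s + s^2 / 2\<close> is
  \<open>1 - cos s \<ge> 0\<close>, so the quadratic term is what makes the cosine admissible as a
  ridge function.\<close>

lemma additive_cos: "additive (\<lambda>x. cos (w \<bullet> (x - z)) + (w \<bullet> (x - z))\<^sup>2 / 2)"
proof -
  have "additive (\<lambda>x. (\<lambda>s. cos (s - w \<bullet> z) + (s - w \<bullet> z)\<^sup>2 / 2) (w \<bullet> x))"
    by (rule additive_ridge[where \<phi>' = "\<lambda>s. - sin (s - w \<bullet> z) + (s - w \<bullet> z)" and h = "\<lambda>s. 1 - cos (s - w \<bullet> z)"])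
      (auto intro!: derivative_eq_intros continuous_intros)
  then show ?thesis by (simp add: inner_diff_right)
qed

lemma additive_norm_sq: "additive (\<lambda>x. (norm (x - z))\<^sup>2)"
proof -
  have "additive (\<lambda>x. \<Sum>b\<in>Basis. 1 * (b \<bullet> (x - z))\<^sup>2)"
    using additive_sum[of Basis "\<lambda>b x. (b \<bullet> (x - z))\<^sup>2" "\<lambda>_. 1"] additive_square by auto
  moreover have "(\<Sum>b\<in>Basis. 1 * (b \<bullet> (x - z))\<^sup>2) = (norm (x - z))\<^sup>2" for x
    unfolding power2_norm_eq_inner euclidean_inner[of "x - z" "x - z"]
    by (simp add: power2_eq_square inner_commute)
  ultimately show ?thesis by simp
qed

text \<open>Products of cosines of linear forms stay within reach of ridge functions because
  \<open>2 cos a cos b = cos (a + b) + cos (a - b)\<close>, while the quadratic corrections add up by the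
  parallelogram law.\<close>

lemma additive_cos_product_step:
  assumes "\<And>v. additive (\<lambda>x. cos (v \<bullet> (x - z)) * p x + (v \<bullet> (x - z))\<^sup>2 / 2 + q x)"
  shows "additive (\<lambda>x. cos (v \<bullet> (x - z)) * (cos (w \<bullet> (x - z)) * p x) + (v \<bullet> (x - z))\<^sup>2 / 2
    + ((w \<bullet> (x - z))\<^sup>2 / 2 + q x))"
proof -
  let ?E = "\<lambda>v x. cos (v \<bullet> (x - z)) * p x + (v \<bullet> (x - z))\<^sup>2 / 2 + q x"
  have "additive (\<lambda>x. (1 / 2) * (?E (v + w) x + ?E (v - w) x))"
    by (intro additive_cmul additive_add assms) simp
  moreover have "(1 / 2) * (?E (v + w) x + ?E (v - w) x)
      = cos (v \<bullet> (x - z)) * (cos (w \<bullet> (x - z)) * p x) + (v \<bullet> (x - z))\<^sup>2 / 2 + ((w \<bullet> (x - z))\<^sup>2 / 2 + q x)" for x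
    unfolding inner_add_left inner_diff_left[of v w] cos_add cos_diff power2_eq_square
    by (simp add: field_simps)
  ultimately show ?thesis by (simp only:)
qed

text \<open>The product step consumes the hypothesis at \<open>v + w\<close> and
  \<open>v - w\<close>; the spare cosine with arbitrary \<open>v\<close> keeps the induction
  going.\<close>

lemma additive_cos_power_step:
  assumes "\<And>v. additive (\<lambda>x. cos (v \<bullet> (x - z)) * p x + (v \<bullet> (x - z))\<^sup>2 / 2 + q x)"
  shows "additive (\<lambda>x. cos (v \<bullet> (x - z)) * (cos (w \<bullet> (x - z)) ^ N * p x) + (v \<bullet> (x - z))\<^sup>2 / 2
    + (real N * ((w \<bullet> (x - z))\<^sup>2 / 2) + q x))"
proof (induction N arbitrary: v)
  case 0
  then show ?case using assms by simp
next
  case (Suc N)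
  from additive_cos_product_step[OF Suc.IH, of v w] show ?case
    by (simp add: algebra_simps add_divide_distrib)
qed

lemma additive_cos_prod:
  assumes "finite S"
  shows "additive (\<lambda>x. cos (v \<bullet> (x - z)) * (\<Prod>w\<in>S. cos (w \<bullet> (x - z)) ^ N) + (v \<bullet> (x - z))\<^sup>2 / 2
    + (\<Sum>w\<in>S. real N * ((w \<bullet> (x - z))\<^sup>2 / 2)))"
  using assms
proof (induction S arbitrary: v rule: finite_induct)
  case empty
  then show ?case using additive_cos by simp
next
  case (insert a S)
  from additive_cos_power_step[OF insert.IH, of v a N] show ?case
    using insert.hyps by simp
qed

text \<open>A cosine at scale \<open>1 / sqrt (N + 1)\<close>, raised to the power
  \<open>N + 1\<close>, tends to a one-dimensional Gaussian; the product over an orthonormal basis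
  gives the radial one. The quadratic corrections add up to the same function for every
  \<open>N\<close> and survive the limit unchanged.\<close>

lemma additive_gaussian:
  assumes e: "e > 0"
  shows "additive (\<lambda>x. exp (- (norm ((1 / e) *\<^sub>R (x - z)))\<^sup>2 / 2) + (norm ((1 / e) *\<^sub>R (x - z)))\<^sup>2 / 2)"
proof (rule additive_limit)
  \<comment> \<open>The scale makes \<open>(N + 1) * (c N)\<^sup>2 = (1 / e)\<^sup>2\<close>, so
    that the corrections do not depend on \<open>N\<close>.\<close>
  define c where "c N = 1 / (e * sqrt (real (Suc N)))" for N
  define G where "G N x = (\<Prod>b\<in>Basis. cos ((b \<bullet> ((1 / e) *\<^sub>R (x - z))) / sqrt (real (Suc N))) ^ Suc N)
      + (norm ((1 / e) *\<^sub>R (x - z)))\<^sup>2 / 2" for N and x :: 'a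
  have c: "c N > 0" for N using e by (simp add: c_def)
  have inj: "inj_on (\<lambda>b. c N *\<^sub>R b) A" for N and A :: "'a set" using c[of N] by (auto simp: inj_on_def)
  show "additive (G N)" for N
  proof -
    \<comment> \<open>Taking the spare direction to be 0 turns its cosine into 1 and removes its
      square.\<close>
    have A: "additive (\<lambda>x. cos (0 \<bullet> (x - z)) * (\<Prod>w\<in>(\<lambda>b. c N *\<^sub>R b) ` Basis. cos (w \<bullet> (x - z)) ^ Suc N) + (0 \<bullet> (x - z))\<^sup>2 / 2
      + (\<Sum>w\<in>(\<lambda>b. c N *\<^sub>R b) ` Basis. real (Suc N) * ((w \<bullet> (x - z))\<^sup>2 / 2)))"
      by (rule additive_cos_prod) simp
    have prod: "(\<Prod>w\<in>(\<lambda>b. c N *\<^sub>R b) ` Basis. cos (w \<bullet> (x - z)) ^ Suc N)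
        = (\<Prod>b\<in>Basis. cos ((b \<bullet> ((1 / e) *\<^sub>R (x - z))) / sqrt (real (Suc N))) ^ Suc N)" for x
    proof -
      have "(c N *\<^sub>R b) \<bullet> (x - z) = (b \<bullet> ((1 / e) *\<^sub>R (x - z))) / sqrt (real (Suc N))" for b
        by (simp add: c_def inner_diff_right diff_divide_distrib)
      then show ?thesis by (subst prod.reindex[OF inj]) (simp only: o_def)
    qed
    have sum: "(\<Sum>w\<in>(\<lambda>b. c N *\<^sub>R b) ` Basis. real (Suc N) * ((w \<bullet> (x - z))\<^sup>2 / 2))
        = (norm ((1 / e) *\<^sub>R (x - z)))\<^sup>2 / 2" for x
    proof -
      have cN: "real (Suc N) * (c N)\<^sup>2 = (1 / e)\<^sup>2"
        using e by (simp add: c_def power_divide power_mult_distrib del: of_nat_Suc)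
      have "(\<Sum>w\<in>(\<lambda>b. c N *\<^sub>R b) ` Basis. real (Suc N) * ((w \<bullet> (x - z))\<^sup>2 / 2))
          = (\<Sum>b\<in>Basis. (real (Suc N) * (c N)\<^sup>2) * ((b \<bullet> (x - z))\<^sup>2 / 2))"
        by (subst sum.reindex[OF inj]) (simp add: power_mult_distrib mult.assoc del: of_nat_Suc)
      also have "\<dots> = (1 / e)\<^sup>2 * ((norm (x - z))\<^sup>2 / 2)"
        unfolding cN power2_norm_eq_inner euclidean_inner[of "x - z" "x - z"]
        by (simp add: sum_distrib_left sum_divide_distrib power2_eq_square inner_commute)
      also have "\<dots> = (norm ((1 / e) *\<^sub>R (x - z)))\<^sup>2 / 2"
        using e by (simp add: power_divide)
      finally show ?thesis .
    qed
    show ?thesis using A unfolding G_def[abs_def] prod sum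
      by (simp only: inner_zero_left cos_zero mult_1_left zero_power2 div_0 add_0_right)
  qed
  fix x
  have "(\<lambda>N. cos (s / sqrt (real (Suc N))) ^ Suc N) \<longlonglongrightarrow> exp (- s\<^sup>2 / 2)" for s
    using LIMSEQ_Suc[OF cos_power_tendsto[of s]] by simp
  then have "(\<lambda>N. G N x) \<longlonglongrightarrow> (\<Prod>b\<in>Basis. exp (- (b \<bullet> ((1 / e) *\<^sub>R (x - z)))\<^sup>2 / 2)) + (norm ((1 / e) *\<^sub>R (x - z)))\<^sup>2 / 2"
    unfolding G_def by (intro tendsto_intros)
  moreover have "(\<Prod>b\<in>Basis. exp (- (b \<bullet> y)\<^sup>2 / 2)) = exp (- (norm y)\<^sup>2 / 2)" for y :: 'a
    unfolding power2_norm_eq_inner euclidean_inner[of y y]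
    by (simp add: exp_sum[symmetric] sum_divide_distrib sum_negf power2_eq_square inner_commute)
  ultimately show "(\<lambda>N. G N x) \<longlonglongrightarrow> exp (- (norm ((1 / e) *\<^sub>R (x - z)))\<^sup>2 / 2) + (norm ((1 / e) *\<^sub>R (x - z)))\<^sup>2 / 2"
    by (simp only:)
qed

text \<open>A Gaussian mollification of \<open>\<psi>\<close> is a superposition of Gaussians
  centred at \<open>z\<close> with weights \<open>\<psi> z \<ge> 0\<close>. Adding the quadratic
  \<open>q z\<close> to each Gaussian makes the superposition \<open>P\<close> additive, and the
  accumulated quadratics \<open>Q\<close> are additive too. The rescaled difference plus the squared
  norm is convex because mollifying preserves the convexity in \<open>conv\<close>, so
  \<open>additive_diff\<close> applies; shrinking the width recovers \<open>\<psi>\<close>.\<close>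

lemma additive_compactly_supported_plus_norm_sq:
  assumes \<psi>: "continuous_on UNIV \<psi>" "\<And>x. \<psi> x \<ge> 0" "\<And>x. norm x > r \<Longrightarrow> \<psi> x = 0"
    and conv: "convex_on UNIV (\<lambda>x. \<psi> x + (norm x)\<^sup>2)"
  shows "additive (\<lambda>x. \<psi> x + (norm x)\<^sup>2)"
proof (rule additive_limit)
  define G where "G y = exp (- (norm y)\<^sup>2 / 2)" for y :: 'a
  define c where "c = (\<integral>y. G y \<partial>lborel)"
  have Gi: "integrable lborel G" and c: "c > 0"
    using integrable_gaussian integral_gaussian_pos unfolding G_def[abs_def] c_def by auto
  have G0: "G y \<ge> 0" for y by (simp add: G_def)
  have [measurable]: "\<psi> \<in> borel_measurable borel" using \<psi>(1) by (rule borel_measurable_continuous_onI)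
  have [measurable]: "G \<in> borel_measurable borel" unfolding G_def[abs_def] by simp
  have "bounded (\<psi> ` cball 0 r)"
    by (intro compact_imp_bounded compact_continuous_image continuous_on_subset[OF \<psi>(1)]) auto
  then obtain b where b: "\<forall>z\<in>\<psi> ` cball 0 r. norm z \<le> b" unfolding bounded_iff by (rule exE)
  have B: "\<bar>\<psi> x\<bar> \<le> \<bar>b\<bar>" for x
    using b \<psi>(3)[of x] by (cases "norm x \<le> r") force+
  define e where "e m = 1 / real (Suc m)" for m
  have e: "e m > 0" for m by (simp add: e_def)
  define S where "S m x = (\<integral>y. \<psi> (x + e m *\<^sub>R y) * G y \<partial>lborel) / c" for m x
  have int: "integrable lborel (\<lambda>y. \<psi> (x + e m *\<^sub>R y) * G y)" for m x
    by (rule Bochner_Integration.integrable_bound[of _ "\<lambda>y. \<bar>b\<bar> * G y"])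
      (use Gi B G0 in \<open>auto simp: abs_mult intro!: mult_right_mono\<close>)
  show "(\<lambda>m. S m x + (norm x)\<^sup>2) \<longlonglongrightarrow> \<psi> x + (norm x)\<^sup>2" for x
  proof -
    have "(\<lambda>m. \<integral>y. \<psi> (x + e m *\<^sub>R y) * G y \<partial>lborel) \<longlonglongrightarrow> (\<integral>y. \<psi> x * G y \<partial>lborel)"
    proof (rule integral_dominated_convergence[where w="\<lambda>y. \<bar>b\<bar> * G y"])
      show "AE y in lborel. (\<lambda>m. \<psi> (x + e m *\<^sub>R y) * G y) \<longlonglongrightarrow> \<psi> x * G y"
      proof (rule AE_I2)
        fix y
        have "(\<lambda>m. x + e m *\<^sub>R y) \<longlonglongrightarrow> x + 0 *\<^sub>R y"
          unfolding e_def using LIMSEQ_inverse_real_of_nat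
          by (intro tendsto_intros) (simp add: inverse_eq_divide)
        then have "(\<lambda>m. x + e m *\<^sub>R y) \<longlonglongrightarrow> x" by simp
        from continuous_on_tendsto_compose[OF \<psi>(1) this]
        show "(\<lambda>m. \<psi> (x + e m *\<^sub>R y) * G y) \<longlonglongrightarrow> \<psi> x * G y"
          by (intro tendsto_intros) simp
      qed
      show "AE y in lborel. norm (\<psi> (x + e m *\<^sub>R y) * G y) \<le> \<bar>b\<bar> * G y" for m
        using B G0 by (auto simp: abs_mult intro!: mult_right_mono)
    qed (use Gi in auto)
    then have "(\<lambda>m. S m x) \<longlonglongrightarrow> (\<psi> x * c) / c"
      unfolding S_def c_def[symmetric] using c by (intro tendsto_divide) (auto simp: c_def)
    then show ?thesis using c by (intro tendsto_intros) simp
  qed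
  fix m
  have conv_S: "convex_on UNIV (\<lambda>x. S m x + (norm x)\<^sup>2)"
  proof -
    have "convex_on UNIV (\<lambda>x. (\<integral>y. \<psi> (x + e m *\<^sub>R y) * G y + (norm x)\<^sup>2 * G y \<partial>lborel))"
    proof (rule convex_on_integral)
      fix y
      \<comment> \<open>Translating the squared norm changes it by an affine function, so convexity
        survives with the norm taken at \<open>x\<close> instead.\<close>
      have "convex_on UNIV (\<lambda>x. \<psi> (x + e m *\<^sub>R y) + (norm (x + e m *\<^sub>R y))\<^sup>2)"
        by (rule convex_on_compose_affine[OF conv]) (simp add: algebra_simps)
      then have "convex_on UNIV (\<lambda>x. (\<psi> (x + e m *\<^sub>R y) + (norm (x + e m *\<^sub>R y))\<^sup>2)
          + ((- 2 * e m) *\<^sub>R y \<bullet> x + - (e m)\<^sup>2 * (norm y)\<^sup>2))"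
        by (rule convex_on_add[OF _ convex_on_affine])
      moreover have "(\<psi> (x + e m *\<^sub>R y) + (norm (x + e m *\<^sub>R y))\<^sup>2)
          + ((- 2 * e m) *\<^sub>R y \<bullet> x + - (e m)\<^sup>2 * (norm y)\<^sup>2) = \<psi> (x + e m *\<^sub>R y) + (norm x)\<^sup>2" for x
        unfolding power2_norm_eq_inner by (simp add: inner_simps inner_commute power2_eq_square algebra_simps)
      ultimately have "convex_on UNIV (\<lambda>x. \<psi> (x + e m *\<^sub>R y) + (norm x)\<^sup>2)" by (simp only:)
      from convex_on_cmul[OF G0 this, of y]
      show "convex_on UNIV (\<lambda>x. \<psi> (x + e m *\<^sub>R y) * G y + (norm x)\<^sup>2 * G y)"
        by (simp add: algebra_simps)
    qed (use int Gi in auto)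
    from convex_on_cdiv[OF less_imp_le[OF c] this]
    show ?thesis using int Gi c by (simp add: S_def add_divide_distrib flip: c_def)
  qed
  \<comment> \<open>The factor collects the Jacobian of \<open>z = x + e m *\<^sub>R y\<close> and
    the mass \<open>c\<close> of the Gaussian.\<close>
  define \<kappa> where "\<kappa> = 1 / (e m ^ DIM('a) * c)"
  have \<kappa>: "\<kappa> \<ge> 0" using c e[of m] by (simp add: \<kappa>_def)
  define q where "q z x = (norm ((1 / e m) *\<^sub>R (x - z)))\<^sup>2 / 2" for z x :: 'a
  define P where "P x = (\<integral>z\<in>cball 0 r. \<psi> z * (G ((1 / e m) *\<^sub>R (x - z)) + q z x) \<partial>lborel)" for x
  define Q where "Q x = (\<integral>z\<in>cball 0 r. \<psi> z * q z x \<partial>lborel)" for x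
  have qa: "additive (q z)" for z
  proof -
    have "additive (\<lambda>x. ((1 / e m)\<^sup>2 / 2) * (norm (x - z))\<^sup>2)"
      by (intro additive_cmul additive_norm_sq) simp
    moreover have "((1 / e m)\<^sup>2 / 2) * (norm (x - z))\<^sup>2 = q z x" for x
      using e[of m] by (simp add: q_def power_divide)
    ultimately show ?thesis by (simp only:)
  qed
  have cont: "continuous_on UNIV (\<lambda>z. \<psi> z * (G ((1 / e m) *\<^sub>R (x - z)) + q z x))"
    "continuous_on UNIV (\<lambda>z. \<psi> z * q z x)" for x
    unfolding G_def q_def by (intro continuous_intros \<psi>; simp)+
  have Pa: "additive P"
    unfolding P_def[abs_def]
    by (intro additive_integral(1) additive_cmul \<psi> cont)
      (use additive_gaussian[OF e[of m]] in \<open>simp add: G_def q_def[abs_def]\<close>)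
  have Qa: "additive Q"
    unfolding Q_def[abs_def] by (intro additive_integral(1) additive_cmul \<psi> cont qa)
  have S_eq: "S m x = \<kappa> * P x - \<kappa> * Q x" for x
  proof -
    have "(\<integral>z. \<psi> z * G ((1 / e m) *\<^sub>R (x - z)) \<partial>lborel)
        = e m ^ DIM('a) * (\<integral>y. \<psi> (x + e m *\<^sub>R y) * G ((1 / e m) *\<^sub>R (x - (x + e m *\<^sub>R y))) \<partial>lborel)"
      by (rule integral_lborel_affine) (use e[of m] in auto)
    also have "(\<lambda>y. G ((1 / e m) *\<^sub>R (x - (x + e m *\<^sub>R y)))) = G"
      using e[of m] by (auto simp: G_def)
    then have "e m ^ DIM('a) * (\<integral>y. \<psi> (x + e m *\<^sub>R y) * G ((1 / e m) *\<^sub>R (x - (x + e m *\<^sub>R y))) \<partial>lborel)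
        = e m ^ DIM('a) * c * S m x"
      using c by (simp add: S_def fun_eq_iff)
    finally have 1: "S m x = \<kappa> * (\<integral>z. \<psi> z * G ((1 / e m) *\<^sub>R (x - z)) \<partial>lborel)"
      using c e[of m] by (simp add: \<kappa>_def)
    have "(\<integral>z. \<psi> z * G ((1 / e m) *\<^sub>R (x - z)) \<partial>lborel) = (\<integral>z\<in>cball 0 r. \<psi> z * G ((1 / e m) *\<^sub>R (x - z)) \<partial>lborel)"
      unfolding set_lebesgue_integral_def
      by (rule Bochner_Integration.integral_cong) (auto simp: indicator_def \<psi>(3) not_le)
    also have "\<dots> = (\<integral>z\<in>cball 0 r. \<psi> z * (G ((1 / e m) *\<^sub>R (x - z)) + q z x) - \<psi> z * q z x \<partial>lborel)"
      by (simp add: algebra_simps)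
    also have "\<dots> = P x - Q x"
      unfolding P_def Q_def
      by (rule set_integral_diff)
        (unfold set_integrable_def, intro borel_integrable_compact continuous_on_subset[OF cont(1)] continuous_on_subset[OF cont(2)]; simp)+
    finally show ?thesis unfolding 1 by (simp only: right_diff_distrib)
  qed
  have "additive (\<lambda>x. (\<kappa> * P x + (norm (x - 0))\<^sup>2) - \<kappa> * Q x)"
  proof (rule additive_diff)
    show "additive (\<lambda>x. \<kappa> * P x + (norm (x - 0))\<^sup>2)"
      by (intro additive_add additive_cmul Pa \<kappa> additive_norm_sq)
    show "additive (\<lambda>x. \<kappa> * Q x)" by (intro additive_cmul Qa \<kappa>)
    show "convex_on UNIV (\<lambda>x. (\<kappa> * P x + (norm (x - 0))\<^sup>2) - \<kappa> * Q x)"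
      using conv_S unfolding S_eq by (simp add: algebra_simps)
  qed
  then show "additive (\<lambda>x. S m x + (norm x)\<^sup>2)"
    unfolding S_eq by (simp add: algebra_simps)
qed

text \<open>Truncate \<open>f\<close> from below by the paraboloid
  \<open>(norm x)\<^sup>2 - R\<close>. Since the paraboloid eventually dominates a function of
  linear growth, the excess of the truncation over it is nonnegative with compact support. At a
  fixed \<open>x\<close> the truncation is inactive for large \<open>R\<close>.\<close>

lemma additive_linear_growth:
  assumes f: "convex_on UNIV f" and C: "\<And>x. f x \<le> C * (1 + norm x)"
  shows "additive f"
proof (rule additive_limit)
  define F where "F R x = max (f x) ((norm x)\<^sup>2 - real R)" for R :: nat and x
  have norm_sq: "convex_on UNIV (\<lambda>x::'a. (norm x)\<^sup>2 + - real R)" for R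
    by (intro convex_on_add convex_on_norm_sq) (simp add: convex_on_const)
  show "additive (F R)" for R
  proof -
    define \<psi> where "\<psi> x = max 0 (f x - (norm x)\<^sup>2 + real R)" for x
    have eq: "\<psi> x + (norm x)\<^sup>2 = F R x + real R" for x by (auto simp: \<psi>_def F_def max_def)
    have "additive (\<lambda>x. \<psi> x + (norm x)\<^sup>2)"
    proof (rule additive_compactly_supported_plus_norm_sq)
      show "continuous_on UNIV \<psi>"
        unfolding \<psi>_def[abs_def] by (intro continuous_intros convex_continuous f)
      show "\<psi> x \<ge> 0" for x by (simp add: \<psi>_def)
      have "convex_on UNIV (\<lambda>x. F R x + real R)"
        unfolding F_def using norm_sq[of R] by (intro convex_on_add convex_on_max_UNIV f) (auto simp: convex_on_const)
      then show "convex_on UNIV (\<lambda>x. \<psi> x + (norm x)\<^sup>2)" unfolding eq .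
      \<comment> \<open>Beyond this radius the squared norm is at least
        \<open>(1 + R + 2 * \<bar>C\<bar>) * norm x\<close>, which dominates
        \<open>f x + R\<close>.\<close>
      fix x :: 'a assume x: "norm x > 1 + real R + 2 * \<bar>C\<bar>"
      then have n1: "norm x \<ge> 1" by linarith
      have "f x \<le> C * (1 + norm x)" by (rule C)
      also have "\<dots> \<le> \<bar>C\<bar> * (2 * norm x)" using n1 by (intro mult_mono) auto
      finally have "f x + real R \<le> \<bar>C\<bar> * (2 * norm x) + real R * norm x"
        using mult_left_mono[OF n1, of "real R"] by simp
      also have "\<dots> \<le> (1 + real R + 2 * \<bar>C\<bar>) * norm x" by (simp add: algebra_simps)
      also have "\<dots> \<le> norm x * norm x" using x by (intro mult_right_mono) auto
      finally show "\<psi> x = 0" by (simp add: \<psi>_def power2_eq_square)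
    qed
    from additive_add[OF this additive_affine[of 0 "- real R"]]
    show ?thesis unfolding eq by simp
  qed
  fix x
  obtain N where N: "(norm x)\<^sup>2 - f x \<le> real N" using real_arch_simple by blast
  have "\<forall>\<^sub>F R in sequentially. F R x = f x"
    unfolding eventually_sequentially
  proof (intro exI[of _ N] allI impI)
    fix R assume "N \<le> R"
    then have "real N \<le> real R" by simp
    then show "F R x = f x" unfolding F_def using N by linarith
  qed
  then show "(\<lambda>R. F R x) \<longlonglongrightarrow> f x" by (rule tendsto_eventually)
qed

text \<open>Replace \<open>f\<close> by the supremum \<open>F R\<close> of its tangents at the
  points of a ball. It equals \<open>f\<close> on the ball, and it grows at most linearly because
  the slopes there are bounded.\<close>

lemma additive_convex_on:
  assumes f: "convex_on UNIV f"
  shows "additive f"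
proof -
  have "\<exists>p. \<forall>x. f z + p \<bullet> (x - z) \<le> f x" for z
    using convex_subgradient[OF f, of z] by blast
  then obtain p where p: "\<And>z x. f z + p z \<bullet> (x - z) \<le> f x" by metis
  define T where "T x z = f z + p z \<bullet> (x - z)" for x z
  define F where "F R x = (SUP z\<in>cball 0 (real R). T x z)" for R :: nat and x
  have bdd: "bdd_above (T x ` A)" for x A
    by (rule bdd_aboveI[of _ "f x"]) (use p in \<open>auto simp: T_def\<close>)
  have additive_F: "additive (F R)" for R
  proof -
    have conv: "convex_on UNIV (F R)"
    proof (rule convex_onI)
      fix t :: real and x y :: 'a assume t: "0 < t" "t < 1"
      show "F R ((1 - t) *\<^sub>R x + t *\<^sub>R y) \<le> (1 - t) * F R x + t * F R y"
        unfolding F_def[of R "(1 - t) *\<^sub>R x + t *\<^sub>R y"]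
      proof (rule cSUP_least)
        fix z :: 'a assume z: "z \<in> cball 0 (real R)"
        have "T ((1 - t) *\<^sub>R x + t *\<^sub>R y) z = (1 - t) * T x z + t * T y z"
          by (simp add: T_def inner_simps algebra_simps)
        also have "\<dots> \<le> (1 - t) * F R x + t * F R y"
          unfolding F_def using t z by (intro add_mono mult_left_mono cSUP_upper bdd) auto
        finally show "T ((1 - t) *\<^sub>R x + t *\<^sub>R y) z \<le> (1 - t) * F R x + t * F R y" .
      qed simp
    qed simp
    obtain B where B: "B > 0" "\<And>x. norm x \<le> real R + 1 \<Longrightarrow> \<bar>f x\<bar> \<le> B"
      using convex_bounded_on_cball[OF f] by blast
    \<comment> \<open>A step of length one from \<open>z\<close> in the direction of
      \<open>p z\<close> raises the tangent by \<open>norm (p z)\<close>, while \<open>f\<close> can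
      rise by at most \<open>2 * B\<close>.\<close>
    have pB: "norm (p z) \<le> 2 * B" if z: "norm z \<le> real R" for z
    proof (cases "p z = 0")
      case False
      define u where "u = z + (1 / norm (p z)) *\<^sub>R p z"
      have "norm u \<le> real R + 1"
        using norm_triangle_ineq[of z "(1 / norm (p z)) *\<^sub>R p z"] z False by (simp add: u_def)
      then have "f u \<le> B" "- B \<le> f z" using B(2)[of u] B(2)[of z] z by auto
      moreover have "p z \<bullet> (u - z) = norm (p z)"
        using False by (simp add: u_def dot_square_norm power2_eq_square)
      ultimately show ?thesis using p[of z u] by simp
    qed (use B in simp)
    have "F R x \<le> (B + 2 * B * real R + 2 * B) * (1 + norm x)" for x
      unfolding F_def
    proof (rule cSUP_least)
      fix z :: 'a assume "z \<in> cball 0 (real R)"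
      then have z: "norm z \<le> real R" by simp
      have "p z \<bullet> (x - z) \<le> norm (p z) * norm (x - z)" by (rule norm_cauchy_schwarz)
      also have "\<dots> \<le> (2 * B) * (norm x + real R)"
        using pB[OF z] B z norm_triangle_ineq4[of x z] by (intro mult_mono) auto
      finally have "T x z \<le> B + (2 * B) * (norm x + real R)"
        using B(2)[of z] z by (simp add: T_def)
      also have "\<dots> \<le> (B + 2 * B * real R + 2 * B) * (1 + norm x)"
      proof -
        have "0 \<le> B * norm x" "0 \<le> B * real R * norm x" using B by auto
        then show ?thesis using B by (simp add: algebra_simps)
      qed
      finally show "T x z \<le> (B + 2 * B * real R + 2 * B) * (1 + norm x)" .
    qed simp
    then show ?thesis by (rule additive_linear_growth[OF conv])
  qed
  have "(\<lambda>R. F R x) \<longlonglongrightarrow> f x" for x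
  proof -
    obtain N where N: "norm x \<le> real N" using real_arch_simple by blast
    have "F R x = f x" if "N \<le> R" for R
    proof (rule antisym)
      show "F R x \<le> f x" unfolding F_def by (rule cSUP_least) (use p in \<open>auto simp: T_def\<close>)
      have "real N \<le> real R" using that by simp
      then have "T x x \<le> F R x" unfolding F_def using N by (intro cSUP_upper bdd) auto
      then show "f x \<le> F R x" by (simp add: T_def)
    qed
    then have "\<forall>\<^sub>F R in sequentially. F R x = f x" unfolding eventually_sequentially by blast
    then show ?thesis by (rule tendsto_eventually)
  qed
  with additive_F show ?thesis by (rule additive_limit)
qed

lemma add:
  assumes "convex_on UNIV f" "convex_on UNIV g"
  shows "\<mu> (\<lambda>x. f x + g x) = \<mu> f + \<mu> g"
  using additiveD[OF additive_convex_on[OF assms(2)] assms(1)] .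

section \<open>Compact support and densities\<close>

lemma homog0: "convex_on UNIV f \<Longrightarrow> t \<ge> 0 \<Longrightarrow> \<mu> (\<lambda>x. t * f x) = t * \<mu> f"
  by (cases "t = 0") (simp_all add: homog zero)

text \<open>After subtracting a common tangent, both functions are lowered by \<open>M\<close>, which makes them
  nonpositive where they agree, and raised by a cone \<open>q\<close> vanishing on the half ball, which makes
  them nonnegative where they differ; so truncation at \<open>0\<close> does not change the difference.\<close>

lemma vanishing_representation:
  assumes f: "convex_on UNIV f" and g: "convex_on UNIV g" and R: "R > 0"
    and eq: "\<And>x. norm x \<le> R \<Longrightarrow> f x = g x"
  obtains f' g' where "convex_on UNIV f'" "convex_on UNIV g'"
    "\<And>x. norm x \<le> R / 2 \<Longrightarrow> f' x = 0" "\<And>x. norm x \<le> R / 2 \<Longrightarrow> g' x = 0" "\<mu> f' - \<mu> g' = \<mu> f - \<mu> g"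
proof -
  obtain p where p0: "\<And>x. f 0 + p \<bullet> (x - 0) \<le> f x" using convex_subgradient[OF f, of 0] by blast
  then have p: "f 0 + p \<bullet> x \<le> f x" for x by simp
  \<comment> \<open>The tangent of \<open>f\<close> at 0 is a minorant of \<open>g\<close> too:
    \<open>t\<close> shrinks \<open>x\<close> into the ball where both agree, and convexity of
    \<open>g\<close> along the ray does the rest.\<close>
  have pg: "f 0 + p \<bullet> x \<le> g x" for x
  proof -
    define t where "t = R / (R + norm x)"
    have t: "0 < t" "t \<le> 1" using R by (auto simp: t_def divide_le_eq_1 add_pos_nonneg)
    have "R * norm x \<le> R * (R + norm x)" using R by (intro mult_left_mono) auto
    then have "norm (t *\<^sub>R x) \<le> R"
      using R by (simp add: t_def divide_le_eq add_pos_nonneg)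
    then have "g (t *\<^sub>R x) = f (t *\<^sub>R x)" using eq by simp
    moreover have "g (t *\<^sub>R x) \<le> (1 - t) * g 0 + t * g x" using convex_onD[OF g, of t 0 x] t by simp
    moreover have "g 0 = f 0" using eq[of 0] R by simp
    ultimately have "t * (f 0 + p \<bullet> x) \<le> t * g x" using p[of "t *\<^sub>R x"] by (simp add: algebra_simps)
    then show ?thesis using t by simp
  qed
  define F where "F x = f x + (- p \<bullet> x + (- f 0))" for x
  define G where "G x = g x + (- p \<bullet> x + (- f 0))" for x
  have FG: "convex_on UNIV F" "convex_on UNIV G" "\<mu> F = \<mu> f" "\<mu> G = \<mu> g"
    unfolding F_def[abs_def] G_def[abs_def] using f g by (auto intro!: convex_on_add convex_on_affine simp only: add_affine)
  have F0: "F x \<ge> 0" "G x \<ge> 0" for x using p[of x] pg[of x] by (auto simp: F_def G_def)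
  have FGeq: "F x = G x" if "norm x \<le> R" for x using eq[OF that] by (simp add: F_def G_def)
  obtain M where M: "M > 0" "\<And>x. norm x \<le> R \<Longrightarrow> \<bar>F x\<bar> \<le> M"
    using convex_bounded_on_cball[OF FG(1)] by blast
  \<comment> \<open>The slope lets \<open>q\<close> vanish up to radius \<open>R / 2\<close> and
    reach the height \<open>M\<close> at radius \<open>R\<close>.\<close>
  define q where "q x = (2 * M / R) * max 0 (norm x + (- R / 2))" for x :: 'a
  have q0: "q x = 0" if "norm x \<le> R / 2" for x using that by (simp add: q_def)
  have qM: "q x \<ge> M" if "norm x > R" for x
  proof -
    have "(2 * M / R) * (R / 2) \<le> q x" unfolding q_def using that M R by (intro mult_left_mono) auto
    then show ?thesis using R by simp
  qed
  have cn: "convex_on UNIV (norm :: 'a \<Rightarrow> real)" using convex_on_dist[of UNIV "0::'a"] by simp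
  have qc: "convex_on UNIV q"
    unfolding q_def[abs_def] using M R
    by (intro convex_on_cmul convex_on_max_UNIV convex_on_add cn) (auto simp: convex_on_const)
  define f' where "f' x = max (F x + (- M) + q x) 0" for x
  define g' where "g' x = max (G x + (- M) + q x) 0" for x
  have fg': "convex_on UNIV f'" "convex_on UNIV g'"
    unfolding f'_def[abs_def] g'_def[abs_def]
    by (intro convex_on_max_UNIV convex_on_add FG qc; simp add: convex_on_const)+
  \<comment> \<open>This is \<open>f' - g' = F - G\<close>, written with sums because additivity of
    \<open>\<mu>\<close> is available for convex functions.\<close>
  have "f' x + G x = g' x + F x" for x
  proof (cases "norm x \<le> R")
    case True
    then show ?thesis using FGeq by (simp add: f'_def g'_def)
  next
    case False
    then show ?thesis using qM[of x] F0[of x] by (simp add: f'_def g'_def)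
  qed
  then have "\<mu> f' + \<mu> G = \<mu> g' + \<mu> F"
    using add[OF fg'(1) FG(2)] add[OF fg'(2) FG(1)] by simp
  moreover have "f' x = 0" "g' x = 0" if x: "norm x \<le> R / 2" for x
  proof -
    have xR: "norm x \<le> R" using x R by simp
    show "f' x = 0" "g' x = 0"
      using M(2)[OF xR] FGeq[OF xR] q0[OF x] by (auto simp: f'_def g'_def)
  qed
  ultimately show thesis using that[OF fg'] FG by simp
qed

definition supported_on_cball :: "real \<Rightarrow> bool" where
  "supported_on_cball R \<longleftrightarrow> (\<forall>f g. convex_on UNIV f \<longrightarrow> convex_on UNIV g \<longrightarrow>
    (\<forall>x. norm x \<le> R \<longrightarrow> f x = g x) \<longrightarrow> \<mu> f = \<mu> g)"

text \<open>If every ball failed, homogeneity would give pairs vanishing on larger and larger balls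
  whose values under \<open>\<mu>\<close> differ by exactly 1. Both members converge pointwise to 0,
  which contradicts continuity.\<close>

lemma compact_support: "\<exists>R>0. supported_on_cball R"
proof (rule ccontr)
  assume "\<not> ?thesis"
  then have bad: "\<exists>f g. convex_on UNIV f \<and> convex_on UNIV g \<and> (\<forall>x. norm x \<le> R \<longrightarrow> f x = g x) \<and> \<mu> f \<noteq> \<mu> g"
    if "R > 0" for R using that unfolding supported_on_cball_def by blast
  have "\<exists>F G. convex_on UNIV F \<and> convex_on UNIV G \<and> (\<forall>x. norm x \<le> real k \<longrightarrow> F x = 0 \<and> G x = 0) \<and> \<mu> F - \<mu> G = 1"
    for k :: nat
  proof -
    \<comment> \<open>\<open>vanishing_representation\<close> halves the radius; starting from
      \<open>2 * k + 2\<close> covers radius \<open>k\<close> and is positive even for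
      \<open>k = 0\<close>.\<close>
    have R: "2 * real k + 2 > 0" by simp
    obtain f g where fg: "convex_on UNIV f" "convex_on UNIV g" "\<And>x. norm x \<le> 2 * real k + 2 \<Longrightarrow> f x = g x" "\<mu> f > \<mu> g"
    proof -
      from bad[OF R] obtain f g where *: "convex_on UNIV f" "convex_on UNIV g"
          "\<forall>x. norm x \<le> 2 * real k + 2 \<longrightarrow> f x = g x" "\<mu> f \<noteq> \<mu> g" by blast
      show thesis
      proof (cases "\<mu> f > \<mu> g")
        case True
        then show thesis using that[of f g] * by blast
      next
        case False
        then show thesis using that[of g f] * by force
      qed
    qed
    obtain f' g' where f': "convex_on UNIV f'" "convex_on UNIV g'"
        "\<And>x. norm x \<le> (2 * real k + 2) / 2 \<Longrightarrow> f' x = 0" "\<And>x. norm x \<le> (2 * real k + 2) / 2 \<Longrightarrow> g' x = 0"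
        "\<mu> f' - \<mu> g' = \<mu> f - \<mu> g"
      using vanishing_representation[OF fg(1,2) R fg(3)] by blast
    define t where "t = 1 / (\<mu> f - \<mu> g)"
    have t: "t > 0" using fg(4) by (simp add: t_def)
    have "\<mu> (\<lambda>x. t * f' x) - \<mu> (\<lambda>x. t * g' x) = t * (\<mu> f' - \<mu> g')"
      using homog[OF f'(1) t] homog[OF f'(2) t] by (simp add: algebra_simps)
    also have "\<dots> = 1" using fg(4) f'(5) by (simp add: t_def)
    finally show ?thesis
      using f' t by (intro exI[of _ "\<lambda>x. t * f' x"] exI[of _ "\<lambda>x. t * g' x"]) auto
  qed
  then obtain F G where FG: "\<And>k. convex_on UNIV (F k)" "\<And>k. convex_on UNIV (G k)"
      "\<And>k x. norm x \<le> real k \<Longrightarrow> F k x = 0 \<and> G k x = 0" "\<And>k. \<mu> (F k) - \<mu> (G k) = 1" by metis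
  have lim: "(\<lambda>k. \<mu> (H k)) \<longlonglongrightarrow> 0"
    if "\<And>k. convex_on UNIV (H k)" "\<And>k x. norm x \<le> real k \<Longrightarrow> H k x = 0" for H
  proof -
    have "(\<lambda>k. \<mu> (H k)) \<longlonglongrightarrow> \<mu> (\<lambda>x. 0)"
    proof (rule conts)
      fix x :: 'a
      obtain N where N: "norm x \<le> real N" using real_arch_simple by blast
      have "\<forall>\<^sub>F k in sequentially. H k x = 0"
        unfolding eventually_sequentially
      proof (intro exI[of _ N] allI impI that(2))
        fix k assume "N \<le> k"
        then have "real N \<le> real k" by simp
        then show "norm x \<le> real k" using N by linarith
      qed
      then show "(\<lambda>k. H k x) \<longlonglongrightarrow> 0" by (rule tendsto_eventually)
    qed (auto simp: that convex_on_const)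
    then show ?thesis by (simp add: zero)
  qed
  have "(\<lambda>k. \<mu> (F k) - \<mu> (G k)) \<longlonglongrightarrow> 0 - 0"
    by (intro tendsto_diff lim) (use FG in auto)
  then show False using FG(4) by (simp add: LIMSEQ_const_iff)
qed

section \<open>Densities from translates of the hat\<close>

definition hat_density :: "real \<Rightarrow> 'a \<Rightarrow> real" where
  "hat_density n y = (\<mu> (\<lambda>x. max 1 (n * norm (x - y))) - \<mu> (\<lambda>x. n * norm (x - y))) / hat_mass TYPE('a) n"

lemma convex_cone_shift:
  assumes "n \<ge> 0"
  shows "convex_on UNIV (\<lambda>x::'a. n * norm (x - y))" "convex_on UNIV (\<lambda>x::'a. max 1 (n * norm (x - y)))"
proof -
  show "convex_on UNIV (\<lambda>x::'a. n * norm (x - y))"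
    using convex_on_cmul[OF assms convex_on_dist[of UNIV y]] by (simp add: dist_norm norm_minus_commute)
  then show "convex_on UNIV (\<lambda>x::'a. max 1 (n * norm (x - y)))"
    by (intro convex_on_max_UNIV) (auto simp: convex_on_const)
qed

lemma continuous_hat_density:
  assumes n: "n \<ge> 0"
  shows "continuous_on UNIV (hat_density n)"
proof -
  show ?thesis
    unfolding hat_density_def[abs_def] divide_inverse
    by (intro continuous_intros continuous_on_param convex_cone_shift n)
qed

context
  fixes R :: real
  assumes R: "R > 0"
    and supported: "supported_on_cball R"
begin

lemma eq_on_cball_imp_eq:
  "\<lbrakk>convex_on UNIV f; convex_on UNIV g; \<And>x. norm x \<le> R \<Longrightarrow> f x = g x\<rbrakk> \<Longrightarrow> \<mu> f = \<mu> g"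
  using supported unfolding supported_on_cball_def by blast

lemma hat_density_eq_0:
  assumes n: "n \<ge> 1" and y: "norm y > R + 1"
  shows "hat_density n y = 0"
proof -
  have "\<mu> (\<lambda>x. max 1 (n * norm (x - y))) = \<mu> (\<lambda>x. n * norm (x - y))"
  proof (rule eq_on_cball_imp_eq)
    fix x :: 'a assume x: "norm x \<le> R"
    have "1 \<le> norm (x - y)" using x y norm_triangle_ineq2[of y x] by (simp add: norm_minus_commute)
    then have "1 * 1 \<le> n * norm (x - y)" using n by (intro mult_mono) auto
    then show "max 1 (n * norm (x - y)) = n * norm (x - y)" by simp
  qed (use convex_cone_shift n in auto)
  then show ?thesis by (simp add: hat_density_def)
qed

text \<open>On the ball of radius \<open>R\<close> the smoothing of \<open>f + B\<close> is a
  superposition of hats centred at \<open>y\<close> with weights \<open>f y + B \<ge> 0\<close>.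
  Splitting each hat into its two convex parts and moving one to the other side gives the identity
  \<open>PN\<close> between convex functions, to which \<open>\<mu>\<close> applies since it sees
  only that ball.\<close>

lemma hat_smooth_integral:
  assumes f: "convex_on UNIV f" and n: "n \<ge> 1" and B: "\<And>x. norm x \<le> R + 1 \<Longrightarrow> \<bar>f x\<bar> \<le> B"
  shows "\<mu> (hat_smooth n f) = (\<integral>y\<in>cball 0 (R + 1). hat_density n y * (f y + B) \<partial>lborel)"
proof -
  let ?Q = "cball (0::'a) (R + 1)" and ?a = "hat_mass TYPE('a) n"
  have a: "?a > 0" using n by (rule hat_mass_pos)
  have n0: "n \<ge> 0" using n by simp
  have fc: "continuous_on UNIV f" using f by (rule convex_continuous)
  \<comment> \<open>The weight has to be nonnegative and continuous on the whole space; truncation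
    does not change it on the ball of integration.\<close>
  define w where "w y = max 0 (f y + B)" for y
  have wQ: "w y = f y + B" if "norm y \<le> R + 1" for y using B[OF that] by (simp add: w_def)
  have w0: "w y \<ge> 0" for y by (simp add: w_def)
  have wc: "continuous_on UNIV w" unfolding w_def[abs_def] by (intro continuous_intros fc)
  define P where "P x = (\<integral>y\<in>?Q. w y * max 1 (n * norm (x - y)) \<partial>lborel)" for x
  define N where "N x = (\<integral>y\<in>?Q. w y * (n * norm (x - y)) \<partial>lborel)" for x
  have cont: "continuous_on UNIV (\<lambda>y. w y * max 1 (n * norm (x - y)))" "continuous_on UNIV (\<lambda>y. w y * (n * norm (x - y)))" for x
    by (intro continuous_intros wc)+
  have add': "additive (\<lambda>x. w y * max 1 (n * norm (x - y)))" "additive (\<lambda>x. w y * (n * norm (x - y)))" for y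
    by (intro additive_cmul additive_convex_on convex_cone_shift n0 w0)+
  have P: "convex_on UNIV P" "\<mu> P = (\<integral>y\<in>?Q. w y * \<mu> (\<lambda>x. max 1 (n * norm (x - y))) \<partial>lborel)"
    unfolding P_def[abs_def]
    by (rule additive_convex[OF additive_integral(1)[OF add'(1) cont(1)]])
      (simp add: additive_integral(2)[OF add'(1) cont(1)] homog0 convex_cone_shift n0 w0)
  have N: "convex_on UNIV N" "\<mu> N = (\<integral>y\<in>?Q. w y * \<mu> (\<lambda>x. n * norm (x - y)) \<partial>lborel)"
    unfolding N_def[abs_def]
    by (rule additive_convex[OF additive_integral(1)[OF add'(2) cont(2)]])
      (simp only: additive_integral(2)[OF add'(2) cont(2)] homog0 convex_cone_shift n0 w0)
  have S: "convex_on UNIV (\<lambda>x. hat_smooth n f x + B)"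
    by (intro convex_on_add hat_smooth_convex f n) (simp add: convex_on_const)
  have PN: "P x = N x + ?a * (hat_smooth n f x + B)" if x: "norm x \<le> R" for x
  proof -
    have "P x - N x = (\<integral>y\<in>?Q. w y * max 1 (n * norm (x - y)) - w y * (n * norm (x - y)) \<partial>lborel)"
      unfolding P_def N_def
      by (rule set_integral_diff(2)[symmetric]) (intro set_integrable_cball_continuous cont)+
    also have "\<dots> = (\<integral>y. (f y + B) * hat n (y - x) \<partial>lborel)"
      unfolding set_lebesgue_integral_def
    proof (rule Bochner_Integration.integral_cong[OF refl])
      fix y
      have k: "max 1 (n * norm (x - y)) - n * norm (x - y) = hat n (y - x)"
        by (simp add: hat_def norm_minus_commute max_def)
      show "indicator ?Q y *\<^sub>R (w y * max 1 (n * norm (x - y)) - w y * (n * norm (x - y))) = (f y + B) * hat n (y - x)"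
      proof (cases "norm y \<le> R + 1")
        case True
        then show ?thesis using wQ[OF True] by (simp add: right_diff_distrib[symmetric] k)
      next
        case False
        \<comment> \<open>Hats centred outside radius \<open>R + 1\<close> do not reach the ball of
          radius \<open>R\<close>.\<close>
        then have "norm (y - x) > 1" using x norm_triangle_ineq2[of y x] by simp
        then show ?thesis using False hat_eq_0[OF n, of "y - x"] by simp
      qed
    qed
    also have "\<dots> = 1 ^ DIM('a) * (\<integral>z. (f (x + 1 *\<^sub>R z) + B) * hat n ((x + 1 *\<^sub>R z) - x) \<partial>lborel)"
    proof (rule integral_lborel_affine)
      show "(\<lambda>y. (f y + B) * hat n (y - x)) \<in> borel_measurable borel"
        unfolding hat_def by (intro borel_measurable_continuous_onI continuous_intros fc)
    qed simp
    also have "\<dots> = (\<integral>z. f (x + z) * hat n z + B * hat n z \<partial>lborel)" by (simp add: algebra_simps)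
    also have "\<dots> = (\<integral>z. f (x + z) * hat n z \<partial>lborel) + B * ?a"
    proof -
      have fx: "continuous_on UNIV (\<lambda>z. f (x + z))"
        by (intro convex_continuous convex_on_compose_affine[OF f]) (simp add: algebra_simps)
      have "integrable lborel (\<lambda>z. f (x + z) * hat n z)" "integrable lborel (\<lambda>z::'a. B * hat n z)"
        by (intro integrable_hat n fx continuous_intros)+
      then show ?thesis by (simp add: hat_mass_def)
    qed
    also have "\<dots> = ?a * (hat_smooth n f x + B)" using a by (simp add: hat_smooth_def algebra_simps)
    finally show ?thesis by simp
  qed
  have aS: "convex_on UNIV (\<lambda>x. ?a * (hat_smooth n f x + B))" using a S by (intro convex_on_cmul) auto
  have "\<mu> P = \<mu> (\<lambda>x. N x + ?a * (hat_smooth n f x + B))"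
    by (rule eq_on_cball_imp_eq) (use P N aS PN in auto)
  also have "\<dots> = \<mu> N + ?a * \<mu> (hat_smooth n f)"
    using add[OF N(1) aS] homog[OF S a] add_const[OF hat_smooth_convex[OF f n]] by simp
  finally have "\<mu> (hat_smooth n f) = (\<mu> P - \<mu> N) / ?a" using a by simp
  also have "\<mu> P - \<mu> N = (\<integral>y\<in>?Q. w y * \<mu> (\<lambda>x. max 1 (n * norm (x - y))) - w y * \<mu> (\<lambda>x. n * norm (x - y)) \<partial>lborel)"
    unfolding P N
  proof (rule set_integral_diff(2)[symmetric])
    have "continuous_on UNIV (\<lambda>y. w y * \<mu> (\<lambda>x. max 1 (n * norm (x - y))))"
      "continuous_on UNIV (\<lambda>y. w y * \<mu> (\<lambda>x. n * norm (x - y)))"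
      by (intro continuous_intros continuous_on_param wc convex_cone_shift n0)+
    then show "set_integrable lborel ?Q (\<lambda>y. w y * \<mu> (\<lambda>x. max 1 (n * norm (x - y))))"
      "set_integrable lborel ?Q (\<lambda>y. w y * \<mu> (\<lambda>x. n * norm (x - y)))"
      by (auto intro: set_integrable_cball_continuous)
  qed
  also have "\<dots> / ?a = (\<integral>y\<in>?Q. (w y * \<mu> (\<lambda>x. max 1 (n * norm (x - y))) - w y * \<mu> (\<lambda>x. n * norm (x - y))) / ?a \<partial>lborel)"
    by (rule set_integral_divide_zero[symmetric])
  also have "\<dots> = (\<integral>y\<in>?Q. hat_density n y * (f y + B) \<partial>lborel)"
    by (rule set_lebesgue_integral_cong) (auto simp: wQ hat_density_def diff_divide_distrib algebra_simps)
  finally show ?thesis .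
qed

lemma integrable_hat_density:
  assumes n: "n \<ge> 1" and f: "continuous_on UNIV f"
  shows "integrable lborel (\<lambda>y. hat_density n y * f y)"
    and "(\<integral>y\<in>cball 0 (R + 1). hat_density n y * f y \<partial>lborel) = (\<integral>y. hat_density n y * f y \<partial>lborel)"
proof -
  have eq: "indicator (cball 0 (R + 1)) y *\<^sub>R (hat_density n y * f y) = hat_density n y * f y" for y
    using hat_density_eq_0[OF n, of y] by (auto simp: indicator_def)
  have "set_integrable lborel (cball 0 (R + 1)) (\<lambda>y. hat_density n y * f y)"
    using n by (intro set_integrable_cball_continuous continuous_intros continuous_hat_density f) auto
  then show "integrable lborel (\<lambda>y. hat_density n y * f y)" unfolding set_integrable_def eq .
  show "(\<integral>y\<in>cball 0 (R + 1). hat_density n y * f y \<partial>lborel) = (\<integral>y. hat_density n y * f y \<partial>lborel)"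
    unfolding set_lebesgue_integral_def eq ..
qed

text \<open>This is \<open>hat_smooth_integral\<close> for \<open>f = 0\<close> and
  \<open>B = 1\<close>. It removes the shift by \<open>B\<close> from the representation.\<close>

lemma integral_hat_density:
  assumes n: "n \<ge> 1"
  shows "(\<integral>y. hat_density n y \<partial>lborel) = 0"
proof -
  have "hat_smooth n (\<lambda>_::'a. 0) = (\<lambda>_. 0)" by (simp add: hat_smooth_def fun_eq_iff)
  then show ?thesis
    using hat_smooth_integral[of "\<lambda>_. 0" n 1] n zero integrable_hat_density(2)[of n "\<lambda>_. 1"]
    by (simp add: convex_on_const continuous_on_const)
qed

lemma integral_hat_density_mult:
  assumes f: "convex_on UNIV f" and n: "n \<ge> 1"
  shows "(\<integral>y. hat_density n y * f y \<partial>lborel) = \<mu> (hat_smooth n f)"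
proof -
  obtain B where B: "B > 0" "\<And>x. norm x \<le> R + 1 \<Longrightarrow> \<bar>f x\<bar> \<le> B"
    using convex_bounded_on_cball[OF f] by blast
  have fc: "continuous_on UNIV f" using f by (rule convex_continuous)
  have i: "integrable lborel (\<lambda>y. hat_density n y * f y)" "integrable lborel (\<lambda>y. hat_density n y * B)"
    by (intro integrable_hat_density(1)[OF n] fc continuous_intros)+
  have "\<mu> (hat_smooth n f) = (\<integral>y. hat_density n y * (f y + B) \<partial>lborel)"
    using hat_smooth_integral[OF f n B(2)] integrable_hat_density(2)[OF n, of "\<lambda>y. f y + B"]
      continuous_on_add[OF fc continuous_on_const[of _ B]] by simp
  also have "\<dots> = (\<integral>y. hat_density n y * f y + hat_density n y * B \<partial>lborel)" by (simp add: algebra_simps)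
  also have "\<dots> = (\<integral>y. hat_density n y * f y \<partial>lborel) + (\<integral>y. hat_density n y \<partial>lborel) * B"
    using i by simp
  finally show ?thesis using integral_hat_density[OF n] by simp
qed

lemma integral_hat_density_affine:
  assumes n: "n \<ge> 1"
  shows "(\<integral>y. hat_density n y * (w \<bullet> y + c) \<partial>lborel) = 0"
proof -
  obtain c' where "\<And>x. hat_smooth n (\<lambda>x. w \<bullet> x + c) x = w \<bullet> x + c'"
    using hat_smooth_affine[OF n] by blast
  then have "hat_smooth n (\<lambda>x. w \<bullet> x + c) = (\<lambda>x. w \<bullet> x + c')" by blast
  then show ?thesis using integral_hat_density_mult[OF convex_on_affine n] affine by simp
qed

end

text \<open>If uniformity failed, pick functions violating it along indices tending to infinity and
  extract a pointwise convergent subsequence by \<open>convex_subsequence\<close>. By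
  \<open>hat_smooth_close\<close> the smoothings converge to the same limit, so continuity of
  \<open>\<mu>\<close> forces the two values together.\<close>

lemma hat_smooth_uniform:
  fixes F :: "'b \<Rightarrow> 'a \<Rightarrow> real"
  assumes F: "\<And>u. u \<in> K \<Longrightarrow> convex_on UNIV (F u)" and bd: "\<And>x. \<exists>B. \<forall>u\<in>K. \<bar>F u x\<bar> \<le> B"
  shows "uniform_limit K (\<lambda>j u. \<mu> (hat_smooth (real (Suc j)) (F u))) (\<lambda>u. \<mu> (F u)) sequentially"
proof (rule ccontr)
  assume "\<not> ?thesis"
  then obtain \<epsilon> where \<epsilon>: "\<epsilon> > 0"
    "\<not> (\<forall>\<^sub>F j in sequentially. \<forall>u\<in>K. dist (\<mu> (hat_smooth (real (Suc j)) (F u))) (\<mu> (F u)) < \<epsilon>)"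
    by (auto simp: uniform_limit_iff)
  from not_eventually_sequentiallyD[OF \<epsilon>(2)] obtain s where s: "strict_mono (s::nat\<Rightarrow>nat)"
    "\<And>j. \<exists>u\<in>K. \<not> dist (\<mu> (hat_smooth (real (Suc (s j))) (F u))) (\<mu> (F u)) < \<epsilon>" by blast
  then obtain u where u: "\<And>j. u j \<in> K" "\<And>j. \<not> dist (\<mu> (hat_smooth (real (Suc (s j))) (F (u j)))) (\<mu> (F (u j))) < \<epsilon>"
    by metis
  have Fu: "convex_on UNIV (F (u j))" for j using F u(1) by blast
  have bu: "\<exists>B. \<forall>j. \<bar>F (u j) x\<bar> \<le> B" for x using bd[of x] u(1) by blast
  obtain r f where r: "strict_mono (r::nat\<Rightarrow>nat)" "\<And>x. (\<lambda>j. F (u (r j)) x) \<longlonglongrightarrow> f x"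
    using convex_subsequence[of "\<lambda>j. F (u j)", OF Fu bu] by blast
  have f: "convex_on UNIV f" using convex_on_limit[OF Fu r(2)] .
  define n where "n j = real (Suc (s (r j)))" for j
  have n1: "n j \<ge> 1" for j by (simp add: n_def)
  have lim: "(\<lambda>j. hat_smooth (n j) (F (u (r j))) x) \<longlonglongrightarrow> f x" for x
  proof -
    obtain B where B: "B > 0" "\<And>j y. norm y \<le> norm x + 2 \<Longrightarrow> \<bar>F (u (r j)) y\<bar> \<le> B"
      using convex_sequence_bounded[OF Fu r(2)] by blast
    have "(\<lambda>j. hat_smooth (n j) (F (u (r j))) x - F (u (r j)) x) \<longlonglongrightarrow> 0"
    proof (rule Lim_null_comparison)
      show "\<forall>\<^sub>F j in sequentially. norm (hat_smooth (n j) (F (u (r j))) x - F (u (r j)) x) \<le> 2 * B / n j"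
        using hat_smooth_close[OF Fu n1 B(2) order_refl] by (auto intro!: always_eventually)
      have "(\<lambda>j. 2 * B * inverse (n j)) \<longlonglongrightarrow> 2 * B * 0"
        unfolding n_def
        using LIMSEQ_subseq_LIMSEQ[OF LIMSEQ_inverse_real_of_nat strict_mono_o[OF s(1) r(1)]]
        by (intro tendsto_intros) (simp add: o_def)
      then show "(\<lambda>j. 2 * B / n j) \<longlonglongrightarrow> 0" by (simp add: divide_inverse)
    qed
    from tendsto_add[OF this r(2)[of x]] show ?thesis by simp
  qed
  have "(\<lambda>j. \<mu> (hat_smooth (n j) (F (u (r j))))) \<longlonglongrightarrow> \<mu> f"
    by (rule conts) (use hat_smooth_convex[OF Fu n1] f lim in auto)
  moreover have "(\<lambda>j. \<mu> (F (u (r j)))) \<longlonglongrightarrow> \<mu> f"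
    by (rule conts) (use Fu f r(2) in auto)
  ultimately have "(\<lambda>j. dist (\<mu> (hat_smooth (n j) (F (u (r j))))) (\<mu> (F (u (r j))))) \<longlonglongrightarrow> dist (\<mu> f) (\<mu> f)"
    by (rule tendsto_dist)
  then have "\<forall>\<^sub>F j in sequentially. dist (\<mu> (hat_smooth (n j) (F (u (r j))))) (\<mu> (F (u (r j)))) < \<epsilon>"
    using \<epsilon>(1) by (intro order_tendstoD(2)) auto
  then show False using u(2) unfolding n_def by simp
qed

end

section \<open>Approximation of epi-homogeneous valuations\<close>

lemma fenchel_add_affine:
  "fenchel (\<lambda>x. ereal (f x + (w \<bullet> x + c))) = (\<lambda>y. fenchel (\<lambda>x. ereal (f x)) (y - w) + ereal (- c))"
proof
  fix y
  have "fenchel (\<lambda>x. ereal (f x)) (y - w) + ereal (- c) = (SUP x. ereal (x \<bullet> (y - w)) - ereal (f x) + ereal (- c))"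
    unfolding fenchel_def by (subst SUP_ereal_add_left) auto
  also have "\<dots> = fenchel (\<lambda>x. ereal (f x + (w \<bullet> x + c))) y"
    unfolding fenchel_def by (simp add: inner_diff_right inner_commute algebra_simps)
  finally show "fenchel (\<lambda>x. ereal (f x + (w \<bullet> x + c))) y = fenchel (\<lambda>x. ereal (f x)) (y - w) + ereal (- c)" ..
qed

lemma fenchel_cmul:
  assumes t: "t > 0"
  shows "fenchel (\<lambda>x. ereal (t * f x)) = (\<lambda>y. ereal t * fenchel (\<lambda>x. ereal (f x)) ((1 / t) *\<^sub>R y))"
proof
  fix y
  have "ereal t * fenchel (\<lambda>x. ereal (f x)) ((1 / t) *\<^sub>R y)
      = (SUP x. ereal t * (ereal (x \<bullet> ((1 / t) *\<^sub>R y)) - ereal (f x)))"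
    unfolding fenchel_def by (subst Sup_ereal_mult_left') (use t in \<open>auto simp: image_image\<close>)
  also have "\<dots> = fenchel (\<lambda>x. ereal (t * f x)) y"
    unfolding fenchel_def using t by (simp add: algebra_simps)
  finally show "fenchel (\<lambda>x. ereal (t * f x)) y = ereal t * fenchel (\<lambda>x. ereal (f x)) ((1 / t) *\<^sub>R y)" ..
qed

text \<open>Open sets are defined by sequences, so the preimage of a neighbourhood of
  \<open>Z u\<close> contains almost all \<open>us j\<close>.\<close>

lemma continuous_map_epi_sequentially:
  fixes Z :: "('a::euclidean_space \<Rightarrow> ereal) \<Rightarrow> real"
  assumes Z: "continuous_map epi_topology euclideanreal Z"
    and us: "range us \<subseteq> Conv_sc" "u \<in> Conv_sc" "epi_converges us u"
  shows "(\<lambda>j. Z (us j)) \<longlonglongrightarrow> Z u"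
proof (rule topological_tendstoI)
  fix S assume S: "open S" "Z u \<in> S"
  have "openin epi_topology {v \<in> topspace epi_topology. Z v \<in> S}"
    by (rule openin_continuous_map_preimage[OF Z]) (use S in simp)
  then have "epi_open {v \<in> Conv_sc. Z v \<in> S}"
    by (simp add: openin_epi_topology topspace_epi_topology)
  then have "\<forall>\<^sub>F j in sequentially. us j \<in> {v \<in> Conv_sc. Z v \<in> S}"
    using us S unfolding epi_open_def by blast
  then show "\<forall>\<^sub>F j in sequentially. Z (us j) \<in> S" by (rule eventually_mono) simp
qed

lemma ereal_convex_lsc:
  assumes "convex_on UNIV (f :: 'a::euclidean_space \<Rightarrow> real)"
  shows "lower_semicontinuous (\<lambda>x. ereal (f x))"
proof (rule lower_semicontinuousI)
  fix x a assume a: "ereal a < ereal (f x)"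
  have "isCont f x" using convex_continuous[OF assms, of UNIV] by (simp add: continuous_on_eq_continuous_at)
  then have "(f \<longlongrightarrow> f x) (nhds x)" by (simp add: continuous_at tendsto_at_iff_tendsto_nhds)
  then have "\<forall>\<^sub>F z in nhds x. a < f z" using a by (intro order_tendstoD) auto
  then show "\<forall>\<^sub>F z in nhds x. ereal a < ereal (f z)" by simp
qed

text \<open>The dictionary of conjugation: minima and maxima are exchanged, adding an affine
  function becomes an epi-translation, a positive factor becomes epi-multiplication, pointwise
  convergence becomes epi-convergence. Convexity of the minimum is what \<open>fenchel_max\<close>
  needs.\<close>

lemma dual_valuation_fenchel:
  fixes Z :: "('a::euclidean_space \<Rightarrow> ereal) \<Rightarrow> real"
  assumes cont: "continuous_map epi_topology euclideanreal Z"
    and val: "valuation Z"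
    and inv: "epi_translation_invariant Z"
    and hom: "epi_homogeneous 1 Z"
  shows "dual_valuation (\<lambda>f. Z (fenchel (\<lambda>x. ereal (f x))))"
proof
  fix f g :: "'a \<Rightarrow> real"
  assume f: "convex_on UNIV f" and g: "convex_on UNIV g" and fg: "convex_on UNIV (\<lambda>x. min (f x) (g x))"
  let ?u = "fenchel (\<lambda>x. ereal (f x))" and ?v = "fenchel (\<lambda>x. ereal (g x))"
  have mx: "fenchel (\<lambda>x. ereal (max (f x) (g x))) = (\<lambda>y. min (?u y) (?v y))"
  proof
    fix y
    have "convex_ereal (\<lambda>x. min (ereal (f x)) (ereal (g x)))"
      using fg by (simp add: convex_ereal_iff flip: ereal_min)
    from fenchel_max[OF _ ereal_convex_lsc[OF f] _ ereal_convex_lsc[OF g] this, of y]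
    show "fenchel (\<lambda>x. ereal (max (f x) (g x))) y = min (?u y) (?v y)"
      by (simp flip: ereal_max)
  qed
  have mn: "fenchel (\<lambda>x. ereal (min (f x) (g x))) = (\<lambda>y. max (?u y) (?v y))"
    using fenchel_min[of "\<lambda>x. ereal (f x)" "\<lambda>x. ereal (g x)"] by (auto simp flip: ereal_min)
  have "?u \<in> Conv_sc" "?v \<in> Conv_sc" "(\<lambda>y. min (?u y) (?v y)) \<in> Conv_sc" "(\<lambda>y. max (?u y) (?v y)) \<in> Conv_sc"
    using fenchel_convex_in_Conv_sc[OF f] fenchel_convex_in_Conv_sc[OF g]
      fenchel_convex_in_Conv_sc[OF convex_on_max_UNIV[OF f g]] fenchel_convex_in_Conv_sc[OF fg]
    unfolding mx mn by auto
  then show "Z (fenchel (\<lambda>x. ereal (max (f x) (g x)))) + Z (fenchel (\<lambda>x. ereal (min (f x) (g x)))) = Z ?u + Z ?v"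
    using val unfolding mx mn valuation_def by blast
next
  fix f :: "'a \<Rightarrow> real" and w c assume f: "convex_on UNIV f"
  show "Z (fenchel (\<lambda>x. ereal (f x + (w \<bullet> x + c)))) = Z (fenchel (\<lambda>x. ereal (f x)))"
    using inv fenchel_convex_in_Conv_sc[OF f] unfolding epi_translation_invariant_def fenchel_add_affine by blast
next
  fix f :: "'a \<Rightarrow> real" and t :: real assume f: "convex_on UNIV f" and t: "t > 0"
  show "Z (fenchel (\<lambda>x. ereal (t * f x))) = t * Z (fenchel (\<lambda>x. ereal (f x)))"
    using hom fenchel_convex_in_Conv_sc[OF f] t unfolding epi_homogeneous_def fenchel_cmul[OF t] by simp
next
  fix F and f :: "'a \<Rightarrow> real"
  assume F: "\<And>j. convex_on UNIV (F j)" "convex_on UNIV f" "\<And>x. (\<lambda>j. F j x) \<longlonglongrightarrow> f x"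
  show "(\<lambda>j. Z (fenchel (\<lambda>x. ereal (F j x)))) \<longlonglongrightarrow> Z (fenchel (\<lambda>x. ereal (f x)))"
    by (rule continuous_map_epi_sequentially[OF cont _ _ fenchel_epi_converges[OF F(1,3)]])
      (use F fenchel_convex_in_Conv_sc in auto)
qed

theorem theorem1p7:
  fixes Z :: "(real ^ 'n \<Rightarrow> ereal) \<Rightarrow> real"
  assumes "continuous_map epi_topology euclideanreal Z"
    and "valuation Z"
    and "epi_translation_invariant Z"
    and "epi_homogeneous 1 Z"
  shows "\<exists>(Zs :: nat \<Rightarrow> (real ^ 'n \<Rightarrow> ereal) \<Rightarrow> real) (\<phi> :: nat \<Rightarrow> real ^ 'n \<Rightarrow> real).
           (\<forall>j. integrable lebesgue (\<phi> j)) \<and>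
           (\<exists>R>0. \<forall>j. closure {x. \<phi> j x \<noteq> 0} \<subseteq> cball 0 R) \<and>
           (\<forall>j. \<forall>f c. linear f \<longrightarrow> integral\<^sup>L lebesgue (\<lambda>x. \<phi> j x * (f x + c)) = 0) \<and>
           (\<forall>j. valuation (Zs j)) \<and>
           (\<forall>j. \<forall>u\<in>Conv_sc.
              Zs j u = integral\<^sup>L lebesgue (\<lambda>x. \<phi> j x * real_of_ereal (fenchel u x))) \<and>
           (\<forall>K. compactin epi_topology K \<longrightarrow> uniform_limit K Zs Z sequentially)"
proof -
  define \<mu> where "\<mu> f = Z (fenchel (\<lambda>x. ereal (f x)))" for f :: "real ^ 'n \<Rightarrow> real"
  interpret dual_valuation \<mu>
    unfolding \<mu>_def[abs_def] by (rule dual_valuation_fenchel[OF assms])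
  define dual where "dual u x = real_of_ereal (fenchel u x)" for u :: "real ^ 'n \<Rightarrow> ereal" and x
  have dual: "convex_on UNIV (dual u)" "\<mu> (dual u) = Z u" if "u \<in> Conv_sc" for u
  proof -
    show "convex_on UNIV (dual u)" unfolding dual_def[abs_def] by (rule fenchel_Conv_sc_convex[OF that])
    show "\<mu> (dual u) = Z u"
      unfolding \<mu>_def dual_def[abs_def] by (simp add: fenchel_Conv_sc_finite[OF that] fenchel_fenchel[OF that])
  qed
  obtain R where R: "R > 0" "supported_on_cball R"
    using compact_support by blast
  \<comment> \<open>The index is shifted by one because the hat lemmas ask for
    \<open>n \<ge> 1\<close>.\<close>
  define \<phi> where "\<phi> j = hat_density (real (Suc j))" for j
  have n1: "real (Suc j) \<ge> 1" for j by simp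
  have \<phi>c: "continuous_on UNIV (\<phi> j)" for j unfolding \<phi>_def by (rule continuous_hat_density) simp
  \<comment> \<open>Lebesgue measure is the completion of \<open>lborel\<close>; on Borel measurable
    integrands the integrals agree, so the computations may use \<open>lborel\<close>.\<close>
  have lebesgue: "integral\<^sup>L lebesgue (\<lambda>x. \<phi> j x * f x) = (\<integral>x. \<phi> j x * f x \<partial>lborel)"
    if "continuous_on UNIV f" for j f
    by (intro integral_completion) (use borel_measurable_continuous_onI[OF continuous_on_mult[OF \<phi>c that]] in simp)
  define Zs where "Zs j u = integral\<^sup>L lebesgue (\<lambda>x. \<phi> j x * real_of_ereal (fenchel u x))" for j u
  have Zs: "Zs j u = \<mu> (hat_smooth (real (Suc j)) (dual u))" and
    Zs_lborel: "Zs j u = (\<integral>x. \<phi> j x * dual u x \<partial>lborel)" and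
    int: "integrable lborel (\<lambda>x. \<phi> j x * dual u x)" if "u \<in> Conv_sc" for j u
  proof -
    have c: "continuous_on UNIV (dual u)" using dual(1)[OF that] by (rule convex_continuous)
    then show 1: "Zs j u = (\<integral>x. \<phi> j x * dual u x \<partial>lborel)"
      unfolding Zs_def dual_def[symmetric] by (rule lebesgue)
    show "Zs j u = \<mu> (hat_smooth (real (Suc j)) (dual u))"
      unfolding 1 \<phi>_def by (rule integral_hat_density_mult[OF R dual(1)[OF that] n1])
    show "integrable lborel (\<lambda>x. \<phi> j x * dual u x)"
      unfolding \<phi>_def by (rule integrable_hat_density(1)[OF R n1 c])
  qed
  show ?thesis
  proof (intro exI[of _ Zs] exI[of _ \<phi>] conjI allI ballI impI)
    fix j
    have "integrable lborel (\<lambda>x. \<phi> j x * 1)"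
      unfolding \<phi>_def by (rule integrable_hat_density(1)[OF R n1 continuous_on_const])
    then show "integrable lebesgue (\<phi> j)" by (simp add: integrable_completion)
  next
    show "\<exists>R>0. \<forall>j. closure {x. \<phi> j x \<noteq> 0} \<subseteq> cball 0 R"
    proof (intro exI[of _ "R + 1"] conjI allI closure_minimal)
      show "{x. \<phi> j x \<noteq> 0} \<subseteq> cball 0 (R + 1)" for j
      proof
        fix x assume x: "x \<in> {x. \<phi> j x \<noteq> 0}"
        show "x \<in> cball 0 (R + 1)"
        proof (rule ccontr)
          assume "x \<notin> cball 0 (R + 1)"
          then have "norm x > R + 1" by simp
          then have "\<phi> j x = 0" unfolding \<phi>_def by (rule hat_density_eq_0[OF R n1])
          then show False using x by simp
        qed
      qed
    qed (use R(1) in auto)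
  next
    fix j and f :: "real ^ 'n \<Rightarrow> real" and c assume f: "linear f"
    \<comment> \<open>A linear functional is the inner product with
      \<open>adjoint f 1\<close>.\<close>
    have eq: "f x + c = adjoint f 1 \<bullet> x + c" for x
      using adjoint_works[OF f, of x 1] by (simp add: inner_commute)
    have c: "continuous_on UNIV (\<lambda>x. adjoint f 1 \<bullet> x + c)" by (intro continuous_intros)
    show "integral\<^sup>L lebesgue (\<lambda>x. \<phi> j x * (f x + c)) = 0"
      unfolding eq lebesgue[OF c] by (subst \<phi>_def) (rule integral_hat_density_affine[OF R n1])
  next
    fix j
    show "valuation (Zs j)"
      unfolding valuation_def
    proof (intro allI impI, elim conjE)
      fix u v :: "real ^ 'n \<Rightarrow> ereal"
      let ?m = "\<lambda>x. min (u x) (v x)" and ?M = "\<lambda>x. max (u x) (v x)"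
      assume uv: "u \<in> Conv_sc" "v \<in> Conv_sc" "?m \<in> Conv_sc" "?M \<in> Conv_sc"
      \<comment> \<open>The conjugates of the minimum and the maximum are the maximum and the
        minimum of the conjugates, so the sum is the same at every point.\<close>
      have "dual ?m x + dual ?M x = dual u x + dual v x" for x
      proof -
        have "fenchel ?M x = min (fenchel u x) (fenchel v x)"
          by (rule fenchel_max) (use Conv_scD uv in auto)
        then show ?thesis
          unfolding dual_def fenchel_min
          by (cases "fenchel u x \<le> fenchel v x") (auto simp: min_def max_def)
      qed
      then have "\<phi> j x * dual ?m x + \<phi> j x * dual ?M x = \<phi> j x * dual u x + \<phi> j x * dual v x" for x
        by (metis distrib_left)
      then show "Zs j ?m + Zs j ?M = Zs j u + Zs j v"
        using uv int by (simp add: Zs_lborel flip: Bochner_Integration.integral_add)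
    qed
  next
    fix j and u :: "real ^ 'n \<Rightarrow> ereal"
    show "Zs j u = integral\<^sup>L lebesgue (\<lambda>x. \<phi> j x * real_of_ereal (fenchel u x))"
      by (simp add: Zs_def)
  next
    fix K :: "(real ^ 'n \<Rightarrow> ereal) set" assume K: "compactin epi_topology K"
    then have KC: "K \<subseteq> Conv_sc" by (simp add: compactin_def topspace_epi_topology)
    have "uniform_limit K (\<lambda>j u. \<mu> (hat_smooth (real (Suc j)) (dual u))) (\<lambda>u. \<mu> (dual u)) sequentially"
      by (rule hat_smooth_uniform)
        (use dual(1) KC compactin_fenchel_bounded[OF K] in \<open>auto simp: dual_def\<close>)
    then show "uniform_limit K Zs Z sequentially"
      by (rule uniform_limit_cong[THEN iffD1, rotated -1])
        (use KC Zs dual(2) in \<open>auto intro!: always_eventually\<close>)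
  qed
qed

end
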